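(* Let $k$ be a field and let $S=k\langle X:Y\rangle$ be a finitely presented $k$-algebra, with finite generating set $X=\{x_1,\dots,x_a\}$ and finite set of relations $Y=\{y_1,\dots,y_b\}\subset k\langle X\rangle$. Let $n$ be the integer, $A$ the finite dimensional $k$-algebra, and $\sigma=\{\hat e_1,\dots,\hat e_{n-1}\}$ the set of maps between finitely generated projective $A$-modules, constructed from this presentation as described in the context. Then there is an isomorphism of rings $$\sigma^{-1}A\;\cong\; M_n(S).$$
   Context: Algebras are associative with $1$. $k\langle X:Y\rangle$ denotes the quotient of the free algebra $k\langle X\rangle$ by the two-sided ideal generated by $Y$. Quivers with relations. A quiver has a finite set of vertices and a finite set of arrows, each arrow $c$ having a tail $tc$ and a head $hc$. A path of length $i$ from $v$ to $w$ is a word $c_1\cdots c_i$ in the arrows with $hc_j=tc_{j+1}$ for $1\le j<i$, $tc_1=v$, $hc_i=w$; at each vertex $v$ there is a path $f_v$ of length $0$. The path algebra $\Lambda(Q)$ has the set of all paths as $k$-basis, with product given by concatenation of paths (written left to right, and zero if the head of the first path is not the tail of the second) and $1=\sum_v f_v$. Given a finite set $R$ of relations, each a linear combination of paths with common tail and common head, the path algebra of the quiver with relations $(Q,R)$ is $\Lambda(Q)$ modulo the two-sided ideal generated by $R$. Construction of $n$, $A$, $\sigma$. Write each $y_j$ uniquely as $y_j=\sum_{\ell=1}^{c_j}\lambda_{j\ell}w_{j\ell}$ with $0\ne\lambda_{j\ell}\in k$ and $w_{j\ell}$ distinct words in $X$. Let $n-1$ be the maximal length of the words $w_{j\ell}$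 (if no word occurs, i.e. there are no nonzero relations, put $n=2$). Let $Q$ be the quiver with vertices $1,\dots,n$ and, for each $1\le m\le n-1$, arrows $e_m$ and $a_{mi}$ ($1\le i\le a$), all from $m$ to $m+1$. For $1\le s<t\le n$ put $e_{s,t}=e_s e_{s+1}\cdots e_{t-1}$, and let $e_{m,m}$ be the path of length $0$ at $m$. Let $$T=\{\,a_{1i}e_{2,n}-e_{1,m}a_{mi}e_{m+1,n} : 1<m<n,\ 1\le i\le a\,\}.$$ For a word $w=x_{i_1}\cdots x_{i_u}$ of length $u<n$ put $w'=a_{1,i_1}a_{2,i_2}\cdots a_{u,i_u}e_{u+1,n}$, a path from $1$ to $n$, and let $Y'=\{y'_j:1\le j\le b\}$ with $y_j'=\sum_{\ell=1}^{c_j}\lambda_{j\ell}w'_{j\ell}$. Then $A$ is the path algebra of the quiver with relations $(Q,T\cup Y')$. For each vertex $m$ let $P_m=f_mA$ be the corresponding projective right $A$-module (representation of the quiver). A path $p$ from $s$ to $t$ induces the homomorphism $\hat p:P_t\to P_s$ given by left multiplication by $p$. Put $\sigma=\{\hat e_1,\dots,\hat e_{n-1}\}$. Universal localization. For a ring $A$ and a set $\sigma$ of maps between finitely generated projective $A$-modules, a ring homomorphism $A\to B$ is $\sigma$-inverting if every $s\in\sigma$ becomes an isomorphism after base change to $B$; the universal localization $A\to\sigma^{-1}A$ is the initial $\sigma$-inverting ring homomorphism. *)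

theory Defs
  imports "HOL-Algebra.QuotRing" "HOL-Algebra.Module" "HOL-Algebra.Generated_Groups"
    "HOL-Algebra.Free_Abelian_Groups" "Graph_Theory.Arc_Walk"
begin

section \<open>Free algebras, path algebras, quivers with relations\<close>

text \<open>
  The algebra with basis \<open>P\<close>, where \<open>pcomp\<close> is a partial product on \<open>P\<close> (\<open>None\<close> means that the
  product is zero) and \<open>I\<close> is the finite set of basis elements that sum to the unit. Elements are
  finitely supported coefficient functions. Free algebras (words under concatenation) and path
  algebras (paths under concatenation) are the two instances.
\<close>
definition span_algebra ::
  "('k, 'm) ring_scheme \<Rightarrow> 'p set \<Rightarrow> 'p set \<Rightarrow> ('p \<Rightarrow> 'p \<Rightarrow> 'p option) \<Rightarrow> ('p \<Rightarrow> 'k) ring" where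
  "span_algebra K P I pcomp =
    \<lparr>carrier = {f. (\<forall>p \<in> P. f p \<in> carrier K) \<and> (\<forall>p. p \<notin> P \<longrightarrow> f p = \<zero>\<^bsub>K\<^esub>) \<and>
                   finite {p. f p \<noteq> \<zero>\<^bsub>K\<^esub>}},
     monoid.mult = (\<lambda>f g r. \<Oplus>\<^bsub>K\<^esub>pq \<in> {(p, q). f p \<noteq> \<zero>\<^bsub>K\<^esub> \<and> g q \<noteq> \<zero>\<^bsub>K\<^esub> \<and> pcomp p q = Some r}.
                         f (fst pq) \<otimes>\<^bsub>K\<^esub> g (snd pq)),
     one = (\<lambda>p. if p \<in> I then \<one>\<^bsub>K\<^esub> else \<zero>\<^bsub>K\<^esub>),
     ring.zero = (\<lambda>p. \<zero>\<^bsub>K\<^esub>),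
     add = (\<lambda>f g p. f p \<oplus>\<^bsub>K\<^esub> g p)\<rparr>"

text \<open>The element \<open>c \<cdot> p\<close>, a scalar multiple of one basis element.\<close>
definition term_elt :: "('k, 'm) ring_scheme \<Rightarrow> 'k \<Rightarrow> 'p \<Rightarrow> 'p \<Rightarrow> 'k" where
  "term_elt K c p = (\<lambda>q. if q = p then c else \<zero>\<^bsub>K\<^esub>)"

definition free_algebra :: "('k, 'm) ring_scheme \<Rightarrow> 'x set \<Rightarrow> ('x list \<Rightarrow> 'k) ring" where
  "free_algebra K X = span_algebra K (lists X) {[]} (\<lambda>u v. Some (u @ v))"

definition presented_algebra ::
  "('k, 'm) ring_scheme \<Rightarrow> 'x set \<Rightarrow> ('x list \<Rightarrow> 'k) set \<Rightarrow> ('x list \<Rightarrow> 'k) set ring" where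
  "presented_algebra K X Y = free_algebra K X Quot (Idl\<^bsub>free_algebra K X\<^esub> Y)"

text \<open>
  A quiver is a directed multigraph; a path is stored as (start, list of arrows, end), so that
  \<open>(v, [], v)\<close> is the path of length \<open>0\<close> at \<open>v\<close>.
\<close>
type_synonym ('v, 'e) path = "'v \<times> 'e list \<times> 'v"

definition paths :: "('v, 'e) pre_digraph \<Rightarrow> ('v, 'e) path set" where
  "paths Q = {(v, p, w). pre_digraph.awalk Q v p w}"

fun path_comp :: "('v, 'e) path \<Rightarrow> ('v, 'e) path \<Rightarrow> ('v, 'e) path option" where
  "path_comp (u, p, v) (v', q, w) = (if v = v' then Some (u, p @ q, w) else None)"

definition path_algebra ::
  "('k, 'm) ring_scheme \<Rightarrow> ('v, 'e) pre_digraph \<Rightarrow> (('v, 'e) path \<Rightarrow> 'k) ring" where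
  "path_algebra K Q = span_algebra K (paths Q) {(v, [], v) | v. v \<in> verts Q} path_comp"

definition bound_path_algebra ::
  "('k, 'm) ring_scheme \<Rightarrow> ('v, 'e) pre_digraph \<Rightarrow> (('v, 'e) path \<Rightarrow> 'k) set
     \<Rightarrow> (('v, 'e) path \<Rightarrow> 'k) set ring" where
  "bound_path_algebra K Q R = path_algebra K Q Quot (Idl\<^bsub>path_algebra K Q\<^esub> R)"


section \<open>Matrix rings\<close>

definition matrix_ring :: "nat \<Rightarrow> ('s, 'm) ring_scheme \<Rightarrow> (nat \<times> nat \<Rightarrow> 's) ring" where
  "matrix_ring n S =
    \<lparr>carrier = {1..n} \<times> {1..n} \<rightarrow>\<^sub>E carrier S,
     monoid.mult = (\<lambda>M N. \<lambda>(i, j) \<in> {1..n} \<times> {1..n}. \<Oplus>\<^bsub>S\<^esub>l \<in> {1..n}. M (i, l) \<otimes>\<^bsub>S\<^esub> N (l, j)),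
     one = (\<lambda>(i, j) \<in> {1..n} \<times> {1..n}. if i = j then \<one>\<^bsub>S\<^esub> else \<zero>\<^bsub>S\<^esub>),
     ring.zero = (\<lambda>(i, j) \<in> {1..n} \<times> {1..n}. \<zero>\<^bsub>S\<^esub>),
     add = (\<lambda>M N. \<lambda>(i, j) \<in> {1..n} \<times> {1..n}. M (i, j) \<oplus>\<^bsub>S\<^esub> N (i, j))\<rparr>"


section \<open>Right modules\<close>

text \<open>
  As in \<^theory>\<open>HOL-Algebra.Module\<close>, the record extends rings only to inherit the additive part; the
  fields \<open>mult\<close> and \<open>one\<close> are not used.
\<close>
record ('a, 'b) rmodule = "'b ring" +
  act :: "'b \<Rightarrow> 'a \<Rightarrow> 'b"

locale right_module = R: ring R + M: abelian_group M
  for R :: "('a, 'm) ring_scheme" and M :: "('a, 'b, 'n) rmodule_scheme" +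
  assumes act_closed: "\<lbrakk>x \<in> carrier M; a \<in> carrier R\<rbrakk> \<Longrightarrow> act M x a \<in> carrier M"
    and act_add_left: "\<lbrakk>x \<in> carrier M; y \<in> carrier M; a \<in> carrier R\<rbrakk>
          \<Longrightarrow> act M (x \<oplus>\<^bsub>M\<^esub> y) a = act M x a \<oplus>\<^bsub>M\<^esub> act M y a"
    and act_add_right: "\<lbrakk>x \<in> carrier M; a \<in> carrier R; b \<in> carrier R\<rbrakk>
          \<Longrightarrow> act M x (a \<oplus>\<^bsub>R\<^esub> b) = act M x a \<oplus>\<^bsub>M\<^esub> act M x b"
    and act_mult: "\<lbrakk>x \<in> carrier M; a \<in> carrier R; b \<in> carrier R\<rbrakk>
          \<Longrightarrow> act M x (a \<otimes>\<^bsub>R\<^esub> b) = act M (act M x a) b"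
    and act_one: "x \<in> carrier M \<Longrightarrow> act M x \<one>\<^bsub>R\<^esub> = x"

definition rmodule_hom ::
  "('a, 'm) ring_scheme \<Rightarrow> ('a, 'b, 'n) rmodule_scheme \<Rightarrow> ('a, 'c, 'o) rmodule_scheme
     \<Rightarrow> ('b \<Rightarrow> 'c) set" where
  "rmodule_hom R M N = {h. h \<in> carrier M \<rightarrow> carrier N \<and>
     (\<forall>x \<in> carrier M. \<forall>y \<in> carrier M. h (x \<oplus>\<^bsub>M\<^esub> y) = h x \<oplus>\<^bsub>N\<^esub> h y) \<and>
     (\<forall>x \<in> carrier M. \<forall>a \<in> carrier R. h (act M x a) = act N (h x) a)}"

definition rmodule_iso ::
  "('a, 'm) ring_scheme \<Rightarrow> ('a, 'b, 'n) rmodule_scheme \<Rightarrow> ('a, 'c, 'o) rmodule_scheme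
     \<Rightarrow> ('b \<Rightarrow> 'c) set" where
  "rmodule_iso R M N = {h \<in> rmodule_hom R M N. bij_betw h (carrier M) (carrier N)}"

definition free_rmodule :: "('a, 'm) ring_scheme \<Rightarrow> nat \<Rightarrow> ('a, nat \<Rightarrow> 'a) rmodule" where
  "free_rmodule R r =
    \<lparr>carrier = {..<r} \<rightarrow>\<^sub>E carrier R, monoid.mult = undefined, one = undefined,
     ring.zero = (\<lambda>i \<in> {..<r}. \<zero>\<^bsub>R\<^esub>),
     add = (\<lambda>x y. \<lambda>i \<in> {..<r}. x i \<oplus>\<^bsub>R\<^esub> y i),
     act = (\<lambda>x a. \<lambda>i \<in> {..<r}. x i \<otimes>\<^bsub>R\<^esub> a)\<rparr>"

text \<open>Finitely generated projective: a direct summand of some \<open>R\<^sup>r\<close>.\<close>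
definition fg_projective :: "('a, 'm) ring_scheme \<Rightarrow> ('a, 'b, 'n) rmodule_scheme \<Rightarrow> bool" where
  "fg_projective R M \<longleftrightarrow> right_module R M \<and>
     (\<exists>r. \<exists>\<iota> \<in> rmodule_hom R M (free_rmodule R r). \<exists>\<pi> \<in> rmodule_hom R (free_rmodule R r) M.
        \<forall>x \<in> carrier M. \<pi> (\<iota> x) = x)"


section \<open>Base change and universal localization\<close>

text \<open>
  Base change of a right \<open>A\<close>-module \<open>M\<close> along a ring homomorphism \<open>\<phi>: A \<rightarrow> B\<close> is \<open>M \<otimes>\<^sub>A B\<close>, realised
  as the free abelian group on \<open>M \<times> B\<close> modulo the subgroup generated by the usual relations.
\<close>
definition tensor_relations ::
  "('a, 'm) ring_scheme \<Rightarrow> ('b, 'n) ring_scheme \<Rightarrow> ('a \<Rightarrow> 'b) \<Rightarrow> ('a, 'c, 'o) rmodule_scheme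
     \<Rightarrow> ('c \<times> 'b \<Rightarrow>\<^sub>0 int) set" where
  "tensor_relations A B \<phi> M =
     {frag_of (x \<oplus>\<^bsub>M\<^esub> y, b) - frag_of (x, b) - frag_of (y, b) | x y b.
        x \<in> carrier M \<and> y \<in> carrier M \<and> b \<in> carrier B} \<union>
     {frag_of (x, b \<oplus>\<^bsub>B\<^esub> c) - frag_of (x, b) - frag_of (x, c) | x b c.
        x \<in> carrier M \<and> b \<in> carrier B \<and> c \<in> carrier B} \<union>
     {frag_of (act M x a, b) - frag_of (x, \<phi> a \<otimes>\<^bsub>B\<^esub> b) | x a b.
        x \<in> carrier M \<and> a \<in> carrier A \<and> b \<in> carrier B}"

definition tensor_gens ::
  "('b, 'n) ring_scheme \<Rightarrow> ('a, 'c, 'o) rmodule_scheme \<Rightarrow> ('c \<times> 'b \<Rightarrow>\<^sub>0 int) monoid" where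
  "tensor_gens B M = free_Abelian_group (carrier M \<times> carrier B)"

definition tensor_null ::
  "('a, 'm) ring_scheme \<Rightarrow> ('b, 'n) ring_scheme \<Rightarrow> ('a \<Rightarrow> 'b) \<Rightarrow> ('a, 'c, 'o) rmodule_scheme
     \<Rightarrow> ('c \<times> 'b \<Rightarrow>\<^sub>0 int) set" where
  "tensor_null A B \<phi> M = generate (tensor_gens B M) (tensor_relations A B \<phi> M)"

text \<open>
  The map \<open>M \<otimes>\<^sub>A B \<rightarrow> N \<otimes>\<^sub>A B\<close> which on generators is given by \<open>(x, b) \<mapsto> g (x, b)\<close>. A coset \<open>C\<close> is
  sent to the set of all sums of an element of the null subgroup and the image of an element of \<open>C\<close>,
  which is again a single coset whenever \<open>g\<close> respects the relations.
\<close>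
definition tensor_induced ::
  "('a, 'm) ring_scheme \<Rightarrow> ('b, 'n) ring_scheme \<Rightarrow> ('a \<Rightarrow> 'b) \<Rightarrow> ('a, 'd, 'p) rmodule_scheme
     \<Rightarrow> ('c \<times> 'b \<Rightarrow> 'd \<times> 'b) \<Rightarrow> ('c \<times> 'b \<Rightarrow>\<^sub>0 int) set \<Rightarrow> ('d \<times> 'b \<Rightarrow>\<^sub>0 int) set" where
  "tensor_induced A B \<phi> N g C =
     tensor_null A B \<phi> N <#>\<^bsub>tensor_gens B N\<^esub> (frag_extend (\<lambda>z. frag_of (g z)) ` C)"

definition base_change ::
  "('a, 'm) ring_scheme \<Rightarrow> ('b, 'n) ring_scheme \<Rightarrow> ('a \<Rightarrow> 'b) \<Rightarrow> ('a, 'c, 'o) rmodule_scheme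
     \<Rightarrow> ('b, ('c \<times> 'b \<Rightarrow>\<^sub>0 int) set) rmodule" where
  "base_change A B \<phi> M =
    (let T = tensor_gens B M Mod tensor_null A B \<phi> M in
     \<lparr>carrier = carrier T, monoid.mult = undefined, one = undefined,
      ring.zero = \<one>\<^bsub>T\<^esub>,
      add = monoid.mult T,
      act = (\<lambda>C b. tensor_induced A B \<phi> M (\<lambda>(x, c). (x, c \<otimes>\<^bsub>B\<^esub> b)) C)\<rparr>)"

definition base_change_map ::
  "('a, 'm) ring_scheme \<Rightarrow> ('b, 'n) ring_scheme \<Rightarrow> ('a \<Rightarrow> 'b) \<Rightarrow> ('a, 'd, 'p) rmodule_scheme
     \<Rightarrow> ('c \<Rightarrow> 'd) \<Rightarrow> ('c \<times> 'b \<Rightarrow>\<^sub>0 int) set \<Rightarrow> ('d \<times> 'b \<Rightarrow>\<^sub>0 int) set" where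
  "base_change_map A B \<phi> N s = tensor_induced A B \<phi> N (\<lambda>(x, b). (s x, b))"

text \<open>A module map is stored together with its domain and codomain.\<close>
type_synonym ('a, 'c) module_map = "('a, 'c) rmodule \<times> ('a, 'c) rmodule \<times> ('c \<Rightarrow> 'c)"

definition fg_projective_maps :: "('a, 'm) ring_scheme \<Rightarrow> ('a, 'c) module_map set" where
  "fg_projective_maps A =
     {(P, Q, s). fg_projective A P \<and> fg_projective A Q \<and> s \<in> rmodule_hom A P Q}"

definition inverting ::
  "('a, 'm) ring_scheme \<Rightarrow> ('a, 'c) module_map set \<Rightarrow> ('b, 'n) ring_scheme \<Rightarrow> ('a \<Rightarrow> 'b) \<Rightarrow> bool" where
  "inverting A \<sigma> B \<phi> \<longleftrightarrow> ring B \<and> \<phi> \<in> ring_hom A B \<and>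
     (\<forall>(P, Q, s) \<in> \<sigma>. base_change_map A B \<phi> Q s
        \<in> rmodule_iso B (base_change A B \<phi> P) (base_change A B \<phi> Q))"

text \<open>
  \<open>\<phi>: A \<rightarrow> L\<close> is the universal localization of \<open>A\<close> at \<open>\<sigma>\<close>, i.e. the initial \<open>\<sigma>\<close>-inverting ring
  homomorphism. HOL cannot quantify over types inside a formula, so the type \<open>'u\<close> of the elements of
  the test rings is a parameter; it is the type variable of the otherwise unused first argument. A statement in which \<open>'u\<close> is a
  free type variable covers all test rings; for an isomorphism between two such \<open>L\<close> it suffices to
  test on rings over the element types of both.
\<close>
definition universal_localization ::
  "'u itself \<Rightarrow> ('a, 'm) ring_scheme \<Rightarrow> ('a, 'c) module_map set
     \<Rightarrow> ('l, 'n) ring_scheme \<Rightarrow> ('a \<Rightarrow> 'l) \<Rightarrow> bool" where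
  "universal_localization U A \<sigma> L \<phi> \<longleftrightarrow>
     ring A \<and> \<sigma> \<subseteq> fg_projective_maps A \<and> inverting A \<sigma> L \<phi> \<and>
     (\<forall>(B :: 'u ring) \<psi>. inverting A \<sigma> B \<psi> \<longrightarrow>
        (\<exists>!\<theta>. \<theta> \<in> ring_hom L B \<and> \<theta> \<in> extensional (carrier L) \<and>
              (\<forall>a \<in> carrier A. \<theta> (\<phi> a) = \<psi> a)))"


section \<open>The construction of \<open>n\<close>, \<open>A\<close> and \<open>\<sigma>\<close> from a presentation\<close>

definition size_of_pres :: "('k, 'm) ring_scheme \<Rightarrow> ('x list \<Rightarrow> 'k) set \<Rightarrow> nat" where
  "size_of_pres K Y =
    (let W = {w. \<exists>y \<in> Y. y w \<noteq> \<zero>\<^bsub>K\<^esub>} in if W = {} then 2 else Max (length ` W) + 1)"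

text \<open>\<open>E m\<close> is the arrow \<open>e\<^sub>m\<close> and \<open>G m x\<^sub>i\<close> is the arrow \<open>a\<^sub>m\<^sub>i\<close>.\<close>
datatype 'x arrow = E (level: nat) | G (level: nat) (gen: 'x)

definition loc_quiver :: "nat \<Rightarrow> 'x set \<Rightarrow> (nat, 'x arrow) pre_digraph" where
  "loc_quiver n X =
    \<lparr>verts = {1..n},
     arcs = {E m | m. 1 \<le> m \<and> m < n} \<union> {G m x | m x. 1 \<le> m \<and> m < n \<and> x \<in> X},
     tail = level,
     head = (\<lambda>c. level c + 1)\<rparr>"

definition e_path :: "nat \<Rightarrow> nat \<Rightarrow> (nat, 'x arrow) path" where
  "e_path s t = (s, map E [s..<t], t)"

definition T_rels ::
  "('k, 'm) ring_scheme \<Rightarrow> nat \<Rightarrow> 'x set \<Rightarrow> ((nat, 'x arrow) path \<Rightarrow> 'k) set" where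
  "T_rels K n X =
    {term_elt K \<one>\<^bsub>K\<^esub> (1, G 1 x # map E [2..<n], n)
       \<ominus>\<^bsub>path_algebra K (loc_quiver n X)\<^esub>
     term_elt K \<one>\<^bsub>K\<^esub> (1, map E [1..<m] @ G m x # map E [m + 1..<n], n)
     | m x. 1 < m \<and> m < n \<and> x \<in> X}"

text \<open>For \<open>w = x\<^sub>1 \<dots> x\<^sub>u\<close> this is the path \<open>G 1 x\<^sub>1, \<dots>, G u x\<^sub>u\<close> followed by \<open>e_path (u + 1) n\<close>.\<close>
definition word_path :: "nat \<Rightarrow> 'x list \<Rightarrow> (nat, 'x arrow) path" where
  "word_path n w =
    (1, map2 G [1..<length w + 1] w @ map E [length w + 1..<n], n)"

definition Y_rel ::
  "('k, 'm) ring_scheme \<Rightarrow> nat \<Rightarrow> 'x set \<Rightarrow> ('x list \<Rightarrow> 'k) \<Rightarrow> (nat, 'x arrow) path \<Rightarrow> 'k" where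
  "Y_rel K n X y =
    (\<Oplus>\<^bsub>path_algebra K (loc_quiver n X)\<^esub>w \<in> {w. y w \<noteq> \<zero>\<^bsub>K\<^esub>}. term_elt K (y w) (word_path n w))"

definition loc_rels ::
  "('k, 'm) ring_scheme \<Rightarrow> 'x set \<Rightarrow> ('x list \<Rightarrow> 'k) set \<Rightarrow> ((nat, 'x arrow) path \<Rightarrow> 'k) set" where
  "loc_rels K X Y =
    (let n = size_of_pres K Y in T_rels K n X \<union> Y_rel K n X ` Y)"

definition loc_algebra ::
  "('k, 'm) ring_scheme \<Rightarrow> 'x set \<Rightarrow> ('x list \<Rightarrow> 'k) set
     \<Rightarrow> ((nat, 'x arrow) path \<Rightarrow> 'k) set ring" where
  "loc_algebra K X Y =
     bound_path_algebra K (loc_quiver (size_of_pres K Y) X) (loc_rels K X Y)"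

text \<open>The class in \<open>A\<close> of a path.\<close>
definition path_class ::
  "('k, 'm) ring_scheme \<Rightarrow> 'x set \<Rightarrow> ('x list \<Rightarrow> 'k) set \<Rightarrow> (nat, 'x arrow) path
     \<Rightarrow> ((nat, 'x arrow) path \<Rightarrow> 'k) set" where
  "path_class K X Y p =
    (let \<Lambda> = path_algebra K (loc_quiver (size_of_pres K Y) X)
     in Idl\<^bsub>\<Lambda>\<^esub> (loc_rels K X Y) +>\<^bsub>\<Lambda>\<^esub> term_elt K \<one>\<^bsub>K\<^esub> p)"

text \<open>The right module \<open>fA\<close>.\<close>
definition principal_rmodule :: "('a, 'm) ring_scheme \<Rightarrow> 'a \<Rightarrow> ('a, 'a) rmodule" where
  "principal_rmodule A f =
    \<lparr>carrier = {f \<otimes>\<^bsub>A\<^esub> a | a. a \<in> carrier A}, monoid.mult = undefined, one = undefined,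
     ring.zero = \<zero>\<^bsub>A\<^esub>, add = add A, act = monoid.mult A\<rparr>"

definition vertex_module ::
  "('k, 'm) ring_scheme \<Rightarrow> 'x set \<Rightarrow> ('x list \<Rightarrow> 'k) set \<Rightarrow> nat
     \<Rightarrow> (((nat, 'x arrow) path \<Rightarrow> 'k) set, ((nat, 'x arrow) path \<Rightarrow> 'k) set) rmodule" where
  "vertex_module K X Y m = principal_rmodule (loc_algebra K X Y) (path_class K X Y (m, [], m))"

definition path_map ::
  "('k, 'm) ring_scheme \<Rightarrow> 'x set \<Rightarrow> ('x list \<Rightarrow> 'k) set \<Rightarrow> (nat, 'x arrow) path
     \<Rightarrow> (((nat, 'x arrow) path \<Rightarrow> 'k) set, ((nat, 'x arrow) path \<Rightarrow> 'k) set) module_map" where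
  "path_map K X Y p =
    (case p of (s, _, t) \<Rightarrow>
      (vertex_module K X Y t, vertex_module K X Y s,
       \<lambda>a. path_class K X Y p \<otimes>\<^bsub>loc_algebra K X Y\<^esub> a))"

definition loc_maps ::
  "('k, 'm) ring_scheme \<Rightarrow> 'x set \<Rightarrow> ('x list \<Rightarrow> 'k) set
     \<Rightarrow> (((nat, 'x arrow) path \<Rightarrow> 'k) set, ((nat, 'x arrow) path \<Rightarrow> 'k) set) module_map set" where
  "loc_maps K X Y = {path_map K X Y (m, [E m], m + 1) | m. 1 \<le> m \<and> m < size_of_pres K Y}"

end

theory Submission
  imports Defs
begin

text \<open>
  Write \<open>S = k\<langle>X : Y\<rangle>\<close>. The universal \<open>\<sigma>\<close>-inverting map is \<open>\<phi>: A \<rightarrow> M\<^sub>n(S)\<close>, which sends the class of a path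
  from \<open>i\<close> to \<open>j\<close> to the matrix whose only nonzero entry, in position \<open>(i, j)\<close>, is the product of the
  generators \<open>x\<close> that label the arrows of the path, the arrows \<open>e\<^sub>m\<close> contributing \<open>1\<close>. Both sides of a relation
  in \<open>T\<close> become \<open>x\<close> in position \<open>(1, n)\<close>, and \<open>y'\<close> becomes \<open>y = 0\<close> there, so \<open>\<phi>\<close> is well defined
  (\<open>Phi_kills\<close>); and \<open>e\<^sub>m\<close> becomes the matrix unit in position \<open>(m, m + 1)\<close>, which is inverted by the one in
  position \<open>(m + 1, m)\<close> (\<open>phi_inverting\<close>).

  For universality, base change has to be made concrete. If \<open>f\<close> is idempotent then \<open>fA \<otimes>\<^sub>A B\<close> is the right
  ideal \<open>\<psi>(f)B\<close>, through \<open>x \<otimes> b \<mapsto> \<psi>(x)b\<close>, and left multiplication by \<open>p \<in> f'Af\<close> turns into left multiplication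
  by \<open>\<psi>(p)\<close>. So \<open>\<psi>: A \<rightarrow> B\<close> inverts this map precisely when some \<open>g \<in> \<psi>(f)B\<psi>(f')\<close> satisfies \<open>\<psi>(p)g = \<psi>(f')\<close>
  and \<open>g\<psi>(p) = \<psi>(f)\<close> (\<open>base_change_principal_iso_iff\<close>).

  Given such a \<open>g\<^sub>m\<close> for every \<open>e\<^sub>m\<close>, the elements \<open>U\<^sub>m = \<psi>(e\<^sub>1 \<dots> e\<^sub>m\<^sub>-\<^sub>1)\<close> and \<open>V\<^sub>m = g\<^sub>m\<^sub>-\<^sub>1 \<dots> g\<^sub>1\<close> connect the
  vertices \<open>1\<close> and \<open>m\<close> in both directions, and the products \<open>V\<^sub>i U\<^sub>j\<close> are matrix units of \<open>B\<close>. Everything can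
  now be transported to vertex \<open>1\<close>: the relations \<open>T\<close> say exactly that all arrows \<open>a\<^sub>m\<^sub>i\<close> with the same \<open>i\<close>
  come from one loop \<open>s\<^sub>i = \<psi>(a\<^sub>1\<^sub>i)V\<^sub>2\<close>, namely \<open>\<psi>(a\<^sub>m\<^sub>i) = V\<^sub>m s\<^sub>i U\<^sub>m\<^sub>+\<^sub>1\<close> (\<open>img_G\<close>), so that a path from \<open>i\<close> to \<open>j\<close>
  with word \<open>w\<close> has image \<open>V\<^sub>i w(s) U\<^sub>j\<close> (\<open>img_path\<close>). The relations \<open>Y'\<close> then read \<open>y(s) = 0\<close>
  (\<open>rho_kills\<close>), and \<open>x\<^sub>i \<mapsto> s\<^sub>i\<close> defines a map \<open>\<rho>\<close> from \<open>S\<close> to the corner of \<open>B\<close> at vertex \<open>1\<close>. The required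
  homomorphism \<open>M\<^sub>n(S) \<rightarrow> B\<close> sends \<open>t\<close> in position \<open>(i, j)\<close> to \<open>V\<^sub>i \<rho>(t) U\<^sub>j\<close> (\<open>extension_exists\<close>). No other
  choice is possible, because inverses are unique and \<open>M\<^sub>n(S)\<close> is generated by the image of \<open>A\<close> together with
  the inverses of the matrix units in positions \<open>(m, m + 1)\<close> (\<open>extension_values\<close>).

  Free algebras, path algebras and matrix rings are handled by one construction, an algebra with a
  basis on which a partial product is given; homomorphisms out of it are obtained by prescribing them on the
  terms \<open>c \<cdot> p\<close>. The second half of the theorem is the usual uniqueness of initial objects, with the two
  element types of the test rings taken from the two rings that are compared.
\<close>

(* Rewriting 1 to Suc 0 inside the index ranges {1..n} would separate the rings that contain
   these ranges as parameters from the facts about them. *)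
declare One_nat_def [simp del]

section \<open>Algebras with a basis\<close>

lemma additive_finsum:
  assumes "abelian_group R" "abelian_group B"
    and closed: "\<And>x. x \<in> carrier R \<Longrightarrow> h x \<in> carrier B"
    and add: "\<And>x y. \<lbrakk>x \<in> carrier R; y \<in> carrier R\<rbrakk> \<Longrightarrow> h (x \<oplus>\<^bsub>R\<^esub> y) = h x \<oplus>\<^bsub>B\<^esub> h y"
    and f: "\<And>i. i \<in> I \<Longrightarrow> f i \<in> carrier R"
  shows "h (\<Oplus>\<^bsub>R\<^esub>i\<in>I. f i) = (\<Oplus>\<^bsub>B\<^esub>i\<in>I. h (f i))"
proof -
  interpret R: abelian_group R by fact
  interpret B: abelian_group B by fact
  have zero: "h \<zero>\<^bsub>R\<^esub> = \<zero>\<^bsub>B\<^esub>"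
    using add[of "\<zero>\<^bsub>R\<^esub>" "\<zero>\<^bsub>R\<^esub>"] closed[of "\<zero>\<^bsub>R\<^esub>"] by simp
  show ?thesis
    using f
  proof (induction I rule: infinite_finite_induct)
    case (insert i I)
    then have "f \<in> I \<rightarrow> carrier R" "f i \<in> carrier R" "(\<lambda>i. h (f i)) \<in> I \<rightarrow> carrier B"
      using closed by auto
    with insert closed show ?case by (simp add: add R.finsum_closed)
  qed (simp_all add: zero)
qed

text \<open>The conditions under which \<open>span_algebra\<close> is a ring. In the associativity law a product that is zero
  is \<open>None\<close>, and the unit laws say that exactly one element of \<open>I\<close> acts on \<open>p\<close>, from either side, and all
  others annihilate it.\<close>
locale basis_algebra = ring K for K (structure) +
  fixes P I :: "'p set" and pcomp :: "'p \<Rightarrow> 'p \<Rightarrow> 'p option"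
  assumes units_subset: "I \<subseteq> P" and finite_units: "finite I"
    and pcomp_closed: "\<lbrakk>p \<in> P; q \<in> P; pcomp p q = Some r\<rbrakk> \<Longrightarrow> r \<in> P"
    and pcomp_assoc: "\<lbrakk>p \<in> P; q \<in> P; r \<in> P\<rbrakk> \<Longrightarrow>
      Option.bind (pcomp p q) (\<lambda>s. pcomp s r) = Option.bind (pcomp q r) (pcomp p)"
    and left_unit: "p \<in> P \<Longrightarrow> \<exists>i\<in>I. \<forall>j\<in>I. pcomp j p = (if j = i then Some p else None)"
    and right_unit: "p \<in> P \<Longrightarrow> \<exists>i\<in>I. \<forall>j\<in>I. pcomp p j = (if j = i then Some p else None)"
begin

abbreviation alg where "alg \<equiv> span_algebra K P I pcomp"
abbreviation trm where "trm \<equiv> term_elt K"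

lemma alg_carrier_iff:
  "f \<in> carrier alg \<longleftrightarrow> (\<forall>p\<in>P. f p \<in> carrier K) \<and> (\<forall>p. p \<notin> P \<longrightarrow> f p = \<zero>) \<and> finite {p. f p \<noteq> \<zero>}"
  by (simp add: span_algebra_def)

lemma alg_coeff_closed: "f \<in> carrier alg \<Longrightarrow> f p \<in> carrier K"
  unfolding alg_carrier_iff by (cases "p \<in> P") auto

lemma alg_finite_support: "f \<in> carrier alg \<Longrightarrow> finite {p. f p \<noteq> \<zero>}"
  unfolding alg_carrier_iff by blast

lemma alg_support_subset: "f \<in> carrier alg \<Longrightarrow> {p. f p \<noteq> \<zero>} \<subseteq> P"
  unfolding alg_carrier_iff by blast

lemma alg_add: "f \<oplus>\<^bsub>alg\<^esub> g = (\<lambda>p. f p \<oplus> g p)"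
  by (simp add: span_algebra_def)

lemma alg_zero: "\<zero>\<^bsub>alg\<^esub> = (\<lambda>p. \<zero>)"
  by (simp add: span_algebra_def)

lemma alg_one: "\<one>\<^bsub>alg\<^esub> = (\<lambda>p. if p \<in> I then \<one> else \<zero>)"
  by (simp add: span_algebra_def)

lemma alg_add_closed:
  assumes "f \<in> carrier alg" "g \<in> carrier alg" shows "f \<oplus>\<^bsub>alg\<^esub> g \<in> carrier alg"
proof -
  have "{p. f p \<oplus> g p \<noteq> \<zero>} \<subseteq> {p. f p \<noteq> \<zero>} \<union> {p. g p \<noteq> \<zero>}" by auto
  then have "finite {p. f p \<oplus> g p \<noteq> \<zero>}"
    using alg_finite_support[OF assms(1)] alg_finite_support[OF assms(2)]
    by (meson finite_UnI finite_subset)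
  then show ?thesis using assms by (auto simp: alg_carrier_iff alg_add)
qed

lemma alg_zero_closed: "\<zero>\<^bsub>alg\<^esub> \<in> carrier alg"
  by (simp add: alg_carrier_iff alg_zero)

lemma alg_one_closed: "\<one>\<^bsub>alg\<^esub> \<in> carrier alg"
proof -
  have "finite {p. \<one>\<^bsub>alg\<^esub> p \<noteq> \<zero>}"
    by (rule finite_subset[OF _ finite_units]) (auto simp: alg_one split: if_splits)
  then show ?thesis
    using units_subset by (auto simp: alg_carrier_iff alg_one)
qed

lemma alg_abelian_group: "abelian_group alg"
proof (rule abelian_groupI)
  fix f assume f: "f \<in> carrier alg"
  have "{p. \<ominus> f p \<noteq> \<zero>} \<subseteq> {p. f p \<noteq> \<zero>}" by auto
  then have "(\<lambda>p. \<ominus> f p) \<in> carrier alg"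
    using f by (auto simp: alg_carrier_iff intro: finite_subset)
  moreover have "(\<lambda>p. \<ominus> f p) \<oplus>\<^bsub>alg\<^esub> f = \<zero>\<^bsub>alg\<^esub>"
    using alg_coeff_closed[OF f] by (simp add: alg_add alg_zero l_neg)
  ultimately show "\<exists>g\<in>carrier alg. g \<oplus>\<^bsub>alg\<^esub> f = \<zero>\<^bsub>alg\<^esub>" by blast
qed (simp_all add: alg_add_closed alg_zero_closed,
     simp_all add: alg_add alg_zero alg_coeff_closed add.m_ac)

sublocale alg: abelian_group alg by (rule alg_abelian_group)

text \<open>The sum defining a coefficient of a product may be taken over any finite rectangle that
  contains the supports; with a common rectangle, products become comparable term by term.\<close>
lemma alg_mult_coeff:
  assumes "f \<in> carrier alg" "g \<in> carrier alg" "finite F" "finite F'"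
    and "{p. f p \<noteq> \<zero>} \<subseteq> F" "{p. g p \<noteq> \<zero>} \<subseteq> F'"
  shows "(f \<otimes>\<^bsub>alg\<^esub> g) r =
    (\<Oplus>z\<in>F \<times> F'. if pcomp (fst z) (snd z) = Some r then f (fst z) \<otimes> g (snd z) else \<zero>)"
proof -
  have "(f \<otimes>\<^bsub>alg\<^esub> g) r = (\<Oplus>z\<in>{(p, q). f p \<noteq> \<zero> \<and> g q \<noteq> \<zero> \<and> pcomp p q = Some r}.
     f (fst z) \<otimes> g (snd z))"
    by (simp add: span_algebra_def)
  also have "\<dots> = (\<Oplus>z\<in>F \<times> F'. if pcomp (fst z) (snd z) = Some r then f (fst z) \<otimes> g (snd z) else \<zero>)"
    using assms by (intro add.finprod_mono_neutral_cong_left) (auto simp: alg_coeff_closed)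
  finally show ?thesis .
qed

lemma alg_mult_closed:
  assumes f: "f \<in> carrier alg" and g: "g \<in> carrier alg"
  shows "f \<otimes>\<^bsub>alg\<^esub> g \<in> carrier alg"
proof -
  let ?F = "{p. f p \<noteq> \<zero>}" and ?G = "{p. g p \<noteq> \<zero>}"
  let ?s = "\<lambda>r z. if pcomp (fst z) (snd z) = Some r then f (fst z) \<otimes> g (snd z) else \<zero>"
  have eq: "(f \<otimes>\<^bsub>alg\<^esub> g) r = (\<Oplus>z\<in>?F \<times> ?G. ?s r z)" for r
    using assms by (intro alg_mult_coeff) (auto simp: alg_finite_support)
  have zero: "(f \<otimes>\<^bsub>alg\<^esub> g) r = \<zero>"
    if "r \<notin> (\<lambda>z. the (pcomp (fst z) (snd z))) ` (?F \<times> ?G) \<or> r \<notin> P" for r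
    unfolding eq
  proof (rule add.finprod_one_eqI)
    fix z assume z: "z \<in> ?F \<times> ?G"
    then have "fst z \<in> P" "snd z \<in> P"
      using alg_support_subset[OF f] alg_support_subset[OF g] by auto
    then have "pcomp (fst z) (snd z) \<noteq> Some r"
      using that z pcomp_closed by (metis (no_types, lifting) image_eqI option.sel)
    then show "?s r z = \<zero>" by simp
  qed
  have "finite {r. (f \<otimes>\<^bsub>alg\<^esub> g) r \<noteq> \<zero>}"
    by (rule finite_subset[of _ "(\<lambda>z. the (pcomp (fst z) (snd z))) ` (?F \<times> ?G)"])
       (use zero assms alg_finite_support in auto)
  moreover have "(f \<otimes>\<^bsub>alg\<^esub> g) r \<in> carrier K" for r
    unfolding eq using assms by (intro finsum_closed) (auto simp: alg_coeff_closed)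
  ultimately show ?thesis using zero by (auto simp: alg_carrier_iff)
qed

lemma alg_l_distr:
  assumes f: "f \<in> carrier alg" and g: "g \<in> carrier alg" and h: "h \<in> carrier alg"
  shows "(f \<oplus>\<^bsub>alg\<^esub> g) \<otimes>\<^bsub>alg\<^esub> h = f \<otimes>\<^bsub>alg\<^esub> h \<oplus>\<^bsub>alg\<^esub> g \<otimes>\<^bsub>alg\<^esub> h"
proof
  fix r
  let ?F = "{p. f p \<noteq> \<zero>} \<union> {p. g p \<noteq> \<zero>}" and ?H = "{p. h p \<noteq> \<zero>}"
  have fin: "finite ?F" "finite ?H" using assms by (auto simp: alg_finite_support)
  have "((f \<oplus>\<^bsub>alg\<^esub> g) \<otimes>\<^bsub>alg\<^esub> h) r = (\<Oplus>z\<in>?F \<times> ?H. if pcomp (fst z) (snd z) = Some r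
      then (f \<oplus>\<^bsub>alg\<^esub> g) (fst z) \<otimes> h (snd z) else \<zero>)"
    by (rule alg_mult_coeff) (use assms fin in \<open>auto simp: alg_add alg_add_closed[unfolded alg_add]\<close>)
  also have "\<dots> = (\<Oplus>z\<in>?F \<times> ?H.
      (if pcomp (fst z) (snd z) = Some r then f (fst z) \<otimes> h (snd z) else \<zero>) \<oplus>
      (if pcomp (fst z) (snd z) = Some r then g (fst z) \<otimes> h (snd z) else \<zero>))"
    by (rule finsum_cong') (auto simp: alg_add l_distr alg_coeff_closed assms)
  also have "\<dots> = (f \<otimes>\<^bsub>alg\<^esub> h) r \<oplus> (g \<otimes>\<^bsub>alg\<^esub> h) r"
    using assms fin by (subst finsum_addf, simp_all add: alg_coeff_closed Pi_def)
      (subst (1 2) alg_mult_coeff[where F = ?F and F' = ?H], auto)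
  finally show "((f \<oplus>\<^bsub>alg\<^esub> g) \<otimes>\<^bsub>alg\<^esub> h) r = (f \<otimes>\<^bsub>alg\<^esub> h \<oplus>\<^bsub>alg\<^esub> g \<otimes>\<^bsub>alg\<^esub> h) r"
    by (simp add: alg_add)
qed

lemma alg_r_distr:
  assumes f: "f \<in> carrier alg" and g: "g \<in> carrier alg" and h: "h \<in> carrier alg"
  shows "h \<otimes>\<^bsub>alg\<^esub> (f \<oplus>\<^bsub>alg\<^esub> g) = h \<otimes>\<^bsub>alg\<^esub> f \<oplus>\<^bsub>alg\<^esub> h \<otimes>\<^bsub>alg\<^esub> g"
proof
  fix r
  let ?F = "{p. f p \<noteq> \<zero>} \<union> {p. g p \<noteq> \<zero>}" and ?H = "{p. h p \<noteq> \<zero>}"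
  have fin: "finite ?F" "finite ?H" using assms by (auto simp: alg_finite_support)
  have "(h \<otimes>\<^bsub>alg\<^esub> (f \<oplus>\<^bsub>alg\<^esub> g)) r = (\<Oplus>z\<in>?H \<times> ?F. if pcomp (fst z) (snd z) = Some r
      then h (fst z) \<otimes> (f \<oplus>\<^bsub>alg\<^esub> g) (snd z) else \<zero>)"
    by (rule alg_mult_coeff) (use assms fin in \<open>auto simp: alg_add alg_add_closed[unfolded alg_add]\<close>)
  also have "\<dots> = (\<Oplus>z\<in>?H \<times> ?F.
      (if pcomp (fst z) (snd z) = Some r then h (fst z) \<otimes> f (snd z) else \<zero>) \<oplus>
      (if pcomp (fst z) (snd z) = Some r then h (fst z) \<otimes> g (snd z) else \<zero>))"
    by (rule finsum_cong') (auto simp: alg_add r_distr alg_coeff_closed assms)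
  also have "\<dots> = (h \<otimes>\<^bsub>alg\<^esub> f) r \<oplus> (h \<otimes>\<^bsub>alg\<^esub> g) r"
    using assms fin by (subst finsum_addf, simp_all add: alg_coeff_closed Pi_def)
      (subst (1 2) alg_mult_coeff[where F = ?H and F' = ?F], auto)
  finally show "(h \<otimes>\<^bsub>alg\<^esub> (f \<oplus>\<^bsub>alg\<^esub> g)) r = (h \<otimes>\<^bsub>alg\<^esub> f \<oplus>\<^bsub>alg\<^esub> h \<otimes>\<^bsub>alg\<^esub> g) r"
    by (simp add: alg_add)
qed

lemma alg_zero_mult:
  assumes "f \<in> carrier alg"
  shows "\<zero>\<^bsub>alg\<^esub> \<otimes>\<^bsub>alg\<^esub> f = \<zero>\<^bsub>alg\<^esub>" "f \<otimes>\<^bsub>alg\<^esub> \<zero>\<^bsub>alg\<^esub> = \<zero>\<^bsub>alg\<^esub>"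
  by (auto simp: span_algebra_def)

lemma trm_closed: "\<lbrakk>c \<in> carrier K; p \<in> P\<rbrakk> \<Longrightarrow> trm c p \<in> carrier alg"
  by (auto simp: alg_carrier_iff term_elt_def)

lemma trm_add: "\<lbrakk>c \<in> carrier K; d \<in> carrier K\<rbrakk> \<Longrightarrow> trm (c \<oplus> d) p = trm c p \<oplus>\<^bsub>alg\<^esub> trm d p"
  by (auto simp: alg_add term_elt_def)

lemma trm_zero: "trm \<zero> p = \<zero>\<^bsub>alg\<^esub>"
  by (auto simp: alg_zero term_elt_def)

lemma trm_mult:
  assumes "c \<in> carrier K" "d \<in> carrier K" "p \<in> P" "q \<in> P"
  shows "trm c p \<otimes>\<^bsub>alg\<^esub> trm d q =
    (case pcomp p q of None \<Rightarrow> \<zero>\<^bsub>alg\<^esub> | Some r \<Rightarrow> trm (c \<otimes> d) r)"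
proof
  fix r
  have "(trm c p \<otimes>\<^bsub>alg\<^esub> trm d q) r = (\<Oplus>z\<in>{p} \<times> {q}. if pcomp (fst z) (snd z) = Some r
      then trm c p (fst z) \<otimes> trm d q (snd z) else \<zero>)"
    using assms by (intro alg_mult_coeff) (auto simp: trm_closed, auto simp: term_elt_def split: if_splits)
  also have "\<dots> = (if pcomp p q = Some r then c \<otimes> d else \<zero>)"
    using assms by (simp add: finsum_insert Pi_def term_elt_def)
  finally show "(trm c p \<otimes>\<^bsub>alg\<^esub> trm d q) r =
    (case pcomp p q of None \<Rightarrow> \<zero>\<^bsub>alg\<^esub> | Some r \<Rightarrow> trm (c \<otimes> d) r) r"
    by (auto simp: term_elt_def alg_zero split: option.split)
qed

text \<open>Every element is a finite sum of terms, so identities between additive expressions need only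
  be checked on terms.\<close>
lemma alg_induct [consumes 1, case_names zero add]:
  assumes f: "f \<in> carrier alg" and zero: "Q \<zero>\<^bsub>alg\<^esub>"
    and add: "\<And>c p g. \<lbrakk>c \<in> carrier K; p \<in> P; g \<in> carrier alg; Q g\<rbrakk> \<Longrightarrow> Q (trm c p \<oplus>\<^bsub>alg\<^esub> g)"
  shows "Q f"
proof -
  have "Q f" if "finite F" "{p. f p \<noteq> \<zero>} \<subseteq> F" "f \<in> carrier alg" for F f
    using that
  proof (induction F arbitrary: f rule: finite_induct)
    case empty
    then have "f = \<zero>\<^bsub>alg\<^esub>" by (auto simp: alg_zero)
    with zero show ?case by simp
  next
    case (insert p F)
    show ?case
    proof (cases "p \<in> P")
      case True
      let ?g = "f(p := \<zero>)"
      have "{q. ?g q \<noteq> \<zero>} \<subseteq> {q. f q \<noteq> \<zero>}" by auto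
      then have g: "?g \<in> carrier alg"
        using insert.prems(2) by (auto simp: alg_carrier_iff intro: finite_subset)
      have "Q ?g" using insert.prems by (intro insert.IH g) auto
      moreover have "f = trm (f p) p \<oplus>\<^bsub>alg\<^esub> ?g"
        using alg_coeff_closed[OF insert.prems(2)] by (auto simp: alg_add term_elt_def)
      ultimately show ?thesis
        using add[of "f p" p ?g] g True alg_coeff_closed[OF insert.prems(2)] by metis
    next
      case False
      then show ?thesis
        using insert alg_support_subset[OF insert.prems(2)] by blast
    qed
  qed
  then show ?thesis using f alg_finite_support by blast
qed

lemma trm_mult_assoc:
  assumes "c \<in> carrier K" "d \<in> carrier K" "e \<in> carrier K" "p \<in> P" "q \<in> P" "r \<in> P"
  shows "(trm c p \<otimes>\<^bsub>alg\<^esub> trm d q) \<otimes>\<^bsub>alg\<^esub> trm e r = trm c p \<otimes>\<^bsub>alg\<^esub> (trm d q \<otimes>\<^bsub>alg\<^esub> trm e r)"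
proof -
  have closed: "x \<in> P" if "pcomp p q = Some x \<or> pcomp q r = Some x" for x
    using that assms pcomp_closed by blast
  have ab: "c \<otimes> d \<in> carrier K" "d \<otimes> e \<in> carrier K" using assms by auto
  show ?thesis
  proof (cases "pcomp p q")
    case None
    then show ?thesis
      using assms ab closed pcomp_assoc[of p q r]
      by (cases "pcomp q r") (simp_all add: trm_mult alg_zero_mult trm_closed)
  next
    case (Some s)
    then show ?thesis
      using assms ab closed pcomp_assoc[of p q r]
      by (cases "pcomp q r") (simp_all add: trm_mult alg_zero_mult trm_closed m_assoc split: option.split)
  qed
qed

lemma alg_mult_assoc:
  assumes "f \<in> carrier alg" "g \<in> carrier alg" "h \<in> carrier alg"
  shows "(f \<otimes>\<^bsub>alg\<^esub> g) \<otimes>\<^bsub>alg\<^esub> h = f \<otimes>\<^bsub>alg\<^esub> (g \<otimes>\<^bsub>alg\<^esub> h)"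
  using assms
proof (induction f rule: alg_induct)
  case (add c p f)
  have "(trm c p \<otimes>\<^bsub>alg\<^esub> g) \<otimes>\<^bsub>alg\<^esub> h = trm c p \<otimes>\<^bsub>alg\<^esub> (g \<otimes>\<^bsub>alg\<^esub> h)"
    using \<open>g \<in> carrier alg\<close>
  proof (induction g rule: alg_induct)
    case (add d q g)
    have "(trm c p \<otimes>\<^bsub>alg\<^esub> trm d q) \<otimes>\<^bsub>alg\<^esub> h = trm c p \<otimes>\<^bsub>alg\<^esub> (trm d q \<otimes>\<^bsub>alg\<^esub> h)"
      using \<open>h \<in> carrier alg\<close>
    proof (induction h rule: alg_induct)
      case (add e r h)
      then show ?case
        using \<open>c \<in> carrier K\<close> \<open>p \<in> P\<close> \<open>d \<in> carrier K\<close> \<open>q \<in> P\<close>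
        by (simp add: alg_r_distr alg_mult_closed trm_closed trm_mult_assoc)
    qed (use \<open>c \<in> carrier K\<close> \<open>p \<in> P\<close> \<open>d \<in> carrier K\<close> \<open>q \<in> P\<close> in
         \<open>simp add: alg_zero_mult trm_closed alg_mult_closed\<close>)
    then show ?case
      using add \<open>c \<in> carrier K\<close> \<open>p \<in> P\<close> \<open>h \<in> carrier alg\<close>
      by (simp add: alg_l_distr alg_r_distr alg_mult_closed trm_closed)
  qed (use \<open>c \<in> carrier K\<close> \<open>p \<in> P\<close> \<open>h \<in> carrier alg\<close> in \<open>simp add: alg_zero_mult trm_closed\<close>)
  then show ?case
    using add by (simp add: alg_l_distr alg_mult_closed trm_closed)
qed (simp add: alg_zero_mult alg_mult_closed)

lemma one_mult_trm:
  assumes "c \<in> carrier K" "p \<in> P"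
  shows "\<one>\<^bsub>alg\<^esub> \<otimes>\<^bsub>alg\<^esub> trm c p = trm c p" "trm c p \<otimes>\<^bsub>alg\<^esub> \<one>\<^bsub>alg\<^esub> = trm c p"
proof -
  obtain i where i: "i \<in> I" "\<And>j. j \<in> I \<Longrightarrow> pcomp j p = (if j = i then Some p else None)"
    using left_unit[OF assms(2)] by blast
  show "\<one>\<^bsub>alg\<^esub> \<otimes>\<^bsub>alg\<^esub> trm c p = trm c p"
  proof
    fix r
    have "(\<one>\<^bsub>alg\<^esub> \<otimes>\<^bsub>alg\<^esub> trm c p) r = (\<Oplus>z\<in>I \<times> {p}. if pcomp (fst z) (snd z) = Some r
        then \<one>\<^bsub>alg\<^esub> (fst z) \<otimes> trm c p (snd z) else \<zero>)"
      using assms finite_units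
      by (intro alg_mult_coeff) (auto simp: trm_closed alg_one_closed, auto simp: term_elt_def alg_one split: if_splits)
    also have "\<dots> = (\<Oplus>z\<in>I \<times> {p}. if (i, p) = z then trm c p r else \<zero>)"
      using assms i by (intro finsum_cong') (auto simp: term_elt_def alg_one)
    also have "\<dots> = trm c p r"
      using assms i finite_units
      by (intro finsum_singleton) (auto simp: term_elt_def)
    finally show "(\<one>\<^bsub>alg\<^esub> \<otimes>\<^bsub>alg\<^esub> trm c p) r = trm c p r" .
  qed
  obtain i where i: "i \<in> I" "\<And>j. j \<in> I \<Longrightarrow> pcomp p j = (if j = i then Some p else None)"
    using right_unit[OF assms(2)] by blast
  show "trm c p \<otimes>\<^bsub>alg\<^esub> \<one>\<^bsub>alg\<^esub> = trm c p"
  proof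
    fix r
    have "(trm c p \<otimes>\<^bsub>alg\<^esub> \<one>\<^bsub>alg\<^esub>) r = (\<Oplus>z\<in>{p} \<times> I. if pcomp (fst z) (snd z) = Some r
        then trm c p (fst z) \<otimes> \<one>\<^bsub>alg\<^esub> (snd z) else \<zero>)"
      using assms finite_units
      by (intro alg_mult_coeff) (auto simp: trm_closed alg_one_closed, auto simp: term_elt_def alg_one split: if_splits)
    also have "\<dots> = (\<Oplus>z\<in>{p} \<times> I. if (p, i) = z then trm c p r else \<zero>)"
      using assms i by (intro finsum_cong') (auto simp: term_elt_def alg_one)
    also have "\<dots> = trm c p r"
      using assms i finite_units
      by (intro finsum_singleton) (auto simp: term_elt_def)
    finally show "(trm c p \<otimes>\<^bsub>alg\<^esub> \<one>\<^bsub>alg\<^esub>) r = trm c p r" .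
  qed
qed

lemma alg_mult_one:
  assumes "f \<in> carrier alg"
  shows "\<one>\<^bsub>alg\<^esub> \<otimes>\<^bsub>alg\<^esub> f = f" "f \<otimes>\<^bsub>alg\<^esub> \<one>\<^bsub>alg\<^esub> = f"
  using assms
  by (induction f rule: alg_induct)
     (simp_all add: alg_zero_mult alg_one_closed alg_l_distr alg_r_distr trm_closed one_mult_trm)

lemma alg_ring: "ring alg"
  by (intro ringI alg_abelian_group monoidI)
     (auto simp: alg_mult_closed alg_one_closed alg_mult_assoc alg_mult_one alg_l_distr alg_r_distr)

end

text \<open>The additive map on a \<open>span_algebra\<close> whose value on the term \<open>c \<cdot> p\<close> is \<open>H c p\<close>.\<close>
definition linear_ext ::
  "('k, 'm) ring_scheme \<Rightarrow> ('b, 'n) ring_scheme \<Rightarrow> ('k \<Rightarrow> 'p \<Rightarrow> 'b) \<Rightarrow> ('p \<Rightarrow> 'k) \<Rightarrow> 'b" where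
  "linear_ext K B H f = (\<Oplus>\<^bsub>B\<^esub>p\<in>{p. f p \<noteq> \<zero>\<^bsub>K\<^esub>}. H (f p) p)"

text \<open>What a prescription on terms has to satisfy for its additive extension to be multiplicative.
  The extension maps \<open>1\<close> to an idempotent of \<open>B\<close>, which allows maps into a corner of a larger ring.\<close>
locale basis_algebra_map = basis_algebra K P I pcomp + B: ring B
  for K (structure) and P I :: "'p set" and pcomp and B (structure) +
  fixes H
  assumes H_closed: "\<lbrakk>c \<in> carrier K; p \<in> P\<rbrakk> \<Longrightarrow> H c p \<in> carrier B"
    and H_add: "\<lbrakk>c \<in> carrier K; d \<in> carrier K; p \<in> P\<rbrakk> \<Longrightarrow> H (c \<oplus>\<^bsub>K\<^esub> d) p = H c p \<oplus>\<^bsub>B\<^esub> H d p"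
    and H_mult: "\<lbrakk>c \<in> carrier K; d \<in> carrier K; p \<in> P; q \<in> P\<rbrakk> \<Longrightarrow>
      H c p \<otimes>\<^bsub>B\<^esub> H d q = (case pcomp p q of None \<Rightarrow> \<zero>\<^bsub>B\<^esub> | Some r \<Rightarrow> H (c \<otimes>\<^bsub>K\<^esub> d) r)"
begin

abbreviation lin where "lin \<equiv> linear_ext K B H"

lemma H_zero: "p \<in> P \<Longrightarrow> H \<zero>\<^bsub>K\<^esub> p = \<zero>\<^bsub>B\<^esub>"
  using H_add[of "\<zero>\<^bsub>K\<^esub>" "\<zero>\<^bsub>K\<^esub>" p] H_closed[of "\<zero>\<^bsub>K\<^esub>" p] by simp

text \<open>The sum may run over any finite set containing the support, since \<open>H 0 p = 0\<close>; this makes the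
  sums for \<open>f\<close>, \<open>g\<close> and \<open>f + g\<close> comparable.\<close>
lemma lin_superset:
  assumes "f \<in> carrier alg" "finite F" "{p. f p \<noteq> \<zero>\<^bsub>K\<^esub>} \<subseteq> F" "F \<subseteq> P"
  shows "lin f = (\<Oplus>\<^bsub>B\<^esub>p\<in>F. H (f p) p)"
  unfolding linear_ext_def using assms
  by (intro B.add.finprod_mono_neutral_cong_left) (auto simp: H_zero intro!: H_closed alg_coeff_closed)

lemma lin_closed: "f \<in> carrier alg \<Longrightarrow> lin f \<in> carrier B"
  unfolding linear_ext_def using alg_support_subset[of f]
  by (intro B.finsum_closed) (auto intro!: H_closed alg_coeff_closed)

lemma lin_add:
  assumes "f \<in> carrier alg" "g \<in> carrier alg"
  shows "lin (f \<oplus>\<^bsub>alg\<^esub> g) = lin f \<oplus>\<^bsub>B\<^esub> lin g"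
proof -
  let ?F = "{p. f p \<noteq> \<zero>\<^bsub>K\<^esub>} \<union> {p. g p \<noteq> \<zero>\<^bsub>K\<^esub>}"
  have F: "finite ?F" "?F \<subseteq> P"
    using assms alg_finite_support alg_support_subset by blast+
  have "lin (f \<oplus>\<^bsub>alg\<^esub> g) = (\<Oplus>\<^bsub>B\<^esub>p\<in>?F. H ((f \<oplus>\<^bsub>alg\<^esub> g) p) p)"
    using F assms by (intro lin_superset alg_add_closed) (auto simp: alg_add)
  also have "\<dots> = (\<Oplus>\<^bsub>B\<^esub>p\<in>?F. H (f p) p \<oplus>\<^bsub>B\<^esub> H (g p) p)"
    using F assms by (intro B.finsum_cong')
      (auto simp: alg_add alg_coeff_closed H_closed H_add subset_iff)
  also have "\<dots> = lin f \<oplus>\<^bsub>B\<^esub> lin g"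
    using F assms by (subst B.finsum_addf)
      (auto simp: alg_coeff_closed lin_superset[where F = ?F] intro!: H_closed)
  finally show ?thesis .
qed

lemma lin_zero: "lin \<zero>\<^bsub>alg\<^esub> = \<zero>\<^bsub>B\<^esub>"
  by (simp add: linear_ext_def alg_zero)

lemma lin_trm: "\<lbrakk>c \<in> carrier K; p \<in> P\<rbrakk> \<Longrightarrow> lin (trm c p) = H c p"
proof -
  assume "c \<in> carrier K" "p \<in> P"
  moreover from this have "lin (trm c p) = (\<Oplus>\<^bsub>B\<^esub>q\<in>{p}. H (trm c p q) q)"
    by (intro lin_superset trm_closed) (auto simp: term_elt_def)
  ultimately show ?thesis by (simp add: term_elt_def H_closed)
qed

lemma lin_mult:
  assumes "f \<in> carrier alg" "g \<in> carrier alg"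
  shows "lin (f \<otimes>\<^bsub>alg\<^esub> g) = lin f \<otimes>\<^bsub>B\<^esub> lin g"
  using assms
proof (induction f rule: alg_induct)
  case zero
  then show ?case by (simp add: alg_zero_mult lin_zero lin_closed)
next
  case (add c p f)
  have "lin (trm c p \<otimes>\<^bsub>alg\<^esub> g) = lin (trm c p) \<otimes>\<^bsub>B\<^esub> lin g"
    using \<open>g \<in> carrier alg\<close>
  proof (induction g rule: alg_induct)
    case zero
    then show ?case using add by (simp add: alg_zero_mult lin_zero lin_closed trm_closed)
  next
    case (add d q g)
    have "lin (trm c p \<otimes>\<^bsub>alg\<^esub> trm d q) = lin (trm c p) \<otimes>\<^bsub>B\<^esub> lin (trm d q)"
      using add \<open>c \<in> carrier K\<close> \<open>p \<in> P\<close> pcomp_closed[of p q]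
      by (auto simp: trm_mult lin_trm H_mult lin_zero split: option.split)
    then show ?case
      using add \<open>c \<in> carrier K\<close> \<open>p \<in> P\<close>
      by (simp add: alg_r_distr lin_add alg_mult_closed trm_closed lin_closed B.r_distr)
  qed
  then show ?case
    using add by (simp add: alg_l_distr lin_add alg_mult_closed trm_closed lin_closed B.l_distr)
qed

lemma lin_one: "lin \<one>\<^bsub>alg\<^esub> = (\<Oplus>\<^bsub>B\<^esub>i\<in>I. H \<one>\<^bsub>K\<^esub> i)"
proof -
  have "lin \<one>\<^bsub>alg\<^esub> = (\<Oplus>\<^bsub>B\<^esub>i\<in>I. H (\<one>\<^bsub>alg\<^esub> i) i)"
    using finite_units units_subset
    by (intro lin_superset) (auto simp: alg_one_closed, auto simp: alg_one split: if_splits)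
  also have "\<dots> = (\<Oplus>\<^bsub>B\<^esub>i\<in>I. H \<one>\<^bsub>K\<^esub> i)"
    using units_subset by (intro B.finsum_cong') (auto simp: alg_one intro!: H_closed)
  finally show ?thesis .
qed

end

lemma (in basis_algebra) alg_eq_sum_of_terms:
  assumes f: "f \<in> carrier alg"
  shows "f = (\<Oplus>\<^bsub>alg\<^esub>p\<in>{p. f p \<noteq> \<zero>}. trm (f p) p)"
proof
  fix q
  have trm: "trm (f p) p \<in> carrier alg" if "p \<in> {p. f p \<noteq> \<zero>}" for p
    using that alg_support_subset[OF f] by (intro trm_closed alg_coeff_closed f) auto
  have "(\<Oplus>\<^bsub>alg\<^esub>p\<in>{p. f p \<noteq> \<zero>}. trm (f p) p) q = (\<Oplus>p\<in>{p. f p \<noteq> \<zero>}. trm (f p) p q)"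
    by (rule additive_finsum[where h = "\<lambda>f. f q"])
       (use trm in \<open>auto simp: alg_coeff_closed alg_add alg_abelian_group abelian_group_axioms\<close>)
  also have "\<dots> = (\<Oplus>p\<in>{p. f p \<noteq> \<zero>}. if q = p then f p else \<zero>)"
    by (rule finsum_cong') (auto simp: term_elt_def alg_coeff_closed[OF f])
  also have "\<dots> = f q"
  proof (cases "f q = \<zero>")
    case True
    then show ?thesis by (intro trans[OF add.finprod_one_eqI]) auto
  next
    case False
    then show ?thesis
      by (intro finsum_singleton) (auto simp: alg_finite_support[OF f] alg_coeff_closed[OF f])
  qed
  finally show "f q = (\<Oplus>\<^bsub>alg\<^esub>p\<in>{p. f p \<noteq> \<zero>}. trm (f p) p) q" by simp
qed

text \<open>The inclusion of terms is itself a prescription on terms, whose extension is the identity.\<close>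
lemma (in basis_algebra) alg_one_eq_sum: "\<one>\<^bsub>alg\<^esub> = (\<Oplus>\<^bsub>alg\<^esub>i\<in>I. trm \<one> i)"
proof -
  interpret t: basis_algebra_map K P I pcomp alg trm
    by (intro basis_algebra_map.intro basis_algebra_map_axioms.intro basis_algebra_axioms alg_ring
        trm_closed trm_add trm_mult)
  show ?thesis
    using t.lin_one alg_eq_sum_of_terms[OF alg_one_closed] by (simp add: linear_ext_def)
qed

section \<open>Presented algebras, path algebras and matrix rings as algebras with a basis\<close>

lemma free_algebra_basis: "ring K \<Longrightarrow> basis_algebra K (lists X) {[]} (\<lambda>u v. Some (u @ v))"
  by (auto simp: basis_algebra_def basis_algebra_axioms_def)

lemma path_algebra_basis:
  fixes Q :: "('v, 'e) pre_digraph"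
  assumes "ring K" "wf_digraph Q" "finite (verts Q)"
  shows "basis_algebra K (paths Q) {(v, [], v) | v. v \<in> verts Q} path_comp"
proof -
  interpret wf_digraph Q by fact
  have cas_app: "cas u (p @ q) w" if "cas u p v" "cas v q w" for u p v q w
    using that by (induction p arbitrary: u) auto
  show ?thesis
  proof (intro basis_algebra.intro basis_algebra_axioms.intro assms(1))
    show "{(v, [], v) | v. v \<in> verts Q} \<subseteq> paths Q"
      by (auto simp: paths_def awalk_def)
    have "{(v, [], v) | v. v \<in> verts Q} = (\<lambda>v. (v, [], v)) ` verts Q" by auto
    then show "finite {(v, [], v) | v. v \<in> verts Q}" using assms(3) by simp
  next
    fix p q r :: "('v, 'e) path"
    assume "p \<in> paths Q" "q \<in> paths Q" "path_comp p q = Some r"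
    then show "r \<in> paths Q"
      by (cases p; cases q) (auto simp: paths_def awalk_def split: if_splits intro: cas_app)
  next
    fix p q r :: "('v, 'e) path"
    show "Option.bind (path_comp p q) (\<lambda>s. path_comp s r) =
        Option.bind (path_comp q r) (path_comp p)"
      by (cases p; cases q; cases r) auto
  next
    fix p :: "('v, 'e) path" assume "p \<in> paths Q"
    then obtain u l w where p: "p = (u, l, w)" "awalk u l w" by (auto simp: paths_def)
    then have "u \<in> verts Q" "w \<in> verts Q" by (auto intro: awalk_last_in_verts simp: awalk_def)
    with p show "\<exists>i\<in>{(v, [], v) |v. v \<in> verts Q}. \<forall>j\<in>{(v, [], v) |v. v \<in> verts Q}.
           path_comp j p = (if j = i then Some p else None)"
      "\<exists>i\<in>{(v, [], v) |v. v \<in> verts Q}. \<forall>j\<in>{(v, [], v) |v. v \<in> verts Q}.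
           path_comp p j = (if j = i then Some p else None)"
      by (auto intro: bexI[of _ "(u, [], u)"] bexI[of _ "(w, [], w)"])
  qed
qed

text \<open>The product of the positions of two matrix units.\<close>
fun pair_comp :: "'i \<times> 'i \<Rightarrow> 'i \<times> 'i \<Rightarrow> ('i \<times> 'i) option" where
  "pair_comp (i, j) (k, l) = (if j = k then Some (i, l) else None)"

text \<open>Elements of a \<open>span_algebra\<close> vanish outside the basis, whereas matrices are \<open>undefined\<close> outside the
  square of indices; restriction passes from the first convention to the second.\<close>
definition to_matrix :: "nat \<Rightarrow> (nat \<times> nat \<Rightarrow> 's) \<Rightarrow> nat \<times> nat \<Rightarrow> 's" where
  "to_matrix n f = restrict f ({1..n} \<times> {1..n})"

definition elem_matrix :: "nat \<Rightarrow> ('s, 'm) ring_scheme \<Rightarrow> 's \<Rightarrow> nat \<times> nat \<Rightarrow> nat \<times> nat \<Rightarrow> 's" where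
  "elem_matrix n S s p = to_matrix n (term_elt S s p)"

text \<open>The coefficient ring \<open>S\<close> may be noncommutative. The pairs of indices form a basis of the matrix ring
  over it, so the ring laws for matrices and the homomorphisms out of \<open>M\<^sub>n(S)\<close> come from \<open>span_algebra\<close>.\<close>
locale matrix_alg = ring S for S :: "('s, 'm) ring_scheme" (structure) +
  fixes n :: nat
begin

abbreviation sq where "sq \<equiv> {1..n} \<times> {1..n}"
abbreviation diag where "diag \<equiv> Id_on {1..n}"

sublocale mb: basis_algebra S sq diag pair_comp
proof (intro basis_algebra.intro basis_algebra_axioms.intro ring_axioms)
  have "diag = (\<lambda>i. (i, i)) ` {1..n}" by (auto simp: Id_on_def)
  then show "finite diag" by simp
next
  fix p q r assume "p \<in> sq" "q \<in> sq" "pair_comp p q = Some r"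
  then show "r \<in> sq" by (cases p; cases q) (auto split: if_splits)
next
  fix p q r :: "nat \<times> nat"
  show "Option.bind (pair_comp p q) (\<lambda>s. pair_comp s r) =
      Option.bind (pair_comp q r) (pair_comp p)"
    by (cases p; cases q; cases r) auto
next
  fix p assume "p \<in> sq"
  then obtain i j where p: "p = (i, j)" "i \<in> {1..n}" "j \<in> {1..n}" by auto
  show "\<exists>i\<in>diag. \<forall>j\<in>diag. pair_comp j p = (if j = i then Some p else None)"
    using p by (intro bexI[of _ "(i, i)"]) (auto split: if_splits)
  show "\<exists>i\<in>diag. \<forall>j\<in>diag. pair_comp p j = (if j = i then Some p else None)"
    using p by (intro bexI[of _ "(j, j)"]) (auto split: if_splits)
qed auto

abbreviation M where "M \<equiv> matrix_ring n S"
abbreviation emat where "emat \<equiv> elem_matrix n S"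

text \<open>Only the pairs of positions \<open>(i, l)\<close>, \<open>(l, j)\<close> compose to \<open>(i, j)\<close>, so the convolution sum collapses to
  the sum over \<open>l\<close>.\<close>
lemma to_matrix_mult:
  assumes f: "f \<in> carrier mb.alg" and g: "g \<in> carrier mb.alg"
  shows "to_matrix n (f \<otimes>\<^bsub>mb.alg\<^esub> g) = to_matrix n f \<otimes>\<^bsub>M\<^esub> to_matrix n g"
proof
  fix p :: "nat \<times> nat"
  show "to_matrix n (f \<otimes>\<^bsub>mb.alg\<^esub> g) p = (to_matrix n f \<otimes>\<^bsub>M\<^esub> to_matrix n g) p"
  proof (cases "p \<in> sq")
    case True
    then obtain i j where p: "p = (i, j)" "i \<in> {1..n}" "j \<in> {1..n}" by auto
    let ?t = "\<lambda>l. ((i, l), (l, j))"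
    have "(f \<otimes>\<^bsub>mb.alg\<^esub> g) p = (\<Oplus>z\<in>sq \<times> sq. if pair_comp (fst z) (snd z) = Some p
        then f (fst z) \<otimes> g (snd z) else \<zero>)"
      using mb.alg_support_subset[OF f] mb.alg_support_subset[OF g]
      by (intro mb.alg_mult_coeff f g) auto
    also have "\<dots> = (\<Oplus>z\<in>?t ` {1..n}. f (fst z) \<otimes> g (snd z))"
      using p f g
      by (intro add.finprod_mono_neutral_cong_right) (auto simp: mb.alg_coeff_closed split: if_splits)
    also have "\<dots> = (\<Oplus>l\<in>{1..n}. f (i, l) \<otimes> g (l, j))"
      using f g by (subst finsum_reindex) (auto simp: mb.alg_coeff_closed inj_on_def)
    also have "\<dots> = (\<Oplus>l\<in>{1..n}. to_matrix n f (i, l) \<otimes> to_matrix n g (l, j))"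
      using p f g by (intro finsum_cong') (auto simp: mb.alg_coeff_closed to_matrix_def)
    finally show ?thesis using p by (simp add: to_matrix_def matrix_ring_def)
  qed (auto simp: to_matrix_def matrix_ring_def)
qed

lemma to_matrix_iso: "to_matrix n \<in> ring_iso mb.alg M"
proof -
  have "bij_betw (to_matrix n) (carrier mb.alg) (carrier M)"
  proof (rule bij_betw_byWitness[where f' = "\<lambda>A p. if p \<in> sq then A p else \<zero>"])
    show "\<forall>f\<in>carrier mb.alg. (\<lambda>p. if p \<in> sq then to_matrix n f p else \<zero>) = f"
      by (auto simp: mb.alg_carrier_iff to_matrix_def)
    show "\<forall>A\<in>carrier M. to_matrix n (\<lambda>p. if p \<in> sq then A p else \<zero>) = A"
      by (auto simp: matrix_ring_def to_matrix_def PiE_def extensional_def restrict_def intro!: ext)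
    show "to_matrix n ` carrier mb.alg \<subseteq> carrier M"
      by (auto simp: matrix_ring_def to_matrix_def mb.alg_coeff_closed split: if_splits)
    show "(\<lambda>A p. if p \<in> sq then A p else \<zero>) ` carrier M \<subseteq> carrier mb.alg"
    proof clarify
      fix A assume "A \<in> carrier M"
      moreover have "finite {p. (if p \<in> sq then A p else \<zero>) \<noteq> \<zero>}"
        by (rule finite_subset[of _ sq]) auto
      ultimately show "(\<lambda>p. if p \<in> sq then A p else \<zero>) \<in> carrier mb.alg"
        by (auto simp: mb.alg_carrier_iff matrix_ring_def PiE_def Pi_def)
    qed
  qed
  moreover have "to_matrix n (f \<oplus>\<^bsub>mb.alg\<^esub> g) = to_matrix n f \<oplus>\<^bsub>M\<^esub> to_matrix n g" for f g
    by (auto simp: to_matrix_def matrix_ring_def mb.alg_add restrict_def)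
  moreover have "to_matrix n \<one>\<^bsub>mb.alg\<^esub> = \<one>\<^bsub>M\<^esub>"
  proof
    fix p :: "nat \<times> nat"
    show "to_matrix n \<one>\<^bsub>mb.alg\<^esub> p = \<one>\<^bsub>M\<^esub> p"
      by (cases p) (auto simp: to_matrix_def matrix_ring_def mb.alg_one)
  qed
  ultimately show ?thesis
    by (auto simp: ring_iso_def ring_hom_def to_matrix_mult bij_betw_def)
qed

lemma to_matrix_zero: "to_matrix n \<zero>\<^bsub>mb.alg\<^esub> = \<zero>\<^bsub>M\<^esub>"
  by (auto simp: to_matrix_def matrix_ring_def mb.alg_zero restrict_def)

lemma matrix_ring_ring: "ring M"
  using ring.ring_iso_imp_img_ring[OF mb.alg_ring to_matrix_iso]
  by (simp add: to_matrix_zero)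

sublocale M: ring M by (rule matrix_ring_ring)

lemmas to_matrix_hom = to_matrix_iso[unfolded ring_iso_def, THEN CollectD, THEN conjunct1]

lemma emat_closed: "\<lbrakk>s \<in> carrier S; p \<in> sq\<rbrakk> \<Longrightarrow> emat s p \<in> carrier M"
  unfolding elem_matrix_def
  by (rule ring_hom_closed[OF to_matrix_hom]) (rule mb.trm_closed)

lemma emat_add: "\<lbrakk>s \<in> carrier S; t \<in> carrier S; p \<in> sq\<rbrakk> \<Longrightarrow> emat (s \<oplus> t) p = emat s p \<oplus>\<^bsub>M\<^esub> emat t p"
  unfolding elem_matrix_def
  by (subst ring_hom_add[OF to_matrix_hom, symmetric]) (simp_all add: mb.trm_closed mb.trm_add)

lemma emat_mult:
  assumes "s \<in> carrier S" "t \<in> carrier S" "i \<in> {1..n}" "j \<in> {1..n}" "k \<in> {1..n}" "l \<in> {1..n}"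
  shows "emat s (i, j) \<otimes>\<^bsub>M\<^esub> emat t (k, l) = (if j = k then emat (s \<otimes> t) (i, l) else \<zero>\<^bsub>M\<^esub>)"
  unfolding elem_matrix_def using assms
  by (subst ring_hom_mult[OF to_matrix_hom, symmetric])
     (simp_all add: mb.trm_closed mb.trm_mult to_matrix_zero)

lemma emat_zero: "emat \<zero> p = \<zero>\<^bsub>M\<^esub>"
  by (simp add: elem_matrix_def mb.trm_zero to_matrix_zero)

lemma matrix_hom_eqI:
  assumes "h \<in> ring_hom M B" "h' \<in> ring_hom M B" "ring B" "A \<in> carrier M"
    and "\<And>s i j. \<lbrakk>s \<in> carrier S; i \<in> {1..n}; j \<in> {1..n}\<rbrakk> \<Longrightarrow> h (emat s (i, j)) = h' (emat s (i, j))"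
  shows "h A = h' A"
proof -
  interpret B: ring B by fact
  have z: "g \<zero>\<^bsub>M\<^esub> = \<zero>\<^bsub>B\<^esub>" if "g \<in> ring_hom M B" for g
    using ring_hom_zero[OF that matrix_ring_ring \<open>ring B\<close>] .
  have eq: "f \<in> carrier mb.alg \<Longrightarrow> h (to_matrix n f) = h' (to_matrix n f)" for f
  proof (induction f rule: mb.alg_induct)
    case zero
    then show ?case using z[OF assms(1)] z[OF assms(2)] by (simp add: to_matrix_zero)
  next
    case (add c p g)
    then have "to_matrix n (mb.trm c p \<oplus>\<^bsub>mb.alg\<^esub> g) = emat c p \<oplus>\<^bsub>M\<^esub> to_matrix n g"
      unfolding elem_matrix_def by (intro ring_hom_add[OF to_matrix_hom] mb.trm_closed)
    moreover have "to_matrix n g \<in> carrier M"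
      using add by (intro ring_hom_closed[OF to_matrix_hom])
    moreover have "h (emat c p) = h' (emat c p)"
      using add assms(5)[of c "fst p" "snd p"] by (cases p) auto
    ultimately show ?case using add emat_closed[of c p]
      by (simp add: ring_hom_add[OF assms(1)] ring_hom_add[OF assms(2)])
  qed
  have "carrier M = to_matrix n ` carrier mb.alg"
    using to_matrix_iso by (simp add: ring_iso_def bij_betw_def)
  with assms(4) have "A \<in> to_matrix n ` carrier mb.alg" by (simp only:)
  then obtain f where "A = to_matrix n f" "f \<in> carrier mb.alg" by (rule imageE)
  then show ?thesis using eq by simp
qed

lemma matrix_one: "\<one>\<^bsub>M\<^esub> = (\<Oplus>\<^bsub>M\<^esub>i\<in>{1..n}. emat \<one> (i, i))"
proof -
  have "\<one>\<^bsub>M\<^esub> = to_matrix n \<one>\<^bsub>mb.alg\<^esub>" using ring_hom_one[OF to_matrix_hom] by simp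
  also have "\<dots> = to_matrix n (\<Oplus>\<^bsub>mb.alg\<^esub>p\<in>diag. mb.trm \<one> p)"
    by (rule arg_cong[OF mb.alg_one_eq_sum])
  also have "\<dots> = (\<Oplus>\<^bsub>M\<^esub>p\<in>diag. emat \<one> p)"
    unfolding elem_matrix_def
    by (rule additive_finsum[where h = "to_matrix n"])
       (auto simp: mb.alg_abelian_group M.abelian_group_axioms ring_hom_closed[OF to_matrix_hom]
          ring_hom_add[OF to_matrix_hom] mb.trm_closed)
  also have "\<dots> = (\<Oplus>\<^bsub>M\<^esub>p\<in>(\<lambda>i. (i, i)) ` {1..n}. emat \<one> p)"
    by (rule arg_cong[where f = "finsum M (emat \<one>)"]) (auto simp: Id_on_def)
  also have "\<dots> = (\<Oplus>\<^bsub>M\<^esub>i\<in>{1..n}. emat \<one> (i, i))"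
    by (subst M.finsum_reindex) (auto simp: inj_on_def intro!: emat_closed)
  finally show ?thesis .
qed

lemma matrix_hom_exists:
  assumes "basis_algebra_map S sq diag pair_comp B H"
    and one: "(\<Oplus>\<^bsub>B\<^esub>i\<in>{1..n}. H \<one> (i, i)) = \<one>\<^bsub>B\<^esub>"
  obtains \<theta> where "\<theta> \<in> ring_hom M B" "\<And>s p. \<lbrakk>s \<in> carrier S; p \<in> sq\<rbrakk> \<Longrightarrow> \<theta> (emat s p) = H s p"
proof -
  interpret hm: basis_algebra_map S sq diag pair_comp B H by fact
  let ?inv = "inv_into (carrier mb.alg) (to_matrix n)"
  have "diag = (\<lambda>i. (i, i)) ` {1..n}" by (auto simp: Id_on_def)
  then have "hm.lin \<one>\<^bsub>mb.alg\<^esub> = (\<Oplus>\<^bsub>B\<^esub>p\<in>(\<lambda>i. (i, i)) ` {1..n}. H \<one> p)"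
    using hm.lin_one by simp
  also have "\<dots> = \<one>\<^bsub>B\<^esub>"
    using one by (subst hm.B.finsum_reindex) (auto simp: inj_on_def intro!: hm.H_closed)
  finally have "hm.lin \<in> ring_hom mb.alg B"
    by (auto simp: ring_hom_def hm.lin_closed hm.lin_add hm.lin_mult)
  moreover have "?inv \<in> ring_hom M mb.alg"
    using ring_iso_set_sym[OF mb.alg_ring to_matrix_iso] by (simp add: ring_iso_def)
  ultimately have hom: "hm.lin \<circ> ?inv \<in> ring_hom M B"
    by (intro ring_hom_trans)
  have val: "(hm.lin \<circ> ?inv) (emat s p) = H s p" if "s \<in> carrier S" "p \<in> sq" for s p
  proof -
    have "inj_on (to_matrix n) (carrier mb.alg)"
      using to_matrix_iso by (auto simp: ring_iso_def bij_betw_def)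
    then show ?thesis
      using that by (simp add: elem_matrix_def inv_into_f_f mb.trm_closed hm.lin_trm)
  qed
  show thesis
    by (rule that[of "hm.lin \<circ> ?inv"]) (fact hom, fact val)
qed

end

section \<open>Factoring maps through quotient rings\<close>

text \<open>A map that is constant on a coset takes its value there at any representative.\<close>
definition factor_map :: "('a \<Rightarrow> 'b) \<Rightarrow> 'a set \<Rightarrow> 'b" where
  "factor_map h C = h (SOME x. x \<in> C)"

locale quotient_by = ring R for R (structure) + fixes Y assumes Y_subset: "Y \<subseteq> carrier R"
begin

abbreviation J where "J \<equiv> Idl Y"
abbreviation cls where "cls x \<equiv> J +> x"
abbreviation RQ where "RQ \<equiv> R Quot J"

sublocale J: ideal J R by (rule genideal_ideal[OF Y_subset])

lemma quot_ring: "ring RQ" by (rule J.quotient_is_ring)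

lemma cls_hom: "cls \<in> ring_hom R RQ" by (rule J.rcos_ring_hom)

lemma quot_carrierE:
  assumes "C \<in> carrier RQ" obtains x where "x \<in> carrier R" "C = cls x"
  using assms by (auto simp: FactRing_def A_RCOSETS_def')

lemma cls_eq_zero: "x \<in> J \<Longrightarrow> cls x = \<zero>\<^bsub>RQ\<^esub>"
  by (simp add: FactRing_def J.a_rcos_const)

text \<open>The zeros of \<open>h\<close> form an ideal, also when \<open>h\<close> is a map into a corner of \<open>B\<close> and \<open>h 1\<close> is a proper
  idempotent.\<close>
lemma vanishes_on_ideal:
  assumes "ring B"
    and closed: "\<And>x. x \<in> carrier R \<Longrightarrow> h x \<in> carrier B"
    and add: "\<And>x y. \<lbrakk>x \<in> carrier R; y \<in> carrier R\<rbrakk> \<Longrightarrow> h (x \<oplus> y) = h x \<oplus>\<^bsub>B\<^esub> h y"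
    and mult: "\<And>x y. \<lbrakk>x \<in> carrier R; y \<in> carrier R\<rbrakk> \<Longrightarrow> h (x \<otimes> y) = h x \<otimes>\<^bsub>B\<^esub> h y"
    and Y: "\<And>y. y \<in> Y \<Longrightarrow> h y = \<zero>\<^bsub>B\<^esub>"
    and x: "x \<in> J"
  shows "h x = \<zero>\<^bsub>B\<^esub>"
proof -
  interpret B: ring B by fact
  have zero: "h \<zero> = \<zero>\<^bsub>B\<^esub>"
    using add[of \<zero> \<zero>] closed[of \<zero>] by simp
  have "ideal {x \<in> carrier R. h x = \<zero>\<^bsub>B\<^esub>} R"
  proof (intro idealI ring_axioms add.subgroupI)
    fix a assume "a \<in> {x \<in> carrier R. h x = \<zero>\<^bsub>B\<^esub>}"
    then show "\<ominus> a \<in> {x \<in> carrier R. h x = \<zero>\<^bsub>B\<^esub>}"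
      using add[of a "\<ominus> a"] closed[of "\<ominus> a"] zero by (simp add: r_neg)
  qed (use zero add mult closed in auto)
  then have "J \<subseteq> {x \<in> carrier R. h x = \<zero>\<^bsub>B\<^esub>}"
    using Y Y_subset by (intro genideal_minimal) auto
  with x show ?thesis by auto
qed

lemma factor_map_cls:
  assumes "ring B"
    and closed: "\<And>x. x \<in> carrier R \<Longrightarrow> h x \<in> carrier B"
    and add: "\<And>x y. \<lbrakk>x \<in> carrier R; y \<in> carrier R\<rbrakk> \<Longrightarrow> h (x \<oplus> y) = h x \<oplus>\<^bsub>B\<^esub> h y"
    and mult: "\<And>x y. \<lbrakk>x \<in> carrier R; y \<in> carrier R\<rbrakk> \<Longrightarrow> h (x \<otimes> y) = h x \<otimes>\<^bsub>B\<^esub> h y"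
    and Y: "\<And>y. y \<in> Y \<Longrightarrow> h y = \<zero>\<^bsub>B\<^esub>"
    and x: "x \<in> carrier R"
  shows "factor_map h (cls x) = h x"
proof -
  interpret B: ring B by fact
  have "x \<in> cls x" using x J.a_rcos_self by blast
  then have "(SOME y. y \<in> cls x) \<in> cls x" by (rule someI)
  then obtain j where j: "j \<in> J" "(SOME y. y \<in> cls x) = j \<oplus> x"
    by (auto simp: a_r_coset_def')
  then have "factor_map h (cls x) = h j \<oplus>\<^bsub>B\<^esub> h x"
    using x add by (simp add: factor_map_def)
  moreover have "h j = \<zero>\<^bsub>B\<^esub>"
    using vanishes_on_ideal[OF assms(1-5) j(1)] .
  ultimately show ?thesis using closed x by simp
qed

lemma factor_map_hom:
  assumes "ring B" "h \<in> ring_hom R B" "\<And>y. y \<in> Y \<Longrightarrow> h y = \<zero>\<^bsub>B\<^esub>"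
  shows "factor_map h \<in> ring_hom RQ B" "\<And>x. x \<in> carrier R \<Longrightarrow> factor_map h (cls x) = h x"
proof -
  show eq: "factor_map h (cls x) = h x" if "x \<in> carrier R" for x
    by (rule factor_map_cls[OF assms(1)])
       (use assms that in \<open>auto simp: ring_hom_closed ring_hom_add ring_hom_mult\<close>)
  show "factor_map h \<in> ring_hom RQ B"
  proof (rule ring_hom_memI)
    fix C assume "C \<in> carrier RQ"
    then obtain x where "x \<in> carrier R" "C = cls x" by (rule quot_carrierE)
    then show "factor_map h C \<in> carrier B" using assms(2) by (simp add: eq ring_hom_closed)
  next
    fix C D assume "C \<in> carrier RQ" "D \<in> carrier RQ"
    then obtain x y where xy: "x \<in> carrier R" "C = cls x" "y \<in> carrier R" "D = cls y"
      by (metis quot_carrierE)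
    then show "factor_map h (C \<otimes>\<^bsub>RQ\<^esub> D) = factor_map h C \<otimes>\<^bsub>B\<^esub> factor_map h D"
      using assms(2) by (simp add: eq ring_hom_mult ring_hom_mult[OF cls_hom, symmetric])
    show "factor_map h (C \<oplus>\<^bsub>RQ\<^esub> D) = factor_map h C \<oplus>\<^bsub>B\<^esub> factor_map h D"
      using xy assms(2) by (simp add: eq ring_hom_add ring_hom_add[OF cls_hom, symmetric])
  next
    have "\<one>\<^bsub>RQ\<^esub> = cls \<one>" by (simp add: FactRing_def)
    then show "factor_map h \<one>\<^bsub>RQ\<^esub> = \<one>\<^bsub>B\<^esub>" using assms(2) by (simp add: eq ring_hom_one)
  qed
qed

end

section \<open>Base change of principal modules\<close>

lemma principal_rmodule_carrier:
  "carrier (principal_rmodule A f) = {f \<otimes>\<^bsub>A\<^esub> a | a. a \<in> carrier A}"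
  by (simp add: principal_rmodule_def)

lemma principal_rmodule_simps [simp]:
  "ring.zero (principal_rmodule A f) = \<zero>\<^bsub>A\<^esub>"
  "add (principal_rmodule A f) = add A"
  "act (principal_rmodule A f) = monoid.mult A"
  by (simp_all add: principal_rmodule_def)

lemma (in ring) principal_rmodule_right_module:
  assumes f: "f \<in> carrier R"
  shows "right_module R (principal_rmodule R f)"
proof -
  have "abelian_group (principal_rmodule R f)"
  proof (rule abelian_groupI; clarsimp simp: principal_rmodule_carrier)
    fix a b assume "a \<in> carrier R" "b \<in> carrier R"
    then show "\<exists>c. f \<otimes> a \<oplus> f \<otimes> b = f \<otimes> c \<and> c \<in> carrier R"
      using f by (intro exI[of _ "a \<oplus> b"]) (simp add: r_distr)
  next
    show "\<exists>a. \<zero> = f \<otimes> a \<and> a \<in> carrier R" using f by (intro exI[of _ \<zero>]) simp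
  next
    fix a assume a: "a \<in> carrier R"
    have "f \<otimes> (\<ominus> a) \<oplus> f \<otimes> a = \<zero>" using a f by (simp add: r_minus l_neg)
    with a show "\<exists>x. (\<exists>a. x = f \<otimes> a \<and> a \<in> carrier R) \<and> x \<oplus> f \<otimes> a = \<zero>"
      using f by (intro exI[of _ "f \<otimes> (\<ominus> a)"]) auto
  qed (use f in \<open>simp_all add: add.m_ac\<close>)
  then show ?thesis
    using f by (intro right_module.intro right_module_axioms.intro ring_axioms)
      (auto simp: principal_rmodule_carrier l_distr r_distr m_assoc)
qed

lemma (in ring) principal_rmodule_fg_projective:
  assumes f: "f \<in> carrier R" "f \<otimes> f = f"
  shows "fg_projective R (principal_rmodule R f)"
proof -
  let ?P = "principal_rmodule R f" and ?F = "free_rmodule R 1"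
  let ?\<iota> = "\<lambda>x. \<lambda>i\<in>{..<1::nat}. x" and ?\<pi> = "\<lambda>y :: nat \<Rightarrow> 'a. f \<otimes> y 0"
  have "?\<iota> \<in> rmodule_hom R ?P ?F"
    using f by (auto simp: principal_rmodule_carrier rmodule_hom_def free_rmodule_def split: if_splits)
  moreover have "?\<pi> \<in> rmodule_hom R ?F ?P"
    using f by (auto simp: principal_rmodule_carrier rmodule_hom_def free_rmodule_def r_distr m_assoc PiE_def Pi_def)
  moreover have "\<forall>x\<in>carrier ?P. ?\<pi> (?\<iota> x) = x"
    using f by (auto simp: principal_rmodule_carrier m_assoc[symmetric])
  ultimately show ?thesis
    unfolding fg_projective_def
    by (intro conjI principal_rmodule_right_module f(1) exI[of _ "1::nat"]
        bexI[of _ ?\<iota>] bexI[of _ ?\<pi>])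
qed

text \<open>Base change along \<open>\<phi>\<close> of the projective module \<open>fA\<close> of an idempotent \<open>f\<close>.\<close>
locale principal_base_change = A: ring A + B: ring B for A (structure) and B (structure) +
  fixes \<phi> f
  assumes phi: "\<phi> \<in> ring_hom A B" and f: "f \<in> carrier A" "f \<otimes>\<^bsub>A\<^esub> f = f"
begin

abbreviation P where "P \<equiv> principal_rmodule A f"
abbreviation gens where "gens \<equiv> tensor_gens B P"
abbreviation null where "null \<equiv> tensor_null A B \<phi> P"
abbreviation tensor where "tensor \<equiv> base_change A B \<phi> P"

text \<open>The evaluation \<open>x \<otimes> b \<mapsto> \<phi>(x)b\<close>, on the level of the free abelian group. It is chosen from the
  universal property of that group, because its target is an abelian group given by a record.\<close>
definition ev where
  "ev = (SOME h. h \<in> hom gens (add_monoid B) \<and>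
     (\<forall>z\<in>carrier P \<times> carrier B. h (frag_of z) = \<phi> (fst z) \<otimes>\<^bsub>B\<^esub> snd z))"

lemma P_carrier: "x \<in> carrier P \<longleftrightarrow> x \<in> carrier A \<and> f \<otimes>\<^bsub>A\<^esub> x = x"
  using f by (force simp: principal_rmodule_carrier A.m_assoc[symmetric])

lemma phi_closed: "a \<in> carrier A \<Longrightarrow> \<phi> a \<in> carrier B"
  using phi by (rule ring_hom_closed)

lemma ev: "ev \<in> hom gens (add_monoid B)"
  "\<lbrakk>x \<in> carrier P; b \<in> carrier B\<rbrakk> \<Longrightarrow> ev (frag_of (x, b)) = \<phi> x \<otimes>\<^bsub>B\<^esub> b"
proof -
  have "(\<lambda>z. \<phi> (fst z) \<otimes>\<^bsub>B\<^esub> snd z) ` (carrier P \<times> carrier B) \<subseteq> carrier (add_monoid B)"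
    by (auto simp: P_carrier phi_closed)
  then obtain h where "h \<in> hom gens (add_monoid B)"
    "\<And>z. z \<in> carrier P \<times> carrier B \<Longrightarrow> h (frag_of z) = \<phi> (fst z) \<otimes>\<^bsub>B\<^esub> snd z"
    using comm_group.free_Abelian_group_universal[OF B.a_comm_group] unfolding tensor_gens_def
    by blast
  then have "\<exists>h. h \<in> hom gens (add_monoid B) \<and>
     (\<forall>z\<in>carrier P \<times> carrier B. h (frag_of z) = \<phi> (fst z) \<otimes>\<^bsub>B\<^esub> snd z)" by blast
  from someI_ex[OF this, folded ev_def]
  show "ev \<in> hom gens (add_monoid B)"
    "\<lbrakk>x \<in> carrier P; b \<in> carrier B\<rbrakk> \<Longrightarrow> ev (frag_of (x, b)) = \<phi> x \<otimes>\<^bsub>B\<^esub> b" by auto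
qed

lemma gens_carrier: "z \<in> carrier gens \<longleftrightarrow> Poly_Mapping.keys z \<subseteq> carrier P \<times> carrier B"
  by (simp add: tensor_gens_def)

lemma gens_add: "z \<otimes>\<^bsub>gens\<^esub> w = z + w" by (simp add: tensor_gens_def)
lemma gens_zero: "\<one>\<^bsub>gens\<^esub> = 0" by (simp add: tensor_gens_def)
lemma gens_group: "comm_group gens"
  unfolding tensor_gens_def by (rule abelian_free_Abelian_group)

sublocale gens: comm_group gens by (rule gens_group)

lemma gens_closed:
  "0 \<in> carrier gens"
  "\<lbrakk>z \<in> carrier gens; w \<in> carrier gens\<rbrakk> \<Longrightarrow> z + w \<in> carrier gens"
  "\<lbrakk>z \<in> carrier gens; w \<in> carrier gens\<rbrakk> \<Longrightarrow> z - w \<in> carrier gens"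
  "\<lbrakk>x \<in> carrier P; b \<in> carrier B\<rbrakk> \<Longrightarrow> frag_of (x, b) \<in> carrier gens"
  using keys_add[of z w] keys_diff[of z w]
  by (auto simp: gens_carrier)

lemma gens_induct [consumes 1, case_names zero diff single]:
  assumes "z \<in> carrier gens" "Q 0"
    "\<And>z w. \<lbrakk>z \<in> carrier gens; w \<in> carrier gens; Q z; Q w\<rbrakk> \<Longrightarrow> Q (z - w)"
    "\<And>x b. \<lbrakk>x \<in> carrier P; b \<in> carrier B\<rbrakk> \<Longrightarrow> Q (frag_of (x, b))"
  shows "Q z"
  using assms(1)[unfolded gens_carrier]
  by (rule free_Abelian_group_induct) (use assms in \<open>auto simp: gens_carrier\<close>)

lemma ev_closed: "z \<in> carrier gens \<Longrightarrow> ev z \<in> carrier B"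
  using hom_in_carrier[OF ev(1)] by simp

lemma ev_add: "\<lbrakk>z \<in> carrier gens; w \<in> carrier gens\<rbrakk> \<Longrightarrow> ev (z + w) = ev z \<oplus>\<^bsub>B\<^esub> ev w"
  using hom_mult[OF ev(1)] by (simp add: gens_add)

lemma ev_zero: "ev 0 = \<zero>\<^bsub>B\<^esub>"
  using hom_one[OF ev(1) gens.is_group B.a_group] by (simp add: gens_zero)

lemma ev_diff:
  assumes "z \<in> carrier gens" "w \<in> carrier gens"
  shows "ev (z - w) = ev z \<ominus>\<^bsub>B\<^esub> ev w"
proof -
  have "ev z = ev (z - w) \<oplus>\<^bsub>B\<^esub> ev w"
    using ev_add[OF gens_closed(3)[OF assms] assms(2)] by simp
  then show ?thesis
    using assms ev_closed gens_closed(3)[OF assms]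
    by (simp add: B.minus_eq B.a_assoc B.r_neg)
qed

lemma relations_closed: "tensor_relations A B \<phi> P \<subseteq> carrier gens"
  unfolding tensor_relations_def using f
  by (auto simp: P_carrier A.r_distr A.m_assoc[symmetric] phi_closed
      intro!: gens_closed)

lemma P_closed:
  "x \<in> carrier P \<Longrightarrow> x \<in> carrier A"
  "\<lbrakk>x \<in> carrier P; y \<in> carrier P\<rbrakk> \<Longrightarrow> x \<oplus>\<^bsub>A\<^esub> y \<in> carrier P"
  "\<lbrakk>x \<in> carrier P; a \<in> carrier A\<rbrakk> \<Longrightarrow> x \<otimes>\<^bsub>A\<^esub> a \<in> carrier P"
  "f \<in> carrier P"
  using f by (auto simp: P_carrier A.r_distr A.m_assoc[symmetric])

lemma ev_relations:
  assumes "z \<in> tensor_relations A B \<phi> P"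
  shows "ev z = \<zero>\<^bsub>B\<^esub>"
proof -
  have cancel: "(u \<oplus>\<^bsub>B\<^esub> v) \<ominus>\<^bsub>B\<^esub> u \<ominus>\<^bsub>B\<^esub> v = \<zero>\<^bsub>B\<^esub>" if "u \<in> carrier B" "v \<in> carrier B" for u v
    using that by (subst B.a_comm) (simp_all add: B.minus_eq B.a_assoc B.r_neg B.r_neg2)
  have self: "u \<ominus>\<^bsub>B\<^esub> u = \<zero>\<^bsub>B\<^esub>" if "u \<in> carrier B" for u
    using that by (simp add: B.minus_eq B.r_neg)
  note [simp] = ev_diff ev(2) gens_closed P_closed phi_closed
  from assms consider
    (left) x y b where "z = frag_of (x \<oplus>\<^bsub>A\<^esub> y, b) - frag_of (x, b) - frag_of (y, b)"
      "x \<in> carrier P" "y \<in> carrier P" "b \<in> carrier B"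
  | (right) x b c where "z = frag_of (x, b \<oplus>\<^bsub>B\<^esub> c) - frag_of (x, b) - frag_of (x, c)"
      "x \<in> carrier P" "b \<in> carrier B" "c \<in> carrier B"
  | (middle) x a b where "z = frag_of (x \<otimes>\<^bsub>A\<^esub> a, b) - frag_of (x, \<phi> a \<otimes>\<^bsub>B\<^esub> b)"
      "x \<in> carrier P" "a \<in> carrier A" "b \<in> carrier B"
    unfolding tensor_relations_def by auto
  then show ?thesis
  proof cases
    case left
    then show ?thesis
      by (simp add: ring_hom_add[OF phi] B.l_distr cancel)
  next
    case right
    then show ?thesis by (simp add: B.r_distr cancel)
  next
    case middle
    then show ?thesis by (simp add: ring_hom_mult[OF phi] B.m_assoc self)
  qed
qed

lemma null_subgroup: "subgroup null gens"
  unfolding tensor_null_def using relations_closed by (rule gens.generate_is_subgroup)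

lemma null_relation: "z \<in> tensor_relations A B \<phi> P \<Longrightarrow> z \<in> null"
  unfolding tensor_null_def by (rule generate.incl)

lemma null_closed:
  "z \<in> null \<Longrightarrow> z \<in> carrier gens"
  "\<lbrakk>z \<in> null; w \<in> null\<rbrakk> \<Longrightarrow> z + w \<in> null"
  "\<lbrakk>z \<in> null; w \<in> null\<rbrakk> \<Longrightarrow> z - w \<in> null"
proof -
  show c: "z \<in> null \<Longrightarrow> z \<in> carrier gens" for z
    using null_subgroup subgroup.mem_carrier by fast
  show a: "\<lbrakk>z \<in> null; w \<in> null\<rbrakk> \<Longrightarrow> z + w \<in> null" for z w
    using subgroup.m_closed[OF null_subgroup, of z w] by (simp add: gens_add)
  assume zw: "z \<in> null" "w \<in> null"
  have "inv\<^bsub>gens\<^esub> w = - w"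
    using c[OF zw(2)] unfolding tensor_gens_def by simp
  then have "- w \<in> null"
    using subgroup.m_inv_closed[OF null_subgroup zw(2)] by simp
  then show "z - w \<in> null" using a[OF zw(1)] by fastforce
qed

lemma ev_null: "z \<in> null \<Longrightarrow> ev z = \<zero>\<^bsub>B\<^esub>"
proof -
  interpret e: group_hom gens "add_monoid B" ev
    using ev(1) by (intro group_hom.intro group_hom_axioms.intro gens.is_group B.a_group)
  have "null \<subseteq> kernel gens (add_monoid B) ev"
    unfolding tensor_null_def using ev_relations relations_closed
    by (intro gens.generate_subgroup_incl e.subgroup_kernel) (auto simp: kernel_def)
  then show "z \<in> null \<Longrightarrow> ev z = \<zero>\<^bsub>B\<^esub>" by (auto simp: kernel_def)
qed

lemma null_relation_right:
  "\<lbrakk>x \<in> carrier P; b \<in> carrier B; c \<in> carrier B\<rbrakk> \<Longrightarrow>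
    frag_of (x, b \<oplus>\<^bsub>B\<^esub> c) - frag_of (x, b) - frag_of (x, c) \<in> null"
  by (rule null_relation) (unfold tensor_relations_def, blast)

lemma null_relation_middle:
  "\<lbrakk>x \<in> carrier P; a \<in> carrier A; b \<in> carrier B\<rbrakk> \<Longrightarrow>
    frag_of (x \<otimes>\<^bsub>A\<^esub> a, b) - frag_of (x, \<phi> a \<otimes>\<^bsub>B\<^esub> b) \<in> null"
  by (rule null_relation) (unfold tensor_relations_def principal_rmodule_simps, blast)

text \<open>As \<open>x = f x\<close>, every generator \<open>(x, b)\<close> is congruent to \<open>(f, \<phi>(x)b)\<close>, and the generators \<open>(f, b)\<close> are
  additive in \<open>b\<close>. Hence an element is determined modulo the relations by its value under \<open>ev\<close>.\<close>
lemma normal_form: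
  assumes "z \<in> carrier gens"
  shows "z - frag_of (f, ev z) \<in> null"
  using assms
proof (induction z rule: gens_induct)
  case zero
  have "frag_of (f, \<zero>\<^bsub>B\<^esub> \<oplus>\<^bsub>B\<^esub> \<zero>\<^bsub>B\<^esub>) - frag_of (f, \<zero>\<^bsub>B\<^esub>) - frag_of (f, \<zero>\<^bsub>B\<^esub>) \<in> null"
    by (rule null_relation_right) (simp_all add: P_closed)
  then show ?case by (simp add: ev_zero)
next
  case (diff z w)
  let ?b = "ev z \<ominus>\<^bsub>B\<^esub> ev w"
  have b: "?b \<in> carrier B" "ev w \<in> carrier B" "?b \<oplus>\<^bsub>B\<^esub> ev w = ev z"
    using diff ev_closed by (auto simp: B.minus_eq B.a_assoc B.l_neg)
  have "frag_of (f, ?b \<oplus>\<^bsub>B\<^esub> ev w) - frag_of (f, ?b) - frag_of (f, ev w) \<in> null"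
    by (rule null_relation_right) (simp_all add: P_closed b)
  then have "(z - frag_of (f, ev z)) - (w - frag_of (f, ev w)) +
      (frag_of (f, ev z) - frag_of (f, ?b) - frag_of (f, ev w)) \<in> null"
    unfolding b(3) by (rule null_closed(2)[OF null_closed(3)[OF diff(3,4)]])
  then show ?case using diff by (simp add: ev_diff algebra_simps)
next
  case (single x b)
  then have "frag_of (f \<otimes>\<^bsub>A\<^esub> x, b) - frag_of (f, \<phi> x \<otimes>\<^bsub>B\<^esub> b) \<in> null"
    by (intro null_relation_middle P_closed)
  then show ?case using single by (simp add: ev(2)) (simp add: P_carrier)
qed

text \<open>If \<open>ev z = 0\<close> then \<open>z\<close> is congruent to \<open>(f, 0)\<close>, which is the normal form of \<open>0\<close>.\<close>
lemma null_iff: "z \<in> null \<longleftrightarrow> z \<in> carrier gens \<and> ev z = \<zero>\<^bsub>B\<^esub>"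
proof
  assume z: "z \<in> carrier gens \<and> ev z = \<zero>\<^bsub>B\<^esub>"
  then have "z - frag_of (f, \<zero>\<^bsub>B\<^esub>) \<in> null" using normal_form[of z] by simp
  moreover have "0 - frag_of (f, \<zero>\<^bsub>B\<^esub>) \<in> null" using normal_form[OF gens_closed(1)] by (simp add: ev_zero)
  ultimately have "(z - frag_of (f, \<zero>\<^bsub>B\<^esub>)) - (0 - frag_of (f, \<zero>\<^bsub>B\<^esub>)) \<in> null" by (rule null_closed)
  then show "z \<in> null" by simp
qed (use ev_null null_closed in auto)

text \<open>By \<open>null_iff\<close> the cosets that make up the tensor product are the fibres of \<open>ev\<close>, and the possible
  values are those in the right ideal \<open>\<phi>(f)B\<close>. So \<open>fibre\<close> is the isomorphism from \<open>\<phi>(f)B\<close> to \<open>fA \<otimes>\<^sub>A B\<close>.\<close>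
definition fibre where "fibre b = {z \<in> carrier gens. ev z = b}"
definition im where "im = {b \<in> carrier B. \<phi> f \<otimes>\<^bsub>B\<^esub> b = b}"

lemma phi_f: "\<phi> f \<in> carrier B" "\<phi> f \<otimes>\<^bsub>B\<^esub> \<phi> f = \<phi> f"
  using f phi_closed ring_hom_mult[OF phi, of f f] by auto

lemma im_closed: "b \<in> im \<Longrightarrow> b \<in> carrier B" by (simp add: im_def)

lemma ev_im: "z \<in> carrier gens \<Longrightarrow> ev z \<in> im"
proof (induction z rule: gens_induct)
  case zero
  then show ?case using phi_f by (simp add: im_def ev_zero)
next
  case (diff z w)
  then have "ev z \<in> carrier B" "ev w \<in> carrier B" by (simp_all add: ev_closed)
  with diff show ?case
    using phi_f by (simp add: im_def ev_diff B.minus_eq B.r_distr B.r_minus)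
next
  case (single x b)
  then have "\<phi> f \<otimes>\<^bsub>B\<^esub> \<phi> x = \<phi> x"
    using ring_hom_mult[OF phi, of f x] f by (simp add: P_carrier)
  with single phi_f show ?case
    by (simp add: im_def ev(2) P_closed phi_closed B.m_assoc[symmetric])
qed

lemma fibre_generator: "b \<in> im \<Longrightarrow> frag_of (f, b) \<in> fibre b"
  by (simp add: fibre_def im_def ev(2) P_closed gens_closed)

lemma fibre_inj: "\<lbrakk>b \<in> im; fibre b = fibre c\<rbrakk> \<Longrightarrow> b = c"
  using fibre_generator[of b] by (auto simp: fibre_def)

lemma null_coset:
  assumes "z \<in> carrier gens" shows "null #>\<^bsub>gens\<^esub> z = fibre (ev z)"
proof
  show "null #>\<^bsub>gens\<^esub> z \<subseteq> fibre (ev z)"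
    using assms by (auto simp: r_coset_def fibre_def gens_add null_iff gens_closed ev_add ev_closed)
  show "fibre (ev z) \<subseteq> null #>\<^bsub>gens\<^esub> z"
  proof
    fix w assume w: "w \<in> fibre (ev z)"
    then have "w - z \<in> null"
      using assms by (auto simp: fibre_def null_iff gens_closed ev_diff ev_closed B.minus_eq B.r_neg)
    moreover have "w = (w - z) + z" by simp
    ultimately show "w \<in> null #>\<^bsub>gens\<^esub> z" unfolding r_coset_def gens_add by blast
  qed
qed

lemma tensor_carrier: "carrier tensor = fibre ` im"
proof -
  have "carrier tensor = {null #>\<^bsub>gens\<^esub> z | z. z \<in> carrier gens}"
    by (auto simp: base_change_def Let_def FactGroup_def RCOSETS_def)
  also have "\<dots> = {fibre (ev z) | z. z \<in> carrier gens}"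
    using null_coset by auto
  also have "\<dots> = fibre ` im"
  proof
    show "{fibre (ev z) | z. z \<in> carrier gens} \<subseteq> fibre ` im" using ev_im by blast
    show "fibre ` im \<subseteq> {fibre (ev z) | z. z \<in> carrier gens}"
    proof clarify
      fix b assume "b \<in> im"
      then have "frag_of (f, b) \<in> carrier gens" "ev (frag_of (f, b)) = b"
        using fibre_generator[of b] unfolding fibre_def by auto
      then show "\<exists>z. fibre b = fibre (ev z) \<and> z \<in> carrier gens" by metis
    qed
  qed
  finally show ?thesis .
qed

lemma fibre_eq_coset: "b \<in> im \<Longrightarrow> fibre b = null #>\<^bsub>gens\<^esub> frag_of (f, b)"
  using fibre_generator[of b] null_coset[of "frag_of (f, b)"] by (simp add: fibre_def)

lemma tensor_add:
  assumes "b \<in> im" "c \<in> im"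
  shows "fibre b \<oplus>\<^bsub>tensor\<^esub> fibre c = fibre (b \<oplus>\<^bsub>B\<^esub> c)"
proof -
  let ?b = "frag_of (f, b)" and ?c = "frag_of (f, c)"
  have bc: "?b \<in> carrier gens" "?c \<in> carrier gens" "ev ?b = b" "ev ?c = c"
    using assms fibre_generator by (auto simp: fibre_def)
  have "fibre b \<oplus>\<^bsub>tensor\<^esub> fibre c = (null #>\<^bsub>gens\<^esub> ?b) <#>\<^bsub>gens\<^esub> (null #>\<^bsub>gens\<^esub> ?c)"
    using assms by (simp add: base_change_def Let_def FactGroup_def fibre_eq_coset)
  also have "\<dots> = null #>\<^bsub>gens\<^esub> (?b + ?c)"
    using normal.rcos_sum[OF gens.subgroup_imp_normal[OF null_subgroup] bc(1,2)] by (simp add: gens_add)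
  also have "\<dots> = fibre (b \<oplus>\<^bsub>B\<^esub> c)"
    using bc by (simp add: null_coset gens_closed ev_add)
  finally show ?thesis .
qed

end

text \<open>A map of generators that \<open>ev\<close> turns into an additive map \<open>L\<close> of \<open>B\<close> moves the fibres as \<open>L\<close>
  moves their values. This covers both the action of \<open>B\<close> (\<open>L\<close> a right multiplication) and the map
  induced by a homomorphism of modules (\<open>L\<close> a left multiplication).\<close>
lemma tensor_induced_fibre:
  assumes "principal_base_change A B \<phi> f" "principal_base_change A B \<phi> f'"
    and g: "\<And>x b. \<lbrakk>x \<in> carrier (principal_rmodule A f); b \<in> carrier B\<rbrakk> \<Longrightarrow>
      g (x, b) \<in> carrier (principal_rmodule A f') \<times> carrier B \<and>
      \<phi> (fst (g (x, b))) \<otimes>\<^bsub>B\<^esub> snd (g (x, b)) = L (\<phi> x \<otimes>\<^bsub>B\<^esub> b)"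
    and L: "\<And>b c. \<lbrakk>b \<in> carrier B; c \<in> carrier B\<rbrakk> \<Longrightarrow> L (b \<ominus>\<^bsub>B\<^esub> c) = L b \<ominus>\<^bsub>B\<^esub> L c"
      "L \<zero>\<^bsub>B\<^esub> = \<zero>\<^bsub>B\<^esub>"
    and b: "b \<in> principal_base_change.im B \<phi> f"
  shows "tensor_induced A B \<phi> (principal_rmodule A f') g (principal_base_change.fibre A B \<phi> f b) =
    principal_base_change.fibre A B \<phi> f' (L b)"
proof -
  interpret P: principal_base_change A B \<phi> f by fact
  interpret Q: principal_base_change A B \<phi> f' by fact
  let ?g = "frag_extend (\<lambda>z. frag_of (g z))"
  have ev_g: "?g z \<in> carrier Q.gens \<and> Q.ev (?g z) = L (P.ev z)" if "z \<in> carrier P.gens" for z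
    using that
  proof (induction z rule: P.gens_induct)
    case zero
    then show ?case by (simp add: Q.gens_closed P.ev_zero Q.ev_zero L)
  next
    case (diff z w)
    then show ?case
      by (simp add: frag_extend_diff Q.gens_closed P.ev_diff Q.ev_diff L P.ev_closed)
  next
    case (single x b)
    then show ?case using g[of x b] by (cases "g (x, b)") (auto simp: Q.gens_closed P.ev Q.ev)
  qed
  have "tensor_induced A B \<phi> Q.P g (P.fibre b) = (\<Union>z\<in>P.fibre b. Q.null #>\<^bsub>Q.gens\<^esub> ?g z)"
    by (auto simp: tensor_induced_def set_mult_def r_coset_def)
  also have "\<dots> = (\<Union>z\<in>P.fibre b. Q.fibre (L b))"
    using ev_g by (intro SUP_cong) (auto simp: P.fibre_def Q.null_coset)
  also have "\<dots> = Q.fibre (L b)" using P.fibre_generator[OF b] by blast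
  finally show ?thesis .
qed

context principal_base_change begin

lemma tensor_act:
  assumes "b \<in> im" "c \<in> carrier B"
  shows "act tensor (fibre b) c = fibre (b \<otimes>\<^bsub>B\<^esub> c)"
proof -
  have "tensor_induced A B \<phi> P (\<lambda>(x, d). (x, d \<otimes>\<^bsub>B\<^esub> c)) (fibre b) = fibre (b \<otimes>\<^bsub>B\<^esub> c)"
    by (rule tensor_induced_fibre[where L = "\<lambda>b. b \<otimes>\<^bsub>B\<^esub> c"])
      (use assms in \<open>auto simp: principal_base_change_axioms B.m_assoc P_closed phi_closed
        B.minus_eq B.l_distr B.l_minus\<close>)
  then show ?thesis by (simp add: base_change_def Let_def)
qed

end

text \<open>Through \<open>fibre\<close>, the base change of left multiplication by \<open>p: fA \<rightarrow> f'A\<close> is left multiplication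
  by \<open>\<phi>(p)\<close> from \<open>\<phi>(f)B\<close> to \<open>\<phi>(f')B\<close>. If this is bijective, the preimage \<open>g\<close> of \<open>\<phi>(f')\<close> is the inverse: the
  other identities for \<open>g\<close> hold because both of their sides have the same image under \<open>\<phi>(p)\<close>.\<close>
lemma base_change_principal_iso_iff:
  assumes "principal_base_change A B \<phi> f" "principal_base_change A B \<phi> f'"
    and p: "p \<in> carrier A" "f' \<otimes>\<^bsub>A\<^esub> p = p" "p \<otimes>\<^bsub>A\<^esub> f = p"
  shows "base_change_map A B \<phi> (principal_rmodule A f') (\<lambda>a. p \<otimes>\<^bsub>A\<^esub> a)
      \<in> rmodule_iso B (base_change A B \<phi> (principal_rmodule A f))
          (base_change A B \<phi> (principal_rmodule A f')) \<longleftrightarrow>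
    (\<exists>g\<in>carrier B. \<phi> f \<otimes>\<^bsub>B\<^esub> g = g \<and> g \<otimes>\<^bsub>B\<^esub> \<phi> f' = g \<and> \<phi> p \<otimes>\<^bsub>B\<^esub> g = \<phi> f' \<and> g \<otimes>\<^bsub>B\<^esub> \<phi> p = \<phi> f)"
    (is "?m \<in> _ \<longleftrightarrow> ?inv")
proof -
  interpret P: principal_base_change A B \<phi> f by fact
  interpret Q: principal_base_change A B \<phi> f' by fact
  let ?p = "\<phi> p"
  have pB: "?p \<in> carrier B" "\<phi> f' \<otimes>\<^bsub>B\<^esub> ?p = ?p" "?p \<otimes>\<^bsub>B\<^esub> \<phi> f = ?p"
    using p P.f Q.f ring_hom_mult[OF P.phi, of f' p] ring_hom_mult[OF P.phi, of p f]
    by (simp_all add: P.phi_closed)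
  have m: "?m (P.fibre b) = Q.fibre (?p \<otimes>\<^bsub>B\<^esub> b)" if "b \<in> P.im" for b
    unfolding base_change_map_def
  proof (rule tensor_induced_fibre[OF assms(1,2)])
    show "(case (x, b) of (x, b) \<Rightarrow> (p \<otimes>\<^bsub>A\<^esub> x, b)) \<in> carrier Q.P \<times> carrier B \<and>
      \<phi> (fst (case (x, b) of (x, b) \<Rightarrow> (p \<otimes>\<^bsub>A\<^esub> x, b))) \<otimes>\<^bsub>B\<^esub> snd (case (x, b) of (x, b) \<Rightarrow> (p \<otimes>\<^bsub>A\<^esub> x, b)) =
      ?p \<otimes>\<^bsub>B\<^esub> (\<phi> x \<otimes>\<^bsub>B\<^esub> b)" if "x \<in> carrier P.P" "b \<in> carrier B" for x b
      using that p Q.f P.P_closed(1)[of x]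
      by (auto simp: Q.P_carrier P.A.m_assoc[symmetric] ring_hom_mult[OF P.phi] P.phi_closed P.B.m_assoc)
  qed (use that pB in \<open>auto simp: P.B.minus_eq P.B.r_distr P.B.r_minus\<close>)
  have im: "?p \<otimes>\<^bsub>B\<^esub> b \<in> Q.im" if "b \<in> P.im" for b
    using that pB Q.phi_f by (simp add: P.im_def Q.im_def P.B.m_assoc[symmetric])
  have add: "b \<oplus>\<^bsub>B\<^esub> c \<in> P.im" if "b \<in> P.im" "c \<in> P.im" for b c
    using that P.phi_f by (simp add: P.im_def P.B.r_distr)
  have mult: "b \<otimes>\<^bsub>B\<^esub> d \<in> P.im" if "b \<in> P.im" "d \<in> carrier B" for b d
    using that P.phi_f by (simp add: P.im_def P.B.m_assoc[symmetric])
  have hom: "?m \<in> rmodule_hom B P.tensor Q.tensor"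
    unfolding rmodule_hom_def
  proof (intro CollectI conjI ballI)
    show "?m \<in> carrier P.tensor \<rightarrow> carrier Q.tensor"
      by (auto simp: P.tensor_carrier Q.tensor_carrier m im)
  next
    fix x y assume "x \<in> carrier P.tensor" "y \<in> carrier P.tensor"
    then obtain b c where "b \<in> P.im" "c \<in> P.im" "x = P.fibre b" "y = P.fibre c"
      by (auto simp: P.tensor_carrier)
    then show "?m (x \<oplus>\<^bsub>P.tensor\<^esub> y) = ?m x \<oplus>\<^bsub>Q.tensor\<^esub> ?m y"
      using pB by (simp add: P.tensor_add m add im Q.tensor_add P.B.r_distr P.im_closed)
  next
    fix x d assume "x \<in> carrier P.tensor" and d: "d \<in> carrier B"
    then obtain b where "b \<in> P.im" "x = P.fibre b"
      by (auto simp: P.tensor_carrier)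
    then show "?m (act P.tensor x d) = act Q.tensor (?m x) d"
      using pB d by (simp add: P.tensor_act m mult im Q.tensor_act P.B.m_assoc P.im_closed)
  qed
  show ?thesis
  proof
    assume "?m \<in> rmodule_iso B P.tensor Q.tensor"
    then have bij: "bij_betw ?m (P.fibre ` P.im) (Q.fibre ` Q.im)"
      by (simp add: rmodule_iso_def P.tensor_carrier Q.tensor_carrier)
    have inj: "b = c" if "b \<in> P.im" "c \<in> P.im" "?p \<otimes>\<^bsub>B\<^esub> b = ?p \<otimes>\<^bsub>B\<^esub> c" for b c
      using bij_betw_imp_inj_on[OF bij, THEN inj_onD, of "P.fibre b" "P.fibre c"] that
      by (auto simp: m dest: P.fibre_inj)
    have "\<phi> f' \<in> Q.im" using Q.phi_f by (simp add: Q.im_def)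
    then have "Q.fibre (\<phi> f') \<in> ?m ` (P.fibre ` P.im)"
      using bij by (auto simp: bij_betw_def)
    then obtain g where g: "g \<in> P.im" "Q.fibre (\<phi> f') = Q.fibre (?p \<otimes>\<^bsub>B\<^esub> g)"
      by (auto simp: m)
    then have pg: "?p \<otimes>\<^bsub>B\<^esub> g = \<phi> f'"
      using Q.fibre_inj[OF \<open>\<phi> f' \<in> Q.im\<close>] by simp
    have gB: "g \<in> carrier B" using g by (simp add: P.im_def)
    have "g \<otimes>\<^bsub>B\<^esub> ?p = \<phi> f"
    proof (rule inj)
      show "g \<otimes>\<^bsub>B\<^esub> ?p \<in> P.im" using mult g pB by simp
      show "\<phi> f \<in> P.im" using P.phi_f by (simp add: P.im_def)
      show "?p \<otimes>\<^bsub>B\<^esub> (g \<otimes>\<^bsub>B\<^esub> ?p) = ?p \<otimes>\<^bsub>B\<^esub> \<phi> f"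
        using gB pB pg by (simp add: P.B.m_assoc[symmetric])
    qed
    moreover have "g \<otimes>\<^bsub>B\<^esub> \<phi> f' = g"
    proof (rule inj)
      show "g \<otimes>\<^bsub>B\<^esub> \<phi> f' \<in> P.im" using mult g Q.phi_f by simp
      show "?p \<otimes>\<^bsub>B\<^esub> (g \<otimes>\<^bsub>B\<^esub> \<phi> f') = ?p \<otimes>\<^bsub>B\<^esub> g"
        using gB pB pg Q.phi_f by (simp add: P.B.m_assoc[symmetric])
    qed (use g in simp)
    ultimately show ?inv using g pg gB by (auto simp: P.im_def)
  next
    assume ?inv
    then obtain g where g: "g \<in> carrier B" "\<phi> f \<otimes>\<^bsub>B\<^esub> g = g" "?p \<otimes>\<^bsub>B\<^esub> g = \<phi> f'" "g \<otimes>\<^bsub>B\<^esub> ?p = \<phi> f"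
      by blast
    have "inj_on ?m (P.fibre ` P.im)"
    proof (rule inj_onI; clarify)
      fix b c assume bc: "b \<in> P.im" "c \<in> P.im" "?m (P.fibre b) = ?m (P.fibre c)"
      then have "?p \<otimes>\<^bsub>B\<^esub> b = ?p \<otimes>\<^bsub>B\<^esub> c" using Q.fibre_inj[OF im[OF bc(1)]] m[OF bc(1)] m[OF bc(2)] by simp
      then have "g \<otimes>\<^bsub>B\<^esub> (?p \<otimes>\<^bsub>B\<^esub> b) = g \<otimes>\<^bsub>B\<^esub> (?p \<otimes>\<^bsub>B\<^esub> c)" by simp
      then have "g \<otimes>\<^bsub>B\<^esub> ?p \<otimes>\<^bsub>B\<^esub> b = g \<otimes>\<^bsub>B\<^esub> ?p \<otimes>\<^bsub>B\<^esub> c"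
        using bc(1,2) g(1) pB(1) P.im_closed P.B.m_assoc by simp
      then have "\<phi> f \<otimes>\<^bsub>B\<^esub> b = \<phi> f \<otimes>\<^bsub>B\<^esub> c" unfolding g(4) .
      then show "P.fibre b = P.fibre c" using bc(1,2) by (simp add: P.im_def)
    qed
    moreover have "Q.fibre b \<in> ?m ` (P.fibre ` P.im)" if b: "b \<in> Q.im" for b
    proof -
      have "g \<otimes>\<^bsub>B\<^esub> b \<in> P.im" "?p \<otimes>\<^bsub>B\<^esub> (g \<otimes>\<^bsub>B\<^esub> b) = b"
        using b g pB P.phi_f by (simp_all add: P.im_def Q.im_def P.B.m_assoc[symmetric])
      then show ?thesis using m[of "g \<otimes>\<^bsub>B\<^esub> b"] by (intro image_eqI[of _ _ "P.fibre (g \<otimes>\<^bsub>B\<^esub> b)"]) simp_all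
    qed
    ultimately show "?m \<in> rmodule_iso B P.tensor Q.tensor"
      using hom im by (auto simp: rmodule_iso_def P.tensor_carrier Q.tensor_carrier bij_betw_def m)
  qed
qed

section \<open>The path algebra and its homomorphism to matrices\<close>

lemma loc_quiver_simps:
  "verts (loc_quiver n X) = {1..n}" "tail (loc_quiver n X) = level"
  "head (loc_quiver n X) = (\<lambda>c. level c + 1)"
  "arcs (loc_quiver n X) = {E m | m. 1 \<le> m \<and> m < n} \<union> {G m x | m x. 1 \<le> m \<and> m < n \<and> x \<in> X}"
  by (simp_all add: loc_quiver_def)

lemma loc_quiver_wf: "wf_digraph (loc_quiver n X)"
  by (rule wf_digraph.intro) (auto simp: loc_quiver_simps)

text \<open>In these quivers the tail and the head of an arrow are functions of its level alone, so consistency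
  of a list of arrows can be tested in any of them; the empty one serves as representative.\<close>
abbreviation level_cas :: "nat \<Rightarrow> 'x arrow list \<Rightarrow> nat \<Rightarrow> bool" where
  "level_cas \<equiv> pre_digraph.cas (loc_quiver 0 {})"

lemma paths_loc_quiver:
  "(i, cs, j) \<in> paths (loc_quiver n X) \<longleftrightarrow>
    i \<in> {1..n} \<and> set cs \<subseteq> arcs (loc_quiver n X) \<and> level_cas i cs j"
proof -
  have "pre_digraph.cas (loc_quiver n X) i cs j = level_cas i cs j"
    by (induction cs arbitrary: i) (simp_all add: pre_digraph.cas.simps loc_quiver_def)
  then show ?thesis by (simp add: paths_def pre_digraph.awalk_def loc_quiver_simps)
qed

lemma level_cas_simps:
  "level_cas u [] v = (u = v)"
  "level_cas u (c # cs) v = (level c = u \<and> level_cas (u + 1) cs v)"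
  by (auto simp: pre_digraph.cas.simps loc_quiver_def)

lemma level_cas_append: "level_cas u p v \<Longrightarrow> level_cas v q w \<Longrightarrow> level_cas u (p @ q) w"
  by (induction p arbitrary: u) (auto simp: level_cas_simps)

lemma level_cas_E: "s \<le> t \<Longrightarrow> level_cas s (map E [s..<t]) t"
  by (induction t rule: dec_induct) (auto simp: level_cas_simps intro: level_cas_append)

lemma level_cas_G: "level_cas s (map2 G [s..<s + length w] w) (s + length w)"
proof (induction w arbitrary: s)
  case (Cons x w)
  have "[s..<s + length (x # w)] = s # [Suc s..<Suc s + length w]"
    by (simp add: upt_conv_Cons del: upt_Suc)
  then show ?case using Cons[of "Suc s"] by (simp add: level_cas_simps Suc_eq_plus1[symmetric] del: upt_Suc Suc_eq_plus1)
qed (simp add: level_cas_simps)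

lemma path_bounds:
  assumes "(i, cs, j) \<in> paths (loc_quiver n X)"
  shows "1 \<le> i" "i \<le> j" "j \<le> n"
proof -
  have "level_cas i cs j \<Longrightarrow> i \<le> j" for i
    by (induction cs arbitrary: i) (auto simp: level_cas_simps, fastforce)
  then show "1 \<le> i" "i \<le> j" using assms by (auto simp: paths_loc_quiver)
  have "level_cas i cs j \<Longrightarrow> i \<le> n \<Longrightarrow> set cs \<subseteq> arcs (loc_quiver n X) \<Longrightarrow> j \<le> n" for i
    by (induction cs arbitrary: i) (auto simp: level_cas_simps loc_quiver_simps)
  then show "j \<le> n" using assms by (auto simp: paths_loc_quiver)
qed

lemma arrow_path:
  "\<lbrakk>1 \<le> m; m < n\<rbrakk> \<Longrightarrow> (m, [E m], m + 1) \<in> paths (loc_quiver n X)"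
  "\<lbrakk>1 \<le> m; m < n; x \<in> X\<rbrakk> \<Longrightarrow> (m, [G m x], m + 1) \<in> paths (loc_quiver n X)"
  by (auto simp: paths_loc_quiver level_cas_simps loc_quiver_simps)

lemma vertex_path: "\<lbrakk>1 \<le> m; m \<le> n\<rbrakk> \<Longrightarrow> (m, [], m) \<in> paths (loc_quiver n X)"
  by (auto simp: paths_loc_quiver level_cas_simps)

lemma e_path_path: "\<lbrakk>1 \<le> s; s \<le> t; t \<le> n\<rbrakk> \<Longrightarrow> e_path s t \<in> paths (loc_quiver n X)"
  by (auto simp: e_path_def paths_loc_quiver level_cas_E loc_quiver_simps)

lemma e_path_arrow: "e_path m (m + 1) = (m, [E m], m + 1)"
  by (simp add: e_path_def Suc_eq_plus1[symmetric] del: Suc_eq_plus1)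

lemma T_paths:
  assumes "1 \<le> m" "m < n" "x \<in> X"
  shows "(1, map E [1..<m] @ G m x # map E [m + 1..<n], n) \<in> paths (loc_quiver n X)"
proof -
  have "level_cas m (G m x # map E [m + 1..<n]) n"
    using assms level_cas_E[of "m + 1" n] by (simp add: level_cas_simps)
  with level_cas_E[OF assms(1)] show ?thesis
    using assms by (auto simp: paths_loc_quiver loc_quiver_simps intro: level_cas_append)
qed

lemma word_path_path:
  assumes "w \<in> lists X" "length w < n"
  shows "word_path n w \<in> paths (loc_quiver n X)"
proof -
  let ?u = "length w"
  have "level_cas 1 (map2 G [1..<?u + 1] w @ map E [?u + 1..<n]) n"
    using level_cas_G[of 1 w] level_cas_E[of "?u + 1" n] assms
    by (intro level_cas_append[of _ _ "?u + 1"]) (simp_all add: add.commute)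
  moreover have "set (map2 G [1..<?u + 1] w) \<subseteq> arcs (loc_quiver n X)"
  proof
    fix c assume "c \<in> set (map2 G [1..<?u + 1] w)"
    then obtain m x where "(m, x) \<in> set (zip [1..<?u + 1] w)" "c = G m x" by auto
    moreover from this(1) have "m \<in> set [1..<?u + 1]" "x \<in> set w"
      by (blast dest: set_zip_leftD set_zip_rightD)+
    ultimately show "c \<in> arcs (loc_quiver n X)"
      using assms by (auto simp: loc_quiver_simps)
  qed
  ultimately show ?thesis
    using assms by (auto simp: word_path_def paths_loc_quiver loc_quiver_simps)
qed

text \<open>The word in the generators that remains of a path when every \<open>e\<^sub>m\<close> becomes \<open>1\<close>.\<close>
fun arrow_word :: "'x arrow list \<Rightarrow> 'x list" where
  "arrow_word [] = []"
| "arrow_word (E m # cs) = arrow_word cs"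
| "arrow_word (G m x # cs) = x # arrow_word cs"

lemma arrow_word_append: "arrow_word (p @ q) = arrow_word p @ arrow_word q"
  by (induction p rule: arrow_word.induct) auto

lemma arrow_word_E: "arrow_word (map E ms) = []"
  by (induction ms) auto

lemma arrow_word_G: "length ms = length w \<Longrightarrow> arrow_word (map2 G ms w) = w"
  by (induction ms w rule: list_induct2) auto

lemma arrow_word_word_path:
  "word_path n w = (1, cs, n) \<Longrightarrow> arrow_word cs = w"
  by (auto simp: word_path_def arrow_word_append arrow_word_E arrow_word_G)

lemma arrow_word_lists: "set cs \<subseteq> arcs (loc_quiver n X) \<Longrightarrow> arrow_word cs \<in> lists X"
  by (induction cs rule: arrow_word.induct) (auto simp: loc_quiver_simps)

locale presentation =
  fixes K :: "('k, 'm) ring_scheme" and X :: "'x set" and Y :: "('x list \<Rightarrow> 'k) set"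
  assumes K: "field K" and finite_X: "finite X" and finite_Y: "finite Y"
    and Y_carrier: "Y \<subseteq> carrier (free_algebra K X)"
begin

abbreviation n where "n \<equiv> size_of_pres K Y"
abbreviation Q where "Q \<equiv> loc_quiver n X"
abbreviation one_K ("\<one>\<^sub>K") where "\<one>\<^sub>K \<equiv> \<one>\<^bsub>K\<^esub>"

lemma ring_K: "ring K"
  using K by (simp add: field_def domain_def cring_def)

sublocale fa: basis_algebra K "lists X" "{[]}" "\<lambda>u v. Some (u @ v)"
  by (rule free_algebra_basis[OF ring_K])

sublocale fq: quotient_by fa.alg Y
  using Y_carrier by (intro quotient_by.intro quotient_by_axioms.intro fa.alg_ring)
    (simp add: free_algebra_def)

sublocale pa: basis_algebra K "paths Q" "{(v, [], v) | v. v \<in> verts Q}" path_comp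
  by (rule path_algebra_basis[OF ring_K loc_quiver_wf]) (simp add: loc_quiver_simps)

sublocale ma: matrix_alg fq.RQ n
  by (rule matrix_alg.intro[OF fq.quot_ring])

abbreviation trm where "trm \<equiv> term_elt K"

lemma presented_algebra_eq: "presented_algebra K X Y = fq.RQ"
  by (simp add: presented_algebra_def free_algebra_def)

lemma n_pos: "1 \<le> n"
  by (simp add: size_of_pres_def Let_def)

text \<open>This is what the choice of \<open>n\<close> is for: the words in the relations have length at most \<open>n - 1\<close>, so that
  \<open>word_path n w\<close> is a path from \<open>1\<close> to \<open>n\<close>.\<close>
lemma word_bound:
  assumes y: "y \<in> Y" and w: "y w \<noteq> \<zero>\<^bsub>K\<^esub>"
  shows "w \<in> lists X" "length w < n"
proof -
  have carr: "y \<in> carrier fa.alg" if "y \<in> Y" for y using that fq.Y_subset by blast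
  show "w \<in> lists X" using fa.alg_support_subset[OF carr[OF y]] w by blast
  let ?W = "{w. \<exists>y\<in>Y. y w \<noteq> \<zero>\<^bsub>K\<^esub>}"
  have "?W = (\<Union>y\<in>Y. {w. y w \<noteq> \<zero>\<^bsub>K\<^esub>})" by auto
  then have "finite ?W" using finite_Y fa.alg_finite_support carr by simp
  moreover have "w \<in> ?W" using y w by blast
  ultimately have "length w \<le> Max (length ` ?W)" by (intro Max_ge) auto
  moreover have "n = Max (length ` ?W) + 1"
    using \<open>w \<in> ?W\<close> by (auto simp: size_of_pres_def Let_def)
  ultimately show "length w < n" by simp
qed

lemma trm_mult:
  assumes "(i, p, j) \<in> paths Q" "(j, q, k) \<in> paths Q" "c \<in> carrier K" "d \<in> carrier K"
  shows "trm c (i, p, j) \<otimes>\<^bsub>pa.alg\<^esub> trm d (j, q, k) = trm (c \<otimes>\<^bsub>K\<^esub> d) (i, p @ q, k)"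
  using assms by (simp add: pa.trm_mult)

lemma one_K_closed: "\<one>\<^sub>K \<in> carrier K"
  using ring_K by (simp add: monoid.one_closed ring.is_monoid)

lemma word_term_closed:
  assumes "y \<in> Y" "y w \<noteq> \<zero>\<^bsub>K\<^esub>"
  shows "trm (y w) (word_path n w) \<in> carrier pa.alg"
  using word_bound[OF assms] assms fq.Y_subset
  by (intro pa.trm_closed word_path_path fa.alg_coeff_closed) auto

lemma loc_rels_closed: "loc_rels K X Y \<subseteq> carrier pa.alg"
proof -
  have "T_rels K n X \<subseteq> carrier pa.alg"
  proof -
    have "trm \<one>\<^sub>K (1, G 1 x # map E [2..<n], n) \<in> carrier pa.alg"
      "trm \<one>\<^sub>K (1, map E [1..<m] @ G m x # map E [m + 1..<n], n) \<in> carrier pa.alg"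
      if "1 < m" "m < n" "x \<in> X" for m x
      using that T_paths[of m n x X] T_paths[of 1 n x X]
      by (auto intro!: pa.trm_closed one_K_closed)
    then show ?thesis
      unfolding T_rels_def path_algebra_def by (auto intro!: pa.alg.minus_closed)
  qed
  moreover have "Y_rel K n X y \<in> carrier pa.alg" if "y \<in> Y" for y
    unfolding Y_rel_def path_algebra_def using that
    by (intro pa.alg.finsum_closed) (auto intro: word_term_closed)
  ultimately show ?thesis by (auto simp: loc_rels_def Let_def)
qed

sublocale pq: quotient_by pa.alg "loc_rels K X Y"
  by (intro quotient_by.intro quotient_by_axioms.intro pa.alg_ring loc_rels_closed)

abbreviation pcls where "pcls p \<equiv> pq.cls (trm \<one>\<^sub>K p)"

lemma loc_algebra_eq: "loc_algebra K X Y = pq.RQ"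
  by (simp add: loc_algebra_def bound_path_algebra_def path_algebra_def)

lemma path_class_eq: "path_class K X Y p = pcls p"
  by (simp add: path_class_def path_algebra_def Let_def)

lemma pcls_closed: "p \<in> paths Q \<Longrightarrow> pcls p \<in> carrier pq.RQ"
  by (intro ring_hom_closed[OF pq.cls_hom] pa.trm_closed one_K_closed)

lemma pcls_mult:
  assumes "(i, p, j) \<in> paths Q" "(j, q, k) \<in> paths Q"
  shows "pcls (i, p, j) \<otimes>\<^bsub>pq.RQ\<^esub> pcls (j, q, k) = pcls (i, p @ q, k)"
  using assms trm_mult[OF assms one_K_closed one_K_closed]
  by (simp add: ring_hom_mult[OF pq.cls_hom, symmetric] pa.trm_closed one_K_closed
      monoid.l_one[OF ring.is_monoid[OF ring_K]])

text \<open>The criterion for principal modules, applied to each arrow \<open>e\<^sub>m\<close>.\<close>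
lemma inverting_iff:
  assumes "ring B" "\<psi> \<in> ring_hom pq.RQ B"
  shows "inverting (loc_algebra K X Y) (loc_maps K X Y) B \<psi> \<longleftrightarrow>
    (\<forall>m. 1 \<le> m \<and> m < n \<longrightarrow> (\<exists>g\<in>carrier B.
      \<psi> (pcls (m + 1, [], m + 1)) \<otimes>\<^bsub>B\<^esub> g = g \<and> g \<otimes>\<^bsub>B\<^esub> \<psi> (pcls (m, [], m)) = g \<and>
      \<psi> (pcls (m, [E m], m + 1)) \<otimes>\<^bsub>B\<^esub> g = \<psi> (pcls (m, [], m)) \<and>
      g \<otimes>\<^bsub>B\<^esub> \<psi> (pcls (m, [E m], m + 1)) = \<psi> (pcls (m + 1, [], m + 1))))"
proof -
  have pb: "principal_base_change pq.RQ B \<psi> (pcls (m, [], m))" if "1 \<le> m" "m \<le> n" for m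
    using assms vertex_path[OF that, of X] pcls_mult[of m "[]" m "[]" m]
    by (intro principal_base_change.intro principal_base_change_axioms.intro pq.quot_ring pcls_closed)
       simp_all
  have iff: "base_change_map pq.RQ B \<psi> (vertex_module K X Y m) (\<lambda>a. pcls (m, [E m], m + 1) \<otimes>\<^bsub>pq.RQ\<^esub> a)
      \<in> rmodule_iso B (base_change pq.RQ B \<psi> (vertex_module K X Y (m + 1)))
          (base_change pq.RQ B \<psi> (vertex_module K X Y m)) \<longleftrightarrow>
     (\<exists>g\<in>carrier B.
      \<psi> (pcls (m + 1, [], m + 1)) \<otimes>\<^bsub>B\<^esub> g = g \<and> g \<otimes>\<^bsub>B\<^esub> \<psi> (pcls (m, [], m)) = g \<and>
      \<psi> (pcls (m, [E m], m + 1)) \<otimes>\<^bsub>B\<^esub> g = \<psi> (pcls (m, [], m)) \<and>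
      g \<otimes>\<^bsub>B\<^esub> \<psi> (pcls (m, [E m], m + 1)) = \<psi> (pcls (m + 1, [], m + 1)))"
    if m: "1 \<le> m" "m < n" for m
    unfolding vertex_module_def loc_algebra_eq path_class_eq
    by (rule base_change_principal_iso_iff)
       (use m pb[of m] pb[of "m + 1"] arrow_path(1)[OF m, of X] vertex_path[of m n X] vertex_path[of "m + 1" n X] in
        \<open>simp_all add: pcls_closed pcls_mult\<close>)
  have "inverting (loc_algebra K X Y) (loc_maps K X Y) B \<psi> \<longleftrightarrow> (\<forall>m. 1 \<le> m \<and> m < n \<longrightarrow>
      base_change_map pq.RQ B \<psi> (vertex_module K X Y m) (\<lambda>a. pcls (m, [E m], m + 1) \<otimes>\<^bsub>pq.RQ\<^esub> a)
      \<in> rmodule_iso B (base_change pq.RQ B \<psi> (vertex_module K X Y (m + 1)))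
          (base_change pq.RQ B \<psi> (vertex_module K X Y m)))"
    using assms unfolding inverting_def loc_maps_def path_map_def loc_algebra_eq path_class_eq
    by simp blast
  with iff show ?thesis by simp
qed

lemma loc_maps_fg_projective: "loc_maps K X Y \<subseteq> fg_projective_maps (loc_algebra K X Y)"
proof -
  interpret A: ring pq.RQ by (rule pq.quot_ring)
  have fg: "fg_projective pq.RQ (vertex_module K X Y m)" if "1 \<le> m" "m \<le> n" for m
    unfolding vertex_module_def loc_algebra_eq path_class_eq
    using pcls_mult[of m "[]" m "[]" m] vertex_path[OF that, of X]
    by (intro A.principal_rmodule_fg_projective pcls_closed) simp_all
  have hom: "(\<lambda>a. pcls (m, [E m], m + 1) \<otimes>\<^bsub>pq.RQ\<^esub> a) \<in>
      rmodule_hom pq.RQ (vertex_module K X Y (m + 1)) (vertex_module K X Y m)"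
    if m: "1 \<le> m" "m < n" for m
  proof -
    have v: "(m, [], m) \<in> paths Q" "(m, [E m], m + 1) \<in> paths Q" "(m + 1, [], m + 1) \<in> paths Q"
      using m by (auto intro!: vertex_path arrow_path(1))
    let ?e = "pcls (m, [E m], m + 1)" and ?f = "pcls (m + 1, [], m + 1)" and ?f' = "pcls (m, [], m)"
    have e: "?f' \<otimes>\<^bsub>pq.RQ\<^esub> ?e = ?e" using pcls_mult[OF v(1,2)] by simp
    note c = v[THEN pcls_closed]
    have "\<exists>b. ?e \<otimes>\<^bsub>pq.RQ\<^esub> (?f \<otimes>\<^bsub>pq.RQ\<^esub> a) = ?f' \<otimes>\<^bsub>pq.RQ\<^esub> b \<and> b \<in> carrier pq.RQ"
      if "a \<in> carrier pq.RQ" for a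
      using that c e by (intro exI[of _ "?e \<otimes>\<^bsub>pq.RQ\<^esub> (?f \<otimes>\<^bsub>pq.RQ\<^esub> a)"]) (simp add: A.m_assoc[symmetric])
    then show ?thesis
      using c unfolding vertex_module_def loc_algebra_eq path_class_eq rmodule_hom_def
      by (auto simp: principal_rmodule_carrier A.r_distr A.m_assoc)
  qed
  show ?thesis
    unfolding loc_maps_def path_map_def fg_projective_maps_def using fg hom
    by (auto simp: loc_algebra_eq path_class_eq)
qed

text \<open>The homomorphism from the path algebra to \<open>M\<^sub>n(S)\<close> on a scalar multiple of a path.\<close>
definition path_matrix where
  "path_matrix c p = (case p of (i, cs, j) \<Rightarrow> ma.emat (fq.cls (trm c (arrow_word cs))) (i, j))"

lemma word_cls_closed: "\<lbrakk>c \<in> carrier K; w \<in> lists X\<rbrakk> \<Longrightarrow> fq.cls (trm c w) \<in> carrier fq.RQ"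
  by (intro ring_hom_closed[OF fq.cls_hom] fa.trm_closed)

lemma word_cls_mult:
  assumes "c \<in> carrier K" "d \<in> carrier K" "u \<in> lists X" "v \<in> lists X"
  shows "fq.cls (trm c u) \<otimes>\<^bsub>fq.RQ\<^esub> fq.cls (trm d v) = fq.cls (trm (c \<otimes>\<^bsub>K\<^esub> d) (u @ v))"
  using assms by (simp add: ring_hom_mult[OF fq.cls_hom, symmetric] fa.trm_closed fa.trm_mult)

lemma word_cls_one: "fq.cls (trm \<one>\<^sub>K []) = \<one>\<^bsub>fq.RQ\<^esub>"
proof -
  have "trm \<one>\<^sub>K [] = \<one>\<^bsub>fa.alg\<^esub>" by (auto simp: fa.alg_one term_elt_def)
  then show ?thesis using ring_hom_one[OF fq.cls_hom] by simp
qed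

sublocale pm: basis_algebra_map K "paths Q" "{(v, [], v) | v. v \<in> verts Q}" path_comp ma.M path_matrix
proof (intro basis_algebra_map.intro basis_algebra_map_axioms.intro pa.basis_algebra_axioms
    ma.matrix_ring_ring)
  have bounds: "i \<in> {1..n}" "j \<in> {1..n}" "arrow_word cs \<in> lists X" if "(i, cs, j) \<in> paths Q" for i cs j
    using path_bounds[OF that] that arrow_word_lists by (auto simp: paths_loc_quiver)
  fix c p assume c: "c \<in> carrier K" and p: "p \<in> paths Q"
  obtain i cs j where p_eq: "p = (i, cs, j)" by (cases p)
  note b = bounds[OF p[unfolded p_eq]]
  show "path_matrix c p \<in> carrier ma.M"
    using b c by (auto simp: p_eq path_matrix_def intro!: ma.emat_closed word_cls_closed)
  fix d assume d: "d \<in> carrier K"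
  show "path_matrix (c \<oplus>\<^bsub>K\<^esub> d) p = path_matrix c p \<oplus>\<^bsub>ma.M\<^esub> path_matrix d p"
    using b c d
    by (simp add: p_eq path_matrix_def fa.trm_add ring_hom_add[OF fq.cls_hom] fa.trm_closed
        ma.emat_add word_cls_closed del: in_lists_conv_set)
  fix q assume q: "q \<in> paths Q"
  obtain i' cs' j' where q_eq: "q = (i', cs', j')" by (cases q)
  note b' = bounds[OF q[unfolded q_eq]]
  show "path_matrix c p \<otimes>\<^bsub>ma.M\<^esub> path_matrix d q =
      (case path_comp p q of None \<Rightarrow> \<zero>\<^bsub>ma.M\<^esub> | Some r \<Rightarrow> path_matrix (c \<otimes>\<^bsub>K\<^esub> d) r)"
    using b b' c d
    by (simp add: p_eq q_eq path_matrix_def ma.emat_mult word_cls_closed word_cls_mult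
        arrow_word_append del: in_lists_conv_set)
qed

abbreviation \<Phi> where "\<Phi> \<equiv> pm.lin"

lemma Phi_hom: "\<Phi> \<in> ring_hom pa.alg ma.M"
proof -
  have "\<Phi> \<one>\<^bsub>pa.alg\<^esub> = (\<Oplus>\<^bsub>ma.M\<^esub>p\<in>{(v, [], v) | v. v \<in> verts Q}. path_matrix \<one>\<^sub>K p)"
    by (rule pm.lin_one)
  also have "\<dots> = (\<Oplus>\<^bsub>ma.M\<^esub>p\<in>(\<lambda>v. (v, [], v)) ` {1..n}. path_matrix \<one>\<^sub>K p)"
    by (rule arg_cong[where f = "finsum ma.M (path_matrix \<one>\<^sub>K)"]) (auto simp: loc_quiver_simps)
  also have "\<dots> = (\<Oplus>\<^bsub>ma.M\<^esub>v\<in>{1..n}. path_matrix \<one>\<^sub>K (v, [], v))"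
    by (subst ma.M.finsum_reindex)
       (auto simp: inj_on_def intro!: pm.H_closed one_K_closed vertex_path)
  also have "\<dots> = \<one>\<^bsub>ma.M\<^esub>"
    by (simp add: path_matrix_def word_cls_one ma.matrix_one)
  finally show ?thesis
    by (auto simp: ring_hom_def pm.lin_closed pm.lin_add pm.lin_mult)
qed

lemma Phi_trm: "\<lbrakk>c \<in> carrier K; (i, cs, j) \<in> paths Q\<rbrakk> \<Longrightarrow>
    \<Phi> (trm c (i, cs, j)) = ma.emat (fq.cls (trm c (arrow_word cs))) (i, j)"
  by (simp add: pm.lin_trm path_matrix_def)

text \<open>Both paths of a relation in \<open>T\<close> have the word \<open>x\<close>, and \<open>y'\<close> is mapped to the matrix with the entry
  \<open>y\<close> in position \<open>(1, n)\<close>, which is zero in \<open>S\<close>.\<close>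
lemma Phi_kills:
  assumes "r \<in> loc_rels K X Y"
  shows "\<Phi> r = \<zero>\<^bsub>ma.M\<^esub>"
proof -
  interpret Ph: ring_hom_ring pa.alg ma.M \<Phi>
    using Phi_hom by (intro ring_hom_ringI2 pa.alg_ring ma.matrix_ring_ring)
  consider (T) m x where "1 < m" "m < n" "x \<in> X"
      "r = trm \<one>\<^sub>K (1, G 1 x # map E [2..<n], n) \<ominus>\<^bsub>pa.alg\<^esub>
           trm \<one>\<^sub>K (1, map E [1..<m] @ G m x # map E [m + 1..<n], n)"
    | (Y) y where "y \<in> Y" "r = Y_rel K n X y"
    using assms by (auto simp: loc_rels_def Let_def T_rels_def path_algebra_def)
  then show ?thesis
  proof cases
    case T
    have p: "(1, G 1 x # map E [2..<n], n) \<in> paths Q"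
      "(1, map E [1..<m] @ G m x # map E [m + 1..<n], n) \<in> paths Q"
      using T T_paths[of m n x X] T_paths[of 1 n x X] by simp_all
    have "\<Phi> (trm \<one>\<^sub>K (1, G 1 x # map E [2..<n], n)) =
        \<Phi> (trm \<one>\<^sub>K (1, map E [1..<m] @ G m x # map E [m + 1..<n], n))"
      using p by (simp add: Phi_trm one_K_closed arrow_word_append arrow_word_E)
    with p show ?thesis
      unfolding T pa.alg.minus_eq
      by (simp add: pa.trm_closed one_K_closed ma.M.r_neg)
  next
    case Y
    let ?h = "\<lambda>t. ma.emat (fq.cls t) (1, n)"
    have n: "(1, n) \<in> {1..n} \<times> {1..n}" using n_pos by simp
    have y: "y \<in> carrier fa.alg" using Y fq.Y_subset by blast
    have w: "trm (y w) w \<in> carrier fa.alg" if "y w \<noteq> \<zero>\<^bsub>K\<^esub>" for w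
      using word_bound[OF Y(1) that] fa.alg_coeff_closed[OF y] by (intro fa.trm_closed)
    have "\<Phi> r = (\<Oplus>\<^bsub>ma.M\<^esub>w\<in>{w. y w \<noteq> \<zero>\<^bsub>K\<^esub>}. \<Phi> (trm (y w) (word_path n w)))"
      unfolding Y Y_rel_def path_algebra_def
      by (rule additive_finsum[where h = \<Phi>])
         (use Y in \<open>auto simp: pa.alg_abelian_group ma.M.abelian_group_axioms pm.lin_closed pm.lin_add
            word_term_closed\<close>)
    also have "\<dots> = (\<Oplus>\<^bsub>ma.M\<^esub>w\<in>{w. y w \<noteq> \<zero>\<^bsub>K\<^esub>}. ?h (trm (y w) w))"
    proof (rule ma.M.finsum_cong')
      fix w assume "w \<in> {w. y w \<noteq> \<zero>\<^bsub>K\<^esub>}"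
      then have "y w \<noteq> \<zero>\<^bsub>K\<^esub>" by simp
      note wb = word_bound[OF Y(1) this]
      obtain cs where cs: "word_path n w = (1, cs, n)" unfolding word_path_def by blast
      have p: "(1, cs, n) \<in> paths Q" using word_path_path[OF wb] unfolding cs .
      show "\<Phi> (trm (y w) (word_path n w)) = ?h (trm (y w) w)"
        unfolding cs Phi_trm[OF fa.alg_coeff_closed[OF y] p] arrow_word_word_path[OF cs] ..
    next
      show "(\<lambda>w. ?h (trm (y w) w)) \<in> {w. y w \<noteq> \<zero>\<^bsub>K\<^esub>} \<rightarrow> carrier ma.M"
        using w by (intro Pi_I ma.emat_closed n ring_hom_closed[OF fq.cls_hom]) simp
    qed simp
    also have "\<dots> = ?h (\<Oplus>\<^bsub>fa.alg\<^esub>w\<in>{w. y w \<noteq> \<zero>\<^bsub>K\<^esub>}. trm (y w) w)"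
      by (rule additive_finsum[where h = ?h, symmetric])
         (use n w in \<open>auto simp: fa.alg_abelian_group ma.M.abelian_group_axioms ma.emat_closed ma.emat_add
            ring_hom_add[OF fq.cls_hom] ring_hom_closed[OF fq.cls_hom]\<close>)
    also have "\<dots> = ?h y" using fa.alg_eq_sum_of_terms[OF y] by simp
    also have "fq.cls y = \<zero>\<^bsub>fq.RQ\<^esub>"
      using Y fq.genideal_self[OF fq.Y_subset] by (intro fq.cls_eq_zero) blast
    finally show ?thesis by (simp add: ma.emat_zero)
  qed
qed

definition \<phi> where "\<phi> = factor_map \<Phi>"

lemma phi_hom: "\<phi> \<in> ring_hom pq.RQ ma.M"
  unfolding \<phi>_def by (rule pq.factor_map_hom(1)[OF ma.matrix_ring_ring Phi_hom Phi_kills])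

lemma phi_cls: "x \<in> carrier pa.alg \<Longrightarrow> \<phi> (pq.cls x) = \<Phi> x"
  unfolding \<phi>_def by (rule pq.factor_map_hom(2)[OF ma.matrix_ring_ring Phi_hom Phi_kills])

lemma phi_trm: "\<lbrakk>c \<in> carrier K; (i, cs, j) \<in> paths Q\<rbrakk> \<Longrightarrow>
    \<phi> (pq.cls (trm c (i, cs, j))) = ma.emat (fq.cls (trm c (arrow_word cs))) (i, j)"
  by (simp add: phi_cls pa.trm_closed Phi_trm)

lemma phi_inverting: "inverting (loc_algebra K X Y) (loc_maps K X Y) ma.M \<phi>"
proof -
  let ?S1 = "\<one>\<^bsub>fq.RQ\<^esub>"
  have one: "?S1 \<in> carrier fq.RQ" "?S1 \<otimes>\<^bsub>fq.RQ\<^esub> ?S1 = ?S1"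
    using ma.one_closed ma.l_one by auto
  have "\<exists>g\<in>carrier ma.M.
      \<phi> (pcls (m + 1, [], m + 1)) \<otimes>\<^bsub>ma.M\<^esub> g = g \<and> g \<otimes>\<^bsub>ma.M\<^esub> \<phi> (pcls (m, [], m)) = g \<and>
      \<phi> (pcls (m, [E m], m + 1)) \<otimes>\<^bsub>ma.M\<^esub> g = \<phi> (pcls (m, [], m)) \<and>
      g \<otimes>\<^bsub>ma.M\<^esub> \<phi> (pcls (m, [E m], m + 1)) = \<phi> (pcls (m + 1, [], m + 1))"
    if m: "1 \<le> m" "m < n" for m
    using m one arrow_path(1)[OF m, of X] vertex_path[of m n X] vertex_path[of "m + 1" n X]
    by (intro bexI[of _ "ma.emat ?S1 (m + 1, m)"])
       (simp_all add: phi_trm one_K_closed word_cls_one ma.emat_mult ma.emat_closed)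
  then show ?thesis
    using inverting_iff[OF ma.matrix_ring_ring phi_hom] by blast
qed

end

section \<open>Inverting the arrows produces matrix units\<close>

text \<open>A \<open>\<sigma>\<close>-inverting ring \<open>B\<close>, with a chosen inverse \<open>g m\<close> of the image of every arrow \<open>e\<^sub>m\<close>.\<close>
locale inverted_presentation = presentation K X Y + B: ring B
  for K :: "('k, 'm) ring_scheme" and X :: "'x set" and Y :: "('x list \<Rightarrow> 'k) set"
    and B :: "('b, 'o) ring_scheme" (structure) +
  fixes \<psi> g
  assumes psi: "\<psi> \<in> ring_hom pq.RQ B"
    and g: "\<And>m. \<lbrakk>1 \<le> m; m < n\<rbrakk> \<Longrightarrow> g m \<in> carrier B \<and>
      \<psi> (pcls (m + 1, [], m + 1)) \<otimes> g m = g m \<and> g m \<otimes> \<psi> (pcls (m, [], m)) = g m \<and>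
      \<psi> (pcls (m, [E m], m + 1)) \<otimes> g m = \<psi> (pcls (m, [], m)) \<and>
      g m \<otimes> \<psi> (pcls (m, [E m], m + 1)) = \<psi> (pcls (m + 1, [], m + 1))"
begin

sublocale K: ring K by (rule ring_K)

definition \<Psi> where "\<Psi> x = \<psi> (pq.cls x)"

lemma Psi_hom: "\<Psi> \<in> ring_hom pa.alg B"
proof -
  have "\<Psi> = \<psi> \<circ> pq.cls" by (auto simp: \<Psi>_def)
  then show ?thesis using ring_hom_trans[OF pq.cls_hom psi] by simp
qed

abbreviation img where "img c p \<equiv> \<Psi> (trm c p)"
abbreviation v where "v i \<equiv> img \<one>\<^sub>K (i, [], i)"

lemma img_closed: "\<lbrakk>c \<in> carrier K; p \<in> paths Q\<rbrakk> \<Longrightarrow> img c p \<in> carrier B"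
  by (intro ring_hom_closed[OF Psi_hom] pa.trm_closed)

lemma img_mult:
  assumes "c \<in> carrier K" "d \<in> carrier K" "(i, p, j) \<in> paths Q" "(j, q, k) \<in> paths Q"
  shows "img c (i, p, j) \<otimes> img d (j, q, k) = img (c \<otimes>\<^bsub>K\<^esub> d) (i, p @ q, k)"
  using assms by (simp add: ring_hom_mult[OF Psi_hom, symmetric] pa.trm_closed trm_mult)

lemma v_mult_zero:
  assumes "i \<in> {1..n}" "j \<in> {1..n}" "i \<noteq> j"
  shows "v i \<otimes> v j = \<zero>"
proof -
  have p: "(i, [], i) \<in> paths Q" "(j, [], j) \<in> paths Q" using assms by (auto intro!: vertex_path)
  have "v i \<otimes> v j = \<Psi> (trm \<one>\<^sub>K (i, [], i) \<otimes>\<^bsub>pa.alg\<^esub> trm \<one>\<^sub>K (j, [], j))"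
    using p by (simp add: ring_hom_mult[OF Psi_hom] pa.trm_closed)
  also have "\<dots> = \<Psi> \<zero>\<^bsub>pa.alg\<^esub>" using p assms by (simp add: pa.trm_mult)
  also have "\<dots> = \<zero>" by (rule ring_hom_zero[OF Psi_hom pa.alg_ring B.ring_axioms])
  finally show ?thesis .
qed

lemma v_closed: "\<lbrakk>1 \<le> m; m \<le> n\<rbrakk> \<Longrightarrow> v m \<in> carrier B"
  by (intro img_closed one_K_closed vertex_path)

lemma g_props:
  assumes "1 \<le> m" "m < n"
  shows "g m \<in> carrier B" "v (m + 1) \<otimes> g m = g m" "g m \<otimes> v m = g m"
    "img \<one>\<^sub>K (m, [E m], m + 1) \<otimes> g m = v m" "g m \<otimes> img \<one>\<^sub>K (m, [E m], m + 1) = v (m + 1)"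
  using g[OF assms] by (simp_all add: \<Psi>_def)

text \<open>\<open>U m\<close> leads from vertex \<open>1\<close> to vertex \<open>m\<close>, and \<open>V m\<close>, the product \<open>g (m - 1) \<dots> g 1\<close>, leads back.\<close>
definition U where "U m = img \<one>\<^sub>K (e_path 1 m)"

primrec V_Suc where
  "V_Suc 0 = v 1"
| "V_Suc (Suc m) = g (Suc m) \<otimes> V_Suc m"

definition V where "V m = V_Suc (m - 1)"

lemma V_1: "V 1 = v 1"
  by (simp add: V_def)

lemma V_step: "1 \<le> m \<Longrightarrow> V (m + 1) = g m \<otimes> V m"
  by (cases m) (simp_all add: V_def Suc_eq_plus1[symmetric] del: Suc_eq_plus1)

lemma U_closed: "\<lbrakk>1 \<le> m; m \<le> n\<rbrakk> \<Longrightarrow> U m \<in> carrier B"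
  unfolding U_def by (intro img_closed one_K_closed e_path_path) simp_all

lemma img_absorb:
  assumes "c \<in> carrier K" "(i, p, j) \<in> paths Q"
  shows "v i \<otimes> img c (i, p, j) = img c (i, p, j)" "img c (i, p, j) \<otimes> v j = img c (i, p, j)"
  using path_bounds[OF assms(2)] assms
  by (simp_all add: img_mult vertex_path)

lemma U_absorb:
  assumes "1 \<le> m" "m \<le> n"
  shows "v 1 \<otimes> U m = U m" "U m \<otimes> v m = U m"
  using e_path_path[OF _ assms, of X] img_absorb[of "\<one>\<^sub>K"] by (auto simp: U_def e_path_def)

lemma U_1: "U 1 = v 1"
  by (simp add: U_def e_path_def)

lemma U_e_path:
  assumes "1 \<le> m" "m \<le> j" "j \<le> n"
  shows "U m \<otimes> img \<one>\<^sub>K (e_path m j) = U j"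
proof -
  have "[1..<j] = [1..<m] @ [m..<j]"
    using assms upt_add_eq_append[of 1 m "j - m"] by simp
  then show ?thesis
    using assms e_path_path[of 1 m n X] e_path_path[of m j n X]
    by (simp add: U_def e_path_def img_mult)
qed

lemma UV_step:
  assumes "1 \<le> m" "m \<le> n"
  shows "V m \<in> carrier B \<and> v m \<otimes> V m = V m \<and> V m \<otimes> v 1 = V m \<and> U m \<otimes> V m = v 1 \<and> V m \<otimes> U m = v m"
  using assms
proof (induction m rule: nat_induct_at_least)
  case base
  then show ?case
    using img_absorb[of "\<one>\<^sub>K" 1 "[]" 1] vertex_path[of 1 n X]
    by (simp add: V_1 U_1 v_closed)
next
  case (Suc m)
  let ?e = "img \<one>\<^sub>K (m, [E m], m + 1)"
  have m: "1 \<le> m" "m < n" "m \<le> n" using Suc by simp_all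
  note gp = g_props[OF m(1,2)]
  note IH = Suc.IH[OF m(3)]
  have Vm: "V m \<in> carrier B" using IH by simp
  have e: "?e \<in> carrier B" using m by (intro img_closed one_K_closed arrow_path)
  have v: "v m \<in> carrier B" "v 1 \<in> carrier B" "v (m + 1) \<in> carrier B" using m by (auto intro!: v_closed)
  have u: "U m \<in> carrier B" "U (m + 1) = U m \<otimes> ?e"
    using m U_e_path[of m "m + 1"] U_closed by (simp_all add: e_path_arrow)
  have V: "V (m + 1) = g m \<otimes> V m" using V_step m by simp
  have "V (m + 1) \<in> carrier B" using V gp IH by simp
  moreover have "v (m + 1) \<otimes> V (m + 1) = V (m + 1)"
    using V gp(1,2) IH v by (simp add: B.m_assoc[symmetric])
  moreover have "V (m + 1) \<otimes> v 1 = V (m + 1)"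
    using V gp(1) IH v by (simp add: B.m_assoc)
  moreover have "U (m + 1) \<otimes> V (m + 1) = v 1"
  proof -
    have "U (m + 1) \<otimes> V (m + 1) = U m \<otimes> ((?e \<otimes> g m) \<otimes> V m)"
      using V u gp(1) Vm e by (simp add: B.m_assoc)
    also have "\<dots> = v 1" using gp IH by simp
    finally show ?thesis .
  qed
  moreover have "V (m + 1) \<otimes> U (m + 1) = v (m + 1)"
  proof -
    have "V (m + 1) \<otimes> U (m + 1) = g m \<otimes> ((V m \<otimes> U m) \<otimes> ?e)"
      using V u gp(1) Vm e by (simp add: B.m_assoc)
    also have "\<dots> = (g m \<otimes> v m) \<otimes> ?e" using IH gp(1) v e by (simp add: B.m_assoc)
    also have "\<dots> = v (m + 1)" using gp by simp
    finally show ?thesis .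
  qed
  ultimately show ?case by (simp add: Suc_eq_plus1)
qed

lemma V_closed: "\<lbrakk>1 \<le> m; m \<le> n\<rbrakk> \<Longrightarrow> V m \<in> carrier B"
  and V_absorb: "\<lbrakk>1 \<le> m; m \<le> n\<rbrakk> \<Longrightarrow> v m \<otimes> V m = V m" "\<lbrakk>1 \<le> m; m \<le> n\<rbrakk> \<Longrightarrow> V m \<otimes> v 1 = V m"
  and UV: "\<lbrakk>1 \<le> m; m \<le> n\<rbrakk> \<Longrightarrow> U m \<otimes> V m = v 1" "\<lbrakk>1 \<le> m; m \<le> n\<rbrakk> \<Longrightarrow> V m \<otimes> U m = v m"
  using UV_step by auto

text \<open>The products \<open>V m U j\<close> are matrix units; for \<open>m \<le> j\<close> they come from \<open>A\<close>.\<close>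
lemma img_e_path:
  assumes "1 \<le> m" "m \<le> j" "j \<le> n"
  shows "img \<one>\<^sub>K (e_path m j) = V m \<otimes> U j"
proof -
  let ?p = "img \<one>\<^sub>K (e_path m j)"
  have c: "?p \<in> carrier B" "V m \<in> carrier B" "U m \<in> carrier B"
    using assms by (auto intro!: img_closed one_K_closed e_path_path V_closed U_closed)
  have "V m \<otimes> U j = (V m \<otimes> U m) \<otimes> ?p"
    using c U_e_path[OF assms] by (simp add: B.m_assoc)
  also have "\<dots> = v m \<otimes> ?p" using UV assms by simp
  also have "\<dots> = ?p"
    using img_absorb(1)[OF one_K_closed] e_path_path[OF assms, of X] by (simp add: e_path_def)
  finally show ?thesis ..
qed

text \<open>The scalar \<open>c\<close> in the corner at vertex \<open>1\<close>. The image of the field need not be central in \<open>B\<close>, but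
  scalars can be moved past the images of paths, since they are central in \<open>A\<close>, and hence past the inverses of
  such images.\<close>
definition scalar where "scalar c = img c (1, [], 1)"

lemma scalar_closed: "c \<in> carrier K \<Longrightarrow> scalar c \<in> carrier B"
  unfolding scalar_def using n_pos by (intro img_closed vertex_path) simp_all

lemma scalar_mult:
  "\<lbrakk>c \<in> carrier K; d \<in> carrier K\<rbrakk> \<Longrightarrow> scalar c \<otimes> scalar d = scalar (c \<otimes>\<^bsub>K\<^esub> d)"
  unfolding scalar_def using n_pos by (simp add: img_mult vertex_path)

lemma scalar_absorb: "c \<in> carrier K \<Longrightarrow> v 1 \<otimes> scalar c = scalar c" "c \<in> carrier K \<Longrightarrow> scalar c \<otimes> v 1 = scalar c"
  unfolding scalar_def using n_pos img_absorb[of c 1 "[]" 1] vertex_path[of 1 n X] by simp_all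

lemma img_scalar:
  assumes "c \<in> carrier K" "(i, p, j) \<in> paths Q"
  shows "img c (i, [], i) \<otimes> img \<one>\<^sub>K (i, p, j) = img c (i, p, j)"
    "img \<one>\<^sub>K (i, p, j) \<otimes> img c (j, [], j) = img c (i, p, j)"
  using path_bounds[OF assms(2)] assms by (simp_all add: img_mult vertex_path)

lemma scalar_V:
  assumes "1 \<le> m" "m \<le> n" "c \<in> carrier K"
  shows "img c (m, [], m) \<otimes> V m = V m \<otimes> scalar c"
proof -
  let ?c = "img c (m, [], m)"
  have cl: "?c \<in> carrier B" "V m \<in> carrier B" "U m \<in> carrier B" "scalar c \<in> carrier B" "v m \<in> carrier B"
    using assms by (auto intro!: img_closed vertex_path V_closed U_closed scalar_closed v_closed)
  \<comment> \<open>Scalars commute with the path \<open>e\<^sub>1 \<dots> e\<^sub>m\<^sub>-\<^sub>1\<close> in \<open>A\<close>, hence also with its inverse \<open>V m\<close>.\<close>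
  have comm: "scalar c \<otimes> U m = U m \<otimes> ?c"
    using img_scalar[OF assms(3)] e_path_path[OF _ assms(1,2), of X]
    by (simp add: scalar_def U_def e_path_def)
  have "V m \<otimes> scalar c = V m \<otimes> (scalar c \<otimes> (U m \<otimes> V m))"
    using assms UV by (simp add: scalar_absorb)
  also have "\<dots> = V m \<otimes> (U m \<otimes> ?c \<otimes> V m)"
    using cl comm by (simp add: B.m_assoc[symmetric])
  also have "\<dots> = (V m \<otimes> U m) \<otimes> ?c \<otimes> V m"
    using cl by (simp add: B.m_assoc)
  also have "\<dots> = ?c \<otimes> V m"
    using assms UV img_absorb(1)[OF assms(3) vertex_path[OF assms(1,2)]] by simp
  finally show ?thesis ..
qed

text \<open>The image of the generator \<open>x\<close> in the corner at vertex \<open>1\<close>. For \<open>n = 1\<close> the quiver has no arrows, but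
  then \<open>S = 0\<close> (see \<open>trivial_if_one_vertex\<close>), so the only possible value is zero.\<close>
definition loop where
  "loop x = (if 1 < n then img \<one>\<^sub>K (1, [G 1 x], 2) \<otimes> V 2 else \<zero>)"

lemma loop_props:
  assumes x: "x \<in> X"
  shows "loop x \<in> carrier B" "v 1 \<otimes> loop x = loop x" "loop x \<otimes> v 1 = loop x"
    "\<And>c. c \<in> carrier K \<Longrightarrow> scalar c \<otimes> loop x = loop x \<otimes> scalar c"
proof -
  have v1: "v 1 \<in> carrier B" using n_pos by (intro v_closed) simp_all
  have "loop x \<in> carrier B \<and> v 1 \<otimes> loop x = loop x \<and> loop x \<otimes> v 1 = loop x \<and>
    (\<forall>c. c \<in> carrier K \<longrightarrow> scalar c \<otimes> loop x = loop x \<otimes> scalar c)"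
  proof (cases "1 < n")
    case True
    let ?a = "img \<one>\<^sub>K (1, [G 1 x], 2)"
    have p: "(1, [G 1 x], 2) \<in> paths Q" using arrow_path(2)[of 1 n x X] True x by simp
    have a: "?a \<in> carrier B" by (intro img_closed one_K_closed p)
    have V: "V 2 \<in> carrier B" using True by (intro V_closed) simp_all
    have s: "loop x = ?a \<otimes> V 2" using True by (simp add: loop_def)
    have "scalar c \<otimes> loop x = loop x \<otimes> scalar c" if c: "c \<in> carrier K" for c
    proof -
      have c2: "img c (2, [], 2) \<in> carrier B" using True c by (intro img_closed vertex_path) simp_all
      have "scalar c \<otimes> loop x = (scalar c \<otimes> ?a) \<otimes> V 2"
        using a V scalar_closed[OF c] by (simp add: s B.m_assoc)
      also have "\<dots> = ?a \<otimes> (img c (2, [], 2) \<otimes> V 2)"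
        using img_scalar[OF c p] a V c2 by (simp add: scalar_def B.m_assoc[symmetric])
      also have "\<dots> = loop x \<otimes> scalar c"
        using True c a V scalar_closed[OF c] by (simp add: scalar_V s B.m_assoc)
      finally show ?thesis .
    qed
    moreover have "v 1 \<otimes> loop x = loop x"
      using img_absorb(1)[OF one_K_closed p] a V v1 by (simp add: s B.m_assoc[symmetric])
    moreover have "loop x \<otimes> v 1 = loop x"
      using V_absorb(2)[of 2] True a V v1 by (simp add: s B.m_assoc)
    ultimately show ?thesis using a V by (simp add: s)
  next
    case False
    then show ?thesis using v1 scalar_closed by (simp add: loop_def)
  qed
  then show "loop x \<in> carrier B" "v 1 \<otimes> loop x = loop x" "loop x \<otimes> v 1 = loop x"
    "\<And>c. c \<in> carrier K \<Longrightarrow> scalar c \<otimes> loop x = loop x \<otimes> scalar c" by auto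
qed

lemma Psi_rels: "r \<in> loc_rels K X Y \<Longrightarrow> \<Psi> r = \<zero>"
proof -
  assume "r \<in> loc_rels K X Y"
  then have "pq.cls r = \<zero>\<^bsub>pq.RQ\<^esub>"
    using pq.genideal_self[OF loc_rels_closed] by (intro pq.cls_eq_zero) blast
  then show ?thesis
    using ring_hom_zero[OF psi pq.quot_ring B.ring_axioms] by (simp add: \<Psi>_def)
qed

text \<open>For \<open>m = 1\<close> this is how the loop is defined. For \<open>m > 1\<close> the relations in \<open>T\<close> state it after multiplication by \<open>U m\<close> on the left and \<open>V (m + 1) U n\<close> on the right,
  and these factors can be cancelled.\<close>
lemma img_G:
  assumes m: "1 \<le> m" "m < n" and x: "x \<in> X"
  shows "img \<one>\<^sub>K (m, [G m x], m + 1) = V m \<otimes> loop x \<otimes> U (m + 1)"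
proof -
  have n: "1 < n" using m by simp
  let ?a = "img \<one>\<^sub>K (m, [G m x], m + 1)" and ?a1 = "img \<one>\<^sub>K (1, [G 1 x], 2)"
  have p: "(m, [G m x], m + 1) \<in> paths Q" "(1, [G 1 x], 2) \<in> paths Q"
    using arrow_path(2)[of 1 n x X] arrow_path(2)[OF m x] n x by simp_all
  have cl: "?a \<in> carrier B" "?a1 \<in> carrier B" "V m \<in> carrier B" "U m \<in> carrier B" "V (m + 1) \<in> carrier B"
    "U (m + 1) \<in> carrier B" "V n \<in> carrier B" "U n \<in> carrier B" "V 2 \<in> carrier B" "v 1 \<in> carrier B"
    "v (m + 1) \<in> carrier B" "v m \<in> carrier B"
    using m n p by (auto intro!: img_closed one_K_closed V_closed U_closed v_closed)
  have "loop x = U m \<otimes> ?a \<otimes> V (m + 1)"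
  proof (cases "m = 1")
    case True
    then show ?thesis
      using n img_absorb(1)[OF one_K_closed p(2)] by (simp add: loop_def U_1)
  next
    case False
    with m have m1: "1 < m" by simp
    let ?l = "(1, G 1 x # map E [2..<n], n)"
    let ?r = "(1, map E [1..<m] @ G m x # map E [m + 1..<n], n)"
    have lr: "?l \<in> paths Q" "?r \<in> paths Q"
      using m m1 x T_paths[of 1 n x X] T_paths[of m n x X] by simp_all
    have e: "(2, map E [2..<n], n) \<in> paths Q" "(1, map E [1..<m], m) \<in> paths Q"
      "(m + 1, map E [m + 1..<n], n) \<in> paths Q" "(1, map E [1..<m] @ [G m x], m + 1) \<in> paths Q"
      using m m1 e_path_path[of 2 n n X] e_path_path[of 1 m n X] e_path_path[of "m + 1" n n X]
        T_paths[of m "m + 1" x X] pa.pcomp_closed[OF _ p(1), of "(1, map E [1..<m], m)"]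
      by (simp_all add: e_path_def)
    have "trm \<one>\<^sub>K ?l \<ominus>\<^bsub>pa.alg\<^esub> trm \<one>\<^sub>K ?r \<in> loc_rels K X Y"
      using m m1 x by (auto simp: loc_rels_def Let_def T_rels_def path_algebra_def)
    from Psi_rels[OF this] have "img \<one>\<^sub>K ?l \<ominus> img \<one>\<^sub>K ?r = \<zero>"
    proof -
      interpret Ps: ring_hom_ring pa.alg B \<Psi>
        using Psi_hom by (intro ring_hom_ringI2 pa.alg_ring B.ring_axioms)
      assume "\<Psi> (trm \<one>\<^sub>K ?l \<ominus>\<^bsub>pa.alg\<^esub> trm \<one>\<^sub>K ?r) = \<zero>"
      then show ?thesis
        using lr by (simp add: pa.alg.minus_eq B.minus_eq pa.trm_closed one_K_closed)
    qed
    then have "img \<one>\<^sub>K ?l = img \<one>\<^sub>K ?r"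
      using lr B.minus_equality[of "img \<one>\<^sub>K ?l" "\<ominus> img \<one>\<^sub>K ?r"]
      by (simp add: B.minus_eq img_closed one_K_closed)
    also have "img \<one>\<^sub>K ?l = ?a1 \<otimes> (V 2 \<otimes> U n)"
      using img_mult[OF one_K_closed one_K_closed p(2) e(1)] img_e_path[of 2 n] n
      by (simp add: e_path_def)
    also have "img \<one>\<^sub>K ?r = U m \<otimes> ?a \<otimes> (V (m + 1) \<otimes> U n)"
      using img_mult[OF one_K_closed one_K_closed e(2) p(1)]
        img_mult[OF one_K_closed one_K_closed e(4,3)] img_e_path[of "m + 1" n] m
      by (simp add: e_path_def U_def)
    finally have "?a1 \<otimes> (V 2 \<otimes> U n) \<otimes> V n = U m \<otimes> ?a \<otimes> (V (m + 1) \<otimes> U n) \<otimes> V n" by simp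
    then have "?a1 \<otimes> (V 2 \<otimes> (U n \<otimes> V n)) = U m \<otimes> ?a \<otimes> (V (m + 1) \<otimes> (U n \<otimes> V n))"
      using cl by (simp add: B.m_assoc)
    then show ?thesis
      using m n n_pos by (simp add: UV V_absorb loop_def)
  qed
  then have "V m \<otimes> loop x \<otimes> U (m + 1) = (V m \<otimes> U m) \<otimes> ?a \<otimes> (V (m + 1) \<otimes> U (m + 1))"
    using cl by (simp add: B.m_assoc)
  also have "\<dots> = ?a"
    using m img_absorb[OF one_K_closed p(1)] by (simp add: UV)
  finally show ?thesis ..
qed

primrec word_prod where
  "word_prod [] = v 1"
| "word_prod (x # w) = loop x \<otimes> word_prod w"

lemma word_prod_props:
  assumes "w \<in> lists X"
  shows "word_prod w \<in> carrier B" "v 1 \<otimes> word_prod w = word_prod w" "word_prod w \<otimes> v 1 = word_prod w"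
    "\<And>c. c \<in> carrier K \<Longrightarrow> scalar c \<otimes> word_prod w = word_prod w \<otimes> scalar c"
proof -
  have v1: "v 1 \<in> carrier B" "v 1 \<otimes> v 1 = v 1"
    using n_pos img_absorb(1)[OF one_K_closed vertex_path[of 1 n X]] by (auto intro!: v_closed)
  have "word_prod w \<in> carrier B \<and> v 1 \<otimes> word_prod w = word_prod w \<and> word_prod w \<otimes> v 1 = word_prod w \<and>
     (\<forall>c. c \<in> carrier K \<longrightarrow> scalar c \<otimes> word_prod w = word_prod w \<otimes> scalar c)"
    using assms
  proof (induction w)
    case Nil
    then show ?case using v1 by (simp add: scalar_absorb)
  next
    case (Cons x w)
    then have x: "x \<in> X" and IH: "word_prod w \<in> carrier B" "v 1 \<otimes> word_prod w = word_prod w" "word_prod w \<otimes> v 1 = word_prod w"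
      "\<And>c. c \<in> carrier K \<Longrightarrow> scalar c \<otimes> word_prod w = word_prod w \<otimes> scalar c" by auto
    have "scalar c \<otimes> (loop x \<otimes> word_prod w) = loop x \<otimes> word_prod w \<otimes> scalar c" if c: "c \<in> carrier K" for c
    proof -
      have "scalar c \<otimes> (loop x \<otimes> word_prod w) = loop x \<otimes> (scalar c \<otimes> word_prod w)"
        using loop_props[OF x] c IH(1) scalar_closed[OF c] by (simp add: B.m_assoc[symmetric])
      then show ?thesis
        using loop_props[OF x] c IH scalar_closed[OF c] by (simp add: B.m_assoc)
    qed
    moreover have "v 1 \<otimes> (loop x \<otimes> word_prod w) = loop x \<otimes> word_prod w"
      using loop_props[OF x] IH v1 by (simp add: B.m_assoc[symmetric])
    ultimately show ?case
      using loop_props[OF x] IH v1 by (simp add: B.m_assoc)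
  qed
  then show "word_prod w \<in> carrier B" "v 1 \<otimes> word_prod w = word_prod w" "word_prod w \<otimes> v 1 = word_prod w"
    "\<And>c. c \<in> carrier K \<Longrightarrow> scalar c \<otimes> word_prod w = word_prod w \<otimes> scalar c" by auto
qed

lemma word_prod_append:
  assumes "u \<in> lists X" "w \<in> lists X"
  shows "word_prod (u @ w) = word_prod u \<otimes> word_prod w"
  using assms
  by (induction u) (simp_all add: word_prod_props loop_props B.m_assoc)

lemma path_word_lists: "(i, cs, j) \<in> paths Q \<Longrightarrow> arrow_word cs \<in> lists X"
  by (rule arrow_word_lists[of cs n]) (simp add: paths_loc_quiver)

definition word_img where "word_img c w = scalar c \<otimes> word_prod w"

text \<open>Between consecutive arrows of the path, \<open>U (i + 1) V (i + 1)\<close> cancels to the idempotent at vertex \<open>1\<close>,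
  which leaves the product of the loops.\<close>
lemma img_path:
  assumes "(i, cs, j) \<in> paths Q"
  shows "img \<one>\<^sub>K (i, cs, j) = V i \<otimes> word_prod (arrow_word cs) \<otimes> U j"
  using assms
proof (induction cs arbitrary: i)
  case Nil
  then have "i = j" by (simp add: paths_loc_quiver level_cas_simps)
  then show ?case using path_bounds[OF Nil] by (simp add: V_absorb UV)
next
  case (Cons c cs)
  have lev: "level c = i" and c: "c \<in> arcs Q" and rest: "(i + 1, cs, j) \<in> paths Q"
    using Cons.prems by (auto simp: paths_loc_quiver level_cas_simps loc_quiver_simps)
  have i: "1 \<le> i" "i < n" using c lev by (auto simp: loc_quiver_simps)
  have j: "1 \<le> j" "j \<le> n" using path_bounds[OF rest] by simp_all
  have w: "arrow_word cs \<in> lists X"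
    by (rule path_word_lists[OF rest])
  note sww = word_prod_props[OF w]
  have cl: "V i \<in> carrier B" "U (i + 1) \<in> carrier B" "V (i + 1) \<in> carrier B" "U j \<in> carrier B"
    using i j by (auto intro!: V_closed U_closed)
  \<comment> \<open>The cancellation at the first interior vertex of the path.\<close>
  have UV1: "U (i + 1) \<otimes> (V (i + 1) \<otimes> word_prod (arrow_word cs) \<otimes> U j) = word_prod (arrow_word cs) \<otimes> U j"
  proof -
    have "U (i + 1) \<otimes> (V (i + 1) \<otimes> word_prod (arrow_word cs) \<otimes> U j) =
        (U (i + 1) \<otimes> V (i + 1)) \<otimes> word_prod (arrow_word cs) \<otimes> U j"
      using cl sww(1) by (simp add: B.m_assoc)
    then show ?thesis using i sww by (simp add: UV)
  qed
  have p: "(i, [c], i + 1) \<in> paths Q"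
    using c lev i by (auto simp: paths_loc_quiver level_cas_simps)
  have split: "img \<one>\<^sub>K (i, c # cs, j) = img \<one>\<^sub>K (i, [c], i + 1) \<otimes> (V (i + 1) \<otimes> word_prod (arrow_word cs) \<otimes> U j)"
    using img_mult[OF one_K_closed one_K_closed p rest] Cons.IH[OF rest] by simp
  show ?case
  proof (cases c)
    case (E m)
    then have "img \<one>\<^sub>K (i, [c], i + 1) = V i \<otimes> U (i + 1)"
      using lev img_e_path[of i "i + 1"] i by (simp add: e_path_arrow)
    then show ?thesis
      using cl sww(1) UV1 unfolding split by (simp add: E B.m_assoc)
  next
    case (G m x)
    then have x: "x \<in> X" "img \<one>\<^sub>K (i, [c], i + 1) = V i \<otimes> loop x \<otimes> U (i + 1)"
      using lev c img_G[OF i] by (auto simp: loc_quiver_simps)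
    then show ?thesis
      using cl sww(1) UV1 loop_props(1)[OF x(1)] unfolding split by (simp add: G B.m_assoc)
  qed
qed

lemma img_scaled_path:
  assumes "(i, cs, j) \<in> paths Q" "c \<in> carrier K"
  shows "img c (i, cs, j) = V i \<otimes> word_img c (arrow_word cs) \<otimes> U j"
proof -
  note b = path_bounds[OF assms(1)]
  have w: "arrow_word cs \<in> lists X"
    by (rule path_word_lists[OF assms(1)])
  have cl: "V i \<in> carrier B" "U j \<in> carrier B" "img c (i, [], i) \<in> carrier B"
    using b assms by (auto intro!: V_closed U_closed img_closed vertex_path)
  have "img c (i, cs, j) = (img c (i, [], i) \<otimes> V i) \<otimes> word_prod (arrow_word cs) \<otimes> U j"
    using img_scalar(1)[OF assms(2,1)] img_path[OF assms(1)] cl word_prod_props(1)[OF w]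
    by (simp add: B.m_assoc)
  then show ?thesis
    using b assms scalar_V[of i c] cl word_prod_props(1)[OF w] scalar_closed[OF assms(2)]
    by (simp add: B.m_assoc word_img_def)
qed

sublocale rho: basis_algebra_map K "lists X" "{[]}" "\<lambda>u v. Some (u @ v)" B word_img
proof (intro basis_algebra_map.intro basis_algebra_map_axioms.intro fa.basis_algebra_axioms B.ring_axioms)
  fix c d p q assume c: "c \<in> carrier K" and p: "p \<in> lists X"
  note sp = word_prod_props[OF p] scalar_closed[OF c]
  show "word_img c p \<in> carrier B" using sp by (simp add: word_img_def)
  assume d: "d \<in> carrier K"
  have "(1, [], 1) \<in> paths Q" using n_pos by (intro vertex_path) simp_all
  then have "scalar (c \<oplus>\<^bsub>K\<^esub> d) = scalar c \<oplus> scalar d"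
    using c d by (simp add: scalar_def pa.trm_add ring_hom_add[OF Psi_hom] pa.trm_closed)
  then show "word_img (c \<oplus>\<^bsub>K\<^esub> d) p = word_img c p \<oplus> word_img d p"
    using sp scalar_closed[OF d] by (simp add: word_img_def B.l_distr)
  assume q: "q \<in> lists X"
  note sq = word_prod_props[OF q] scalar_closed[OF d]
  have "word_img c p \<otimes> word_img d q = scalar c \<otimes> (word_prod p \<otimes> scalar d) \<otimes> word_prod q"
    using sp sq by (simp add: word_img_def B.m_assoc)
  also have "\<dots> = scalar c \<otimes> (scalar d \<otimes> word_prod p) \<otimes> word_prod q" using sp(4)[OF d] by simp
  also have "\<dots> = word_img (c \<otimes>\<^bsub>K\<^esub> d) (p @ q)"
    using sp(1,5) sq(1,5) c d
    by (simp add: word_img_def word_prod_append[OF p q] scalar_mult[symmetric] B.m_assoc)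
  finally show "word_img c p \<otimes> word_img d q =
      (case Some (p @ q) of None \<Rightarrow> \<zero> | Some r \<Rightarrow> word_img (c \<otimes>\<^bsub>K\<^esub> d) r)" by simp
qed

abbreviation \<rho>' where "\<rho>' \<equiv> rho.lin"

lemma rho_one: "\<rho>' \<one>\<^bsub>fa.alg\<^esub> = v 1"
proof -
  have "v 1 \<in> carrier B" using n_pos by (intro v_closed) simp_all
  then show ?thesis
    using scalar_absorb(2)[OF one_K_closed] rho.lin_one
    by (simp add: word_img_def) (simp add: scalar_def)
qed

lemma rho_absorb:
  assumes "x \<in> carrier fa.alg"
  shows "v 1 \<otimes> \<rho>' x = \<rho>' x" "\<rho>' x \<otimes> v 1 = \<rho>' x"
  using rho.lin_mult[OF fa.alg_one_closed assms] rho.lin_mult[OF assms fa.alg_one_closed] assms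
  by (simp_all add: fa.alg_mult_one rho_one)

text \<open>The relation \<open>y'\<close> gives \<open>y(s) U n = 0\<close>, because all its paths run from \<open>1\<close> to \<open>n\<close>, and \<open>U n\<close> is cancelled
  by \<open>V n\<close>.\<close>
lemma rho_kills:
  assumes y: "y \<in> Y" shows "\<rho>' y = \<zero>"
proof -
  let ?W = "{w. y w \<noteq> \<zero>\<^bsub>K\<^esub>}"
  have yc: "y \<in> carrier fa.alg" using y fq.Y_subset by blast
  have n1: "1 \<le> n" "n \<le> n" using n_pos by simp_all
  have cl: "\<rho>' y \<in> carrier B" "U n \<in> carrier B" "V n \<in> carrier B" "v 1 \<in> carrier B"
    using n_pos yc rho.lin_closed by (auto intro!: U_closed V_closed v_closed)
  have wi: "word_img (y w) w \<in> carrier B" "img (y w) (word_path n w) = word_img (y w) w \<otimes> U n"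
    if w: "w \<in> ?W" for w
  proof -
    have "y w \<noteq> \<zero>\<^bsub>K\<^esub>" using w by simp
    note wb = word_bound[OF y this]
    show cl': "word_img (y w) w \<in> carrier B"
      by (rule rho.H_closed[OF fa.alg_coeff_closed[OF yc] wb(1)])
    obtain cs where cs: "word_path n w = (1, cs, n)" unfolding word_path_def by blast
    have p: "(1, cs, n) \<in> paths Q" using word_path_path[OF wb] unfolding cs .
    have "v 1 \<otimes> word_img (y w) w = word_img (y w) w"
      using scalar_absorb(1) scalar_closed fa.alg_coeff_closed[OF yc] word_prod_props[OF wb(1)] cl
      by (simp add: word_img_def B.m_assoc[symmetric])
    then show "img (y w) (word_path n w) = word_img (y w) w \<otimes> U n"
      unfolding cs img_scaled_path[OF p fa.alg_coeff_closed[OF yc]] arrow_word_word_path[OF cs]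
      by (simp add: V_1)
  qed
  have "\<zero> = \<Psi> (Y_rel K n X y)"
    using y by (intro Psi_rels[symmetric]) (simp add: loc_rels_def Let_def)
  also have "\<dots> = (\<Oplus>w\<in>?W. img (y w) (word_path n w))"
    unfolding Y_rel_def path_algebra_def
    by (rule additive_finsum[where h = \<Psi>])
       (use y in \<open>auto simp: pa.alg_abelian_group B.abelian_group_axioms
          ring_hom_closed[OF Psi_hom] ring_hom_add[OF Psi_hom] word_term_closed\<close>)
  also have "\<dots> = (\<Oplus>w\<in>?W. word_img (y w) w \<otimes> U n)"
    using wi cl by (intro B.finsum_cong') auto
  also have "\<dots> = \<rho>' y \<otimes> U n"
    unfolding linear_ext_def
    using fa.alg_finite_support[OF yc] cl wi by (intro B.finsum_ldistr[symmetric]) auto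
  finally have "\<rho>' y \<otimes> U n = \<zero>" by (rule sym)
  then have "\<rho>' y \<otimes> U n \<otimes> V n = \<zero>" using cl by simp
  then have "\<rho>' y \<otimes> v 1 = \<zero>" using cl by (simp add: B.m_assoc UV n_pos)
  then show ?thesis using rho_absorb[OF yc] by simp
qed

definition \<rho> where "\<rho> = factor_map \<rho>'"

lemma rho_cls: "x \<in> carrier fa.alg \<Longrightarrow> \<rho> (fq.cls x) = \<rho>' x"
  unfolding \<rho>_def
  by (rule fq.factor_map_cls[OF B.ring_axioms rho.lin_closed rho.lin_add rho.lin_mult rho_kills])

lemma rho_props:
  assumes "t \<in> carrier fq.RQ"
  shows "\<rho> t \<in> carrier B" "v 1 \<otimes> \<rho> t = \<rho> t"
    "\<And>u. u \<in> carrier fq.RQ \<Longrightarrow> \<rho> (t \<oplus>\<^bsub>fq.RQ\<^esub> u) = \<rho> t \<oplus> \<rho> u"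
    "\<And>u. u \<in> carrier fq.RQ \<Longrightarrow> \<rho> (t \<otimes>\<^bsub>fq.RQ\<^esub> u) = \<rho> t \<otimes> \<rho> u"
proof -
  obtain x where x: "x \<in> carrier fa.alg" "t = fq.cls x" using assms by (rule fq.quot_carrierE)
  show "\<rho> t \<in> carrier B" "v 1 \<otimes> \<rho> t = \<rho> t"
    using x by (simp_all add: rho_cls rho.lin_closed rho_absorb)
  fix u assume "u \<in> carrier fq.RQ"
  then obtain y where y: "y \<in> carrier fa.alg" "u = fq.cls y" by (rule fq.quot_carrierE)
  show "\<rho> (t \<oplus>\<^bsub>fq.RQ\<^esub> u) = \<rho> t \<oplus> \<rho> u" "\<rho> (t \<otimes>\<^bsub>fq.RQ\<^esub> u) = \<rho> t \<otimes> \<rho> u"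
    using x y
    by (simp_all add: ring_hom_add[OF fq.cls_hom, symmetric] ring_hom_mult[OF fq.cls_hom, symmetric]
        rho_cls fa.alg_add_closed fa.alg_mult_closed rho.lin_add rho.lin_mult)
qed

text \<open>The image of the matrix with the single entry \<open>t\<close> in position \<open>p\<close>.\<close>
definition entry_img where "entry_img t p = V (fst p) \<otimes> \<rho> t \<otimes> U (snd p)"

lemma rho_one_quot: "\<rho> \<one>\<^bsub>fq.RQ\<^esub> = v 1"
  using rho_cls[OF fa.alg_one_closed] ring_hom_one[OF fq.cls_hom] rho_one by simp

lemma sum_v: "(\<Oplus>i\<in>{1..n}. v i) = \<one>"
proof -
  have "\<one> = \<Psi> \<one>\<^bsub>pa.alg\<^esub>" using ring_hom_one[OF Psi_hom] by simp
  also have "\<dots> = \<Psi> (\<Oplus>\<^bsub>pa.alg\<^esub>p\<in>{(v, [], v) | v. v \<in> verts Q}. trm \<one>\<^sub>K p)"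
    by (rule arg_cong[OF pa.alg_one_eq_sum])
  also have "\<dots> = (\<Oplus>p\<in>{(v, [], v) | v. v \<in> verts Q}. img \<one>\<^sub>K p)"
  proof (rule additive_finsum[where h = \<Psi>])
    fix p :: "(nat, 'x arrow) path" assume "p \<in> {(v, [], v) | v. v \<in> verts Q}"
    then show "trm \<one>\<^sub>K p \<in> carrier pa.alg"
      using pa.units_subset by (intro pa.trm_closed one_K_closed) blast
  qed (simp_all add: pa.alg_abelian_group B.abelian_group_axioms ring_hom_closed[OF Psi_hom]
          ring_hom_add[OF Psi_hom])
  also have "\<dots> = (\<Oplus>p\<in>(\<lambda>v. (v, [], v)) ` {1..n}. img \<one>\<^sub>K p)"
    by (rule arg_cong[where f = "finsum B (img \<one>\<^sub>K)"]) (auto simp: loc_quiver_simps)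
  also have "\<dots> = (\<Oplus>i\<in>{1..n}. v i)"
    by (subst B.finsum_reindex) (auto simp: inj_on_def intro!: img_closed vertex_path)
  finally show ?thesis by simp
qed

lemma UV_orthogonal:
  assumes "j \<in> {1..n}" "k \<in> {1..n}" "j \<noteq> k"
  shows "U j \<otimes> V k = \<zero>"
proof -
  have c: "1 \<le> j" "j \<le> n" "1 \<le> k" "k \<le> n" using assms by auto
  note cl = U_closed[OF c(1,2)] V_closed[OF c(3,4)] v_closed[OF c(1,2)] v_closed[OF c(3,4)]
  have "U j \<otimes> V k = (U j \<otimes> v j) \<otimes> (v k \<otimes> V k)" using c by (simp add: U_absorb V_absorb)
  also have "\<dots> = U j \<otimes> (v j \<otimes> v k) \<otimes> V k" using cl by (simp add: B.m_assoc)
  also have "\<dots> = \<zero>" using cl v_mult_zero[OF assms] by simp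
  finally show ?thesis .
qed

lemma entry_map: "basis_algebra_map fq.RQ ({1..n} \<times> {1..n}) (Id_on {1..n}) pair_comp B entry_img"
proof (intro basis_algebra_map.intro basis_algebra_map_axioms.intro ma.mb.basis_algebra_axioms B.ring_axioms)
  fix c d p q assume c: "c \<in> carrier fq.RQ" and p: "p \<in> {1..n} \<times> {1..n}"
  obtain i j where p_eq: "p = (i, j)" "1 \<le> i" "i \<le> n" "1 \<le> j" "j \<le> n" using p by (cases p) auto
  note rc = rho_props[OF c] and Vi = V_closed[OF p_eq(2,3)] and Uj = U_closed[OF p_eq(4,5)]
  show "entry_img c p \<in> carrier B" using rc Vi Uj by (simp add: entry_img_def p_eq)
  assume d: "d \<in> carrier fq.RQ"
  note rd = rho_props[OF d]
  show "entry_img (c \<oplus>\<^bsub>fq.RQ\<^esub> d) p = entry_img c p \<oplus> entry_img d p"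
    using rc rd(1) Vi Uj d by (simp add: entry_img_def p_eq(1) B.l_distr B.r_distr)
  assume q: "q \<in> {1..n} \<times> {1..n}"
  obtain k l where q_eq: "q = (k, l)" "1 \<le> k" "k \<le> n" "1 \<le> l" "l \<le> n" using q by (cases q) auto
  note Vk = V_closed[OF q_eq(2,3)] and Ul = U_closed[OF q_eq(4,5)]
  have prod: "entry_img c p \<otimes> entry_img d q = V i \<otimes> \<rho> c \<otimes> ((U j \<otimes> V k) \<otimes> \<rho> d) \<otimes> U l"
    using rc(1) rd(1) Vi Uj Vk Ul by (simp add: entry_img_def p_eq(1) q_eq(1) B.m_assoc)
  show "entry_img c p \<otimes> entry_img d q =
      (case pair_comp p q of None \<Rightarrow> \<zero> | Some x \<Rightarrow> entry_img (c \<otimes>\<^bsub>fq.RQ\<^esub> d) x)"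
  proof (cases "j = k")
    case True
    then show ?thesis
      unfolding prod using rc rd Vi Ul d p_eq q_eq
      by (simp add: UV entry_img_def B.m_assoc)
  next
    case False
    then have "U j \<otimes> V k = \<zero>" using p_eq q_eq by (intro UV_orthogonal) auto
    then show ?thesis
      unfolding prod using False rc(1) rd(1) Vi Ul by (simp add: p_eq(1) q_eq(1))
  qed
qed

lemma extension_exists:
  "\<exists>\<theta>\<in>ring_hom ma.M B. \<forall>a\<in>carrier pq.RQ. \<theta> (\<phi> a) = \<psi> a"
proof -
  have "(\<Oplus>i\<in>{1..n}. entry_img \<one>\<^bsub>fq.RQ\<^esub> (i, i)) = (\<Oplus>i\<in>{1..n}. v i)"
    by (intro B.finsum_cong')
       (auto simp: entry_img_def rho_one_quot V_absorb UV intro!: v_closed)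
  then obtain \<theta> where hom: "\<theta> \<in> ring_hom ma.M B"
    and val: "\<And>t p. \<lbrakk>t \<in> carrier fq.RQ; p \<in> {1..n} \<times> {1..n}\<rbrakk> \<Longrightarrow> \<theta> (ma.emat t p) = entry_img t p"
    using ma.matrix_hom_exists[OF entry_map] sum_v by auto
  have "\<theta> (\<Phi> x) = \<Psi> x" if "x \<in> carrier pa.alg" for x
    using that
  proof (induction x rule: pa.alg_induct)
    case zero
    show ?case
      using ring_hom_zero[OF hom ma.matrix_ring_ring B.ring_axioms]
        ring_hom_zero[OF Psi_hom pa.alg_ring B.ring_axioms] by (simp add: pm.lin_zero)
  next
    case (add c p x)
    obtain i cs j where p: "p = (i, cs, j)" by (cases p)
    have path: "(i, cs, j) \<in> paths Q" using add p by simp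
    have w: "arrow_word cs \<in> lists X"
      by (rule path_word_lists[OF path])
    have "(i, j) \<in> {1..n} \<times> {1..n}" using path_bounds[OF path] by auto
    then have "\<theta> (\<Phi> (trm c p)) = V i \<otimes> word_img c (arrow_word cs) \<otimes> U j"
      unfolding p Phi_trm[OF add(1) path]
      using word_cls_closed[OF add(1) w] rho_cls[OF fa.trm_closed[OF add(1) w]] rho.lin_trm[OF add(1) w]
      by (simp add: val entry_img_def)
    then have "\<theta> (\<Phi> (trm c p)) = img c p"
      using img_scaled_path[OF path add(1)] p by simp
    then show ?case
      using add by (simp add: pm.lin_add pa.trm_closed ring_hom_add[OF hom] ring_hom_add[OF Psi_hom] pm.lin_closed)
  qed
  then have "\<theta> (\<phi> a) = \<psi> a" if "a \<in> carrier pq.RQ" for a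
    using that by (elim pq.quot_carrierE) (simp add: phi_cls \<Psi>_def)
  with hom show ?thesis by blast
qed

text \<open>If \<open>n = 1\<close> then every word occurring in \<open>Y\<close> is empty, so \<open>Y\<close> contains a nonzero scalar.\<close>
lemma trivial_if_one_vertex:
  assumes "n = 1" shows "\<one>\<^bsub>fq.RQ\<^esub> = \<zero>\<^bsub>fq.RQ\<^esub>"
proof -
  interpret KF: field K by (rule K)
  obtain y w where y: "y \<in> Y" and w: "y w \<noteq> \<zero>\<^bsub>K\<^esub>"
    using assms by (auto simp: size_of_pres_def Let_def split: if_splits)
  have nil: "u = []" if "y u \<noteq> \<zero>\<^bsub>K\<^esub>" for u
    using word_bound(2)[OF y that] assms by simp
  let ?c = "y []"
  have yc: "y \<in> carrier fa.alg" using y fq.Y_subset by blast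
  have c: "?c \<in> carrier K" "?c \<noteq> \<zero>\<^bsub>K\<^esub>" using w nil fa.alg_coeff_closed[OF yc] by auto
  then have inv: "inv\<^bsub>K\<^esub> ?c \<in> carrier K" "inv\<^bsub>K\<^esub> ?c \<otimes>\<^bsub>K\<^esub> ?c = \<one>\<^sub>K"
    using KF.field_Units by auto
  have "y u = trm ?c [] u" for u using nil[of u] by (auto simp: term_elt_def)
  then have "y = trm ?c []" by (rule ext)
  then have "trm \<one>\<^sub>K [] = trm (inv\<^bsub>K\<^esub> ?c) [] \<otimes>\<^bsub>fa.alg\<^esub> y"
    using fa.trm_mult[OF inv(1) c(1), of "[]" "[]"] inv by simp
  moreover have "y \<in> fq.J" using y fq.genideal_self[OF fq.Y_subset] by blast
  ultimately have "trm \<one>\<^sub>K [] \<in> fq.J"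
    using fq.J.I_l_closed fa.trm_closed[OF inv(1), of "[]"] by simp
  then show ?thesis using fq.cls_eq_zero word_cls_one by metis
qed

text \<open>A homomorphism compatible with \<open>\<phi>\<close> and \<open>\<psi>\<close> is known on the matrix units on and above the diagonal. On the first
  column it is forced by uniqueness of inverses, on a generator in position \<open>(1, 1)\<close> because this is the image of
  \<open>a\<^sub>1\<^sub>i\<close> times a matrix unit of the first column, and products and sums of these are all matrices.\<close>
lemma extension_values:
  assumes hom: "\<theta> \<in> ring_hom ma.M B" and val: "\<And>a. a \<in> carrier pq.RQ \<Longrightarrow> \<theta> (\<phi> a) = \<psi> a"
    and t: "t \<in> carrier fq.RQ" and ij: "i \<in> {1..n}" "j \<in> {1..n}"
  shows "\<theta> (ma.emat t (i, j)) = entry_img t (i, j)"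
proof -
  have one: "\<one>\<^bsub>fq.RQ\<^esub> \<in> carrier fq.RQ" by (rule ma.one_closed)
  have n1: "1 \<in> {1..n}" using n_pos by simp
  have path: "\<theta> (ma.emat (fq.cls (trm c (arrow_word cs))) (k, l)) = img c (k, cs, l)"
    if "c \<in> carrier K" "(k, cs, l) \<in> paths Q" for c k cs l
  proof -
    have "pq.cls (trm c (k, cs, l)) \<in> carrier pq.RQ"
      using that by (intro ring_hom_closed[OF pq.cls_hom] pa.trm_closed)
    from val[OF this] show ?thesis using phi_trm[OF that] by (simp add: \<Psi>_def)
  qed
  have row: "\<theta> (ma.emat \<one>\<^bsub>fq.RQ\<^esub> (1, k)) = U k" if "k \<in> {1..n}" for k
    using path[OF one_K_closed, of 1 "map E [1..<k]" k] e_path_path[of 1 k n X] that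
    by (simp add: arrow_word_E word_cls_one U_def e_path_def)
  have unit: "\<theta> (ma.emat \<one>\<^bsub>fq.RQ\<^esub> (k, k)) = v k" if "k \<in> {1..n}" for k
    using path[OF one_K_closed, of k "[]" k] vertex_path[of k n X] that
    by (simp add: word_cls_one)
  have mult: "\<theta> (ma.emat a (k, l)) \<otimes> \<theta> (ma.emat b (l, m)) = \<theta> (ma.emat (a \<otimes>\<^bsub>fq.RQ\<^esub> b) (k, m))"
    if "a \<in> carrier fq.RQ" "b \<in> carrier fq.RQ" "k \<in> {1..n}" "l \<in> {1..n}" "m \<in> {1..n}" for a b k l m
    using ring_hom_mult[OF hom ma.emat_closed ma.emat_closed, of a "(k, l)" b "(l, m)"] that
    by (simp add: ma.emat_mult)
  have closed: "\<theta> (ma.emat a (k, l)) \<in> carrier B"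
    if "a \<in> carrier fq.RQ" "k \<in> {1..n}" "l \<in> {1..n}" for a k l
    using that by (intro ring_hom_closed[OF hom] ma.emat_closed) auto
  \<comment> \<open>The image of the unit at \<open>(k, 1)\<close> is inverse to \<open>U k\<close>, and so is \<open>V k\<close>.\<close>
  have col: "\<theta> (ma.emat \<one>\<^bsub>fq.RQ\<^esub> (k, 1)) = V k" if k: "k \<in> {1..n}" for k
  proof -
    let ?x = "\<theta> (ma.emat \<one>\<^bsub>fq.RQ\<^esub> (k, 1))"
    have k': "1 \<le> k" "k \<le> n" using k by auto
    have "?x = ?x \<otimes> v 1" using mult[OF one one k n1 n1] unit[OF n1] by simp
    also have "\<dots> = (?x \<otimes> U k) \<otimes> V k"
      using closed[OF one k n1] U_closed[OF k'] V_closed[OF k'] UV(1)[OF k'] by (simp add: B.m_assoc)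
    also have "?x \<otimes> U k = v k" using mult[OF one one k n1 k] row[OF k] unit[OF k] by simp
    also have "v k \<otimes> V k = V k" using V_absorb(1)[OF k'] .
    finally show ?thesis .
  qed
  have gen: "\<theta> (ma.emat (fq.cls (trm \<one>\<^sub>K [x])) (1, 1)) = loop x" if x: "x \<in> X" for x
  proof (cases "1 < n")
    case True
    have two: "2 \<in> {1..n}" using True by simp
    have p: "(1, [G 1 x], 2) \<in> paths Q" using arrow_path(2)[of 1 n x X] True x by simp
    have xw: "fq.cls (trm \<one>\<^sub>K [x]) \<in> carrier fq.RQ" using x by (intro word_cls_closed one_K_closed) simp
    show ?thesis
      using mult[OF xw one n1 two n1] path[OF one_K_closed p] col[OF two] True xw
      by (simp add: loop_def)
  next
    case False
    then have "n = 1" using n_pos by simp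
    then have "\<one>\<^bsub>fq.RQ\<^esub> = \<zero>\<^bsub>fq.RQ\<^esub>" by (rule trivial_if_one_vertex)
    moreover have xw: "fq.cls (trm \<one>\<^sub>K [x]) \<in> carrier fq.RQ" using x by (intro word_cls_closed one_K_closed) simp
    ultimately have "fq.cls (trm \<one>\<^sub>K [x]) = \<zero>\<^bsub>fq.RQ\<^esub>"
      by (metis ma.l_one ma.l_null)
    then show ?thesis
      using False ring_hom_zero[OF hom ma.matrix_ring_ring B.ring_axioms] by (simp add: ma.emat_zero loop_def)
  qed
  have word: "\<theta> (ma.emat (fq.cls (trm c w)) (1, 1)) = word_img c w"
    if c: "c \<in> carrier K" and w: "w \<in> lists X" for c w
    using w
  proof (induction w)
    case Nil
    show ?case
      using path[OF c, of 1 "[]" 1] vertex_path[of 1 n X] n_pos c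
      by (simp add: word_img_def scalar_absorb) (simp add: scalar_def)
  next
    case (Cons x w)
    then have x: "x \<in> X" and w: "w \<in> lists X" by auto
    have xw: "fq.cls (trm \<one>\<^sub>K [x]) \<in> carrier fq.RQ" using x by (intro word_cls_closed one_K_closed) simp
    have "fq.cls (trm c (x # w)) = fq.cls (trm \<one>\<^sub>K [x]) \<otimes>\<^bsub>fq.RQ\<^esub> fq.cls (trm c w)"
      using word_cls_mult[OF one_K_closed c _ w, of "[x]"] x c by simp
    then have "\<theta> (ma.emat (fq.cls (trm c (x # w))) (1, 1)) = loop x \<otimes> word_img c w"
      using mult[OF xw word_cls_closed[OF c w] n1 n1 n1] gen[OF x] Cons.IH by simp
    also have "\<dots> = (loop x \<otimes> scalar c) \<otimes> word_prod w"
      using loop_props(1)[OF x] scalar_closed[OF c] word_prod_props(1)[OF w] by (simp add: word_img_def B.m_assoc)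
    also have "\<dots> = (scalar c \<otimes> loop x) \<otimes> word_prod w" by (simp only: loop_props(4)[OF x c])
    also have "\<dots> = word_img c (x # w)"
      using loop_props(1)[OF x] scalar_closed[OF c] word_prod_props(1)[OF w]
      by (simp add: word_img_def B.m_assoc)
    finally show ?case .
  qed
  have corner: "\<theta> (ma.emat (fq.cls x) (1, 1)) = \<rho>' x" if "x \<in> carrier fa.alg" for x
    using that
  proof (induction x rule: fa.alg_induct)
    case zero
    have "fq.cls \<zero>\<^bsub>fa.alg\<^esub> = \<zero>\<^bsub>fq.RQ\<^esub>"
      by (rule ring_hom_zero[OF fq.cls_hom fa.alg_ring fq.quot_ring])
    then show ?case
      using ring_hom_zero[OF hom ma.matrix_ring_ring B.ring_axioms]
      by (simp add: ma.emat_zero rho.lin_zero)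
  next
    case (add c w x)
    have cl: "fq.cls (trm c w) \<in> carrier fq.RQ" "fq.cls x \<in> carrier fq.RQ"
      by (rule word_cls_closed[OF add(1,2)], rule ring_hom_closed[OF fq.cls_hom add(3)])
    have tw: "trm c w \<in> carrier fa.alg" by (rule fa.trm_closed[OF add(1,2)])
    have sq: "(1, 1) \<in> {1..n} \<times> {1..n}" using n1 by simp
    have "\<theta> (ma.emat (fq.cls (trm c w \<oplus>\<^bsub>fa.alg\<^esub> x)) (1, 1)) =
        \<theta> (ma.emat (fq.cls (trm c w)) (1, 1)) \<oplus> \<theta> (ma.emat (fq.cls x) (1, 1))"
      using add(3) tw cl
      by (simp add: ring_hom_add[OF fq.cls_hom] ma.emat_add[OF _ _ sq]
          ring_hom_add[OF hom] ma.emat_closed[OF _ sq])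
    then show ?case
      using add(3,4) tw word[OF add(1,2)] rho.lin_trm[OF add(1,2)] by (simp add: rho.lin_add)
  qed
  obtain x where x: "x \<in> carrier fa.alg" "t = fq.cls x" using t by (rule fq.quot_carrierE)
  have "\<theta> (ma.emat t (1, 1)) = \<rho> t" using corner[OF x(1)] rho_cls[OF x(1)] x(2) by simp
  moreover have "\<theta> (ma.emat t (i, j)) =
      \<theta> (ma.emat \<one>\<^bsub>fq.RQ\<^esub> (i, 1)) \<otimes> \<theta> (ma.emat t (1, 1)) \<otimes> \<theta> (ma.emat \<one>\<^bsub>fq.RQ\<^esub> (1, j))"
    using mult[OF one t ij(1) n1 n1] mult[OF t one ij(1) n1 ij(2)] t by simp
  ultimately show ?thesis using row[OF ij(2)] col[OF ij(1)] by (simp add: entry_img_def)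
qed

lemma extension_unique:
  "\<exists>!\<theta>. \<theta> \<in> ring_hom ma.M B \<and> \<theta> \<in> extensional (carrier ma.M) \<and> (\<forall>a\<in>carrier pq.RQ. \<theta> (\<phi> a) = \<psi> a)"
proof -
  obtain \<theta> where \<theta>: "\<theta> \<in> ring_hom ma.M B" "\<And>a. a \<in> carrier pq.RQ \<Longrightarrow> \<theta> (\<phi> a) = \<psi> a"
    using extension_exists by blast
  let ?\<theta> = "restrict \<theta> (carrier ma.M)"
  show ?thesis
  proof (rule ex1I[of _ ?\<theta>], intro conjI ballI)
    show "?\<theta> \<in> ring_hom ma.M B"
      using \<theta>(1) by (auto simp: ring_hom_def)
    show "?\<theta> (\<phi> a) = \<psi> a" if "a \<in> carrier pq.RQ" for a
      using \<theta>(2)[OF that] ring_hom_closed[OF phi_hom that] by simp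
  next
    fix \<eta> assume \<eta>: "\<eta> \<in> ring_hom ma.M B \<and> \<eta> \<in> extensional (carrier ma.M) \<and>
        (\<forall>a\<in>carrier pq.RQ. \<eta> (\<phi> a) = \<psi> a)"
    have "\<eta> A = \<theta> A" if "A \<in> carrier ma.M" for A
      using \<eta> \<theta>
      by (intro ma.matrix_hom_eqI[OF _ \<theta>(1) B.ring_axioms that]) (simp_all add: extension_values)
    then show "\<eta> = ?\<theta>"
      using \<eta> by (intro extensionalityI[of _ "carrier ma.M"]) auto
  qed simp
qed

end

section \<open>The universal localization\<close>

context presentation begin

lemma matrix_ring_universal_localization:
  "universal_localization TYPE('u) (loc_algebra K X Y) (loc_maps K X Y) ma.M \<phi>"
proof -
  have "\<exists>!\<theta>. \<theta> \<in> ring_hom ma.M B \<and> \<theta> \<in> extensional (carrier ma.M) \<and> (\<forall>a\<in>carrier pq.RQ. \<theta> (\<phi> a) = \<psi> a)"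
    if inv: "inverting (loc_algebra K X Y) (loc_maps K X Y) B \<psi>" for B :: "'u ring" and \<psi>
  proof -
    have B: "ring B" "\<psi> \<in> ring_hom pq.RQ B"
      using inv by (simp_all add: inverting_def loc_algebra_eq)
    let ?inv = "\<lambda>m x. x \<in> carrier B \<and>
      \<psi> (pcls (m + 1, [], m + 1)) \<otimes>\<^bsub>B\<^esub> x = x \<and> x \<otimes>\<^bsub>B\<^esub> \<psi> (pcls (m, [], m)) = x \<and>
      \<psi> (pcls (m, [E m], m + 1)) \<otimes>\<^bsub>B\<^esub> x = \<psi> (pcls (m, [], m)) \<and>
      x \<otimes>\<^bsub>B\<^esub> \<psi> (pcls (m, [E m], m + 1)) = \<psi> (pcls (m + 1, [], m + 1))"
    have "\<forall>m. \<exists>x. 1 \<le> m \<and> m < n \<longrightarrow> ?inv m x"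
      using inv[unfolded inverting_iff[OF B]] by blast
    from choice[OF this] obtain g where g: "\<forall>m. 1 \<le> m \<and> m < n \<longrightarrow> ?inv m (g m)" ..
    interpret inverted_presentation K X Y B \<psi> g
    proof (intro inverted_presentation.intro inverted_presentation_axioms.intro presentation_axioms B)
      show "?inv m (g m)" if "1 \<le> m" "m < n" for m
        using g that by (simp only: simp_thms)
    qed
    show ?thesis by (rule extension_unique)
  qed
  then show ?thesis
    unfolding universal_localization_def
    using loc_maps_fg_projective phi_inverting pq.quot_ring by (simp add: loc_algebra_eq)
qed

end

text \<open>Endomorphisms compatible with \<open>\<phi>\<close> are unique only as extensional functions, so both \<open>h\<close> and the
  identity are restricted to the carrier before they are compared.\<close>
lemma universal_localization_endo_id:
  assumes L: "universal_localization TYPE('l) A \<sigma> (L :: 'l ring) \<phi>"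
    and h: "h \<in> ring_hom L L" "\<And>a. a \<in> carrier A \<Longrightarrow> h (\<phi> a) = \<phi> a" and x: "x \<in> carrier L"
  shows "h x = x"
proof -
  have inv: "inverting A \<sigma> L \<phi>" using L by (simp add: universal_localization_def)
  then have phi: "\<phi> \<in> ring_hom A L" by (simp add: inverting_def)
  have ex1: "\<exists>!\<theta>. \<theta> \<in> ring_hom L L \<and> \<theta> \<in> extensional (carrier L) \<and> (\<forall>a\<in>carrier A. \<theta> (\<phi> a) = \<phi> a)"
    using L inv by (simp add: universal_localization_def)
  have r: "restrict k (carrier L) \<in> ring_hom L L \<and> restrict k (carrier L) \<in> extensional (carrier L) \<and>
      (\<forall>a\<in>carrier A. restrict k (carrier L) (\<phi> a) = \<phi> a)"
    if "k \<in> ring_hom L L" "\<And>a. a \<in> carrier A \<Longrightarrow> k (\<phi> a) = \<phi> a" for k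
  proof -
    have "ring L" using inv by (simp add: inverting_def)
    then interpret ring L .
    show ?thesis using that ring_hom_closed[OF phi] by (auto simp: ring_hom_def)
  qed
  have "restrict h (carrier L) = restrict id (carrier L)"
    using ex1 r[OF h] r[of id] by (auto simp: ring_hom_def)
  then show ?thesis using x by (metis id_apply restrict_apply')
qed

text \<open>Each of the two rings serves as a test ring for the other and for itself, which is why both
  element types occur.\<close>
lemma universal_localization_unique:
  fixes L :: "'l ring" and M :: "'r ring"
  assumes L: "universal_localization TYPE('l) A \<sigma> L \<phi>" "universal_localization TYPE('r) A \<sigma> L \<phi>"
    and M: "universal_localization TYPE('l) A \<sigma> M \<chi>" "universal_localization TYPE('r) A \<sigma> M \<chi>"
  shows "L \<simeq> M"
proof -
  have inv: "inverting A \<sigma> L \<phi>" "inverting A \<sigma> M \<chi>"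
    using L M by (simp_all add: universal_localization_def)
  obtain f where f: "f \<in> ring_hom L M" "\<And>a. a \<in> carrier A \<Longrightarrow> f (\<phi> a) = \<chi> a"
    using L(2) inv(2) unfolding universal_localization_def by blast
  obtain h where h: "h \<in> ring_hom M L" "\<And>a. a \<in> carrier A \<Longrightarrow> h (\<chi> a) = \<phi> a"
    using M(1) inv(1) unfolding universal_localization_def by blast
  have "h (f x) = x" if "x \<in> carrier L" for x
    using universal_localization_endo_id[OF L(1) ring_hom_trans[OF f(1) h(1)] _ that] f h by simp
  moreover have "f (h x) = x" if "x \<in> carrier M" for x
    using universal_localization_endo_id[OF M(2) ring_hom_trans[OF h(1) f(1)] _ that] f h by simp
  ultimately have "bij_betw f (carrier L) (carrier M)"
    using f h by (intro bij_betw_byWitness[where f' = h]) (auto simp: ring_hom_closed)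
  then show ?thesis using f(1) by (auto simp: is_ring_iso_def ring_iso_def)
qed

theorem theorem1p1:
  fixes K :: "('k, 'm) ring_scheme" and X :: "'x set" and Y :: "('x list \<Rightarrow> 'k) set"
  assumes "field K"
    and "finite X"
    and "finite Y" and "Y \<subseteq> carrier (free_algebra K X)"
  shows
    "(\<exists>\<phi>. universal_localization TYPE('u) (loc_algebra K X Y) (loc_maps K X Y)
           (matrix_ring (size_of_pres K Y) (presented_algebra K X Y)) \<phi>) \<and>
     (\<forall>(L :: 'l ring) \<phi>.
        universal_localization TYPE('l) (loc_algebra K X Y) (loc_maps K X Y) L \<phi> \<and>
        universal_localization TYPE(nat \<times> nat \<Rightarrow> ('x list \<Rightarrow> 'k) set)
          (loc_algebra K X Y) (loc_maps K X Y) L \<phi> \<longrightarrow>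
        L \<simeq> matrix_ring (size_of_pres K Y) (presented_algebra K X Y))"
proof -
  interpret presentation K X Y using assms by (rule presentation.intro)
  show ?thesis
    unfolding presented_algebra_eq
  proof (intro conjI exI allI impI; (elim conjE)?)
    show "universal_localization TYPE('u) (loc_algebra K X Y) (loc_maps K X Y) ma.M \<phi>"
      by (rule matrix_ring_universal_localization)
    fix L :: "'l ring" and \<chi>
    assume "universal_localization TYPE('l) (loc_algebra K X Y) (loc_maps K X Y) L \<chi>"
      "universal_localization TYPE(nat \<times> nat \<Rightarrow> ('x list \<Rightarrow> 'k) set)
        (loc_algebra K X Y) (loc_maps K X Y) L \<chi>"
    then show "L \<simeq> ma.M"
      by (rule universal_localization_unique[OF _ _ matrix_ring_universal_localization
            matrix_ring_universal_localization])
  qed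
qed

end
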